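(* Assume that $P_X$ satisfies the following two conditions. (Small-ball condition) There are constants $C\ge1$ and $\alpha\in(0,1]$ such that for every $\theta\in\mathbb R^d\setminus\{0\}$ and $t>0$, $\mathbb P\big(|\langle\theta,X\rangle|\le t\,\|\Sigma^{1/2}\theta\|\big)\le(Ct)^\alpha$. ($L^2$–$L^4$ norm equivalence) There is a constant $\kappa>0$ such that for every $\theta\in\mathbb R^d$, $\mathbb E[\langle\theta,X\rangle^4]\le\kappa\,\mathbb E[\langle\theta,X\rangle^2]^2$. Let $C'=3C^4e^{1+9/\alpha}$. Let $P$ be a joint distribution of $(X,Y)$ with $X\sim P_X$, $\mathbb E[Y^2]<\infty$, $\beta^*=\Sigma^{-1}\mathbb E[YX]$ and $\varepsilon=Y-\langle\beta^*,X\rangle$, and assume that $$\chi:=\mathbb E\big[\mathbb E[\varepsilon^2|X]^2\,\|\Sigma^{-1/2}X\|^4\big]/d^2<+\infty$$ (note that $\chi\le\mathbb E[(Y-\langle\beta^*,X\rangle)^4\|\Sigma^{-1/2}X\|^4]/d^2$). Then, for $n\ge\max(96,6d)/\alpha$, the ordinary least squares estimator satisfies $$\mathbb E\big[\mathcal E_P(\widehat\beta_n^{\mathrm{LS}})\big]\le\frac1n\,\mathbb E\big[(Y-\langle\beta^*,X\rangle)^2\,\|\Sigma^{-1/2}X\|^2\big]+276\,C'^2\sqrt{\kappa\chi}\,\Big(\frac dn\Big)^{3/2}.$$ In particular, for $n\ge\max(96,6d)/\alpha$, $$\frac{\sigma^2d}{n}\;\le\;\inf_{\widehat\beta_n}\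 \sup_{P\in\mathcal P_{\mathrm{mis}}(P_X,\sigma^2)}\mathbb E\big[\mathcal E_P(\widehat\beta_n)\big]\;\le\;\frac{\sigma^2d}{n}\bigg(1+276\,C'^2\kappa\sqrt{\frac dn}\bigg).$$
   Context: Let $n,d\ge 1$ be integers, $\sigma^2>0$, and let $P_X$ be a probability distribution on $\mathbb R^d$ such that, for $X\sim P_X$, $\mathbb E\|X\|^2<\infty$ and $\Sigma:=\mathbb E[XX^\top]$ is invertible. The class $\mathcal P_{\mathrm{mis}}(P_X,\sigma^2)$ consists of all joint distributions $P$ of $(X,Y)$ with $X\sim P_X$ and $Y=\langle\beta^*,X\rangle+\varepsilon$, where $\beta^*\in\mathbb R^d$ is arbitrary, $\mathbb E[\varepsilon X]=0$ and $\mathbb E[\varepsilon^2|X]\le\sigma^2$ (the function $x\mapsto\mathbb E[Y|X=x]$ need not be linear). The risk of $\beta\in\mathbb R^d$ under $P$ is $R(\beta)=\mathbb E[(Y-\langle\beta,X\rangle)^2]$; it is uniquely minimized at $\beta^*=\Sigma^{-1}\mathbb E[YX]$, and the excess risk is $\mathcal E_P(\beta)=R(\beta)-R(\beta^* )=\|\Sigma^{1/2}(\beta-\beta^* )\|^2$. An estimator $\widehat\beta_n$ is an $\mathbb R^d$-valued measurable function of an i.i.d. sample $(X_1,Y_1),\dots,(X_n,Y_n)$ from $P$; the infimum is over all estimators and the expectation is over the sample. With $\widehat\Sigma_n=\frac1n\sum_{i=1}^nX_iX_i^\top$ (almost surely invertible under the small-ball condition when $n\ge d$), $\widehat\beta_n^{\mathrm{LS}}=\operatorname{argmin}_{\beta\in\mathbb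 R^d}\sum_{i=1}^n(Y_i-\langle\beta,X_i\rangle)^2=\widehat\Sigma_n^{-1}\frac1n\sum_{i=1}^nY_iX_i$ almost surely. *)

theory Defs
  imports "HOL-Probability.Probability"
begin

text \<open>
  A joint distribution of \<open>(X, Y)\<close> is a Borel probability measure \<open>P\<close> on \<open>real ^ 'd \<times> real\<close>,
  with \<open>X = fst\<close> and \<open>Y = snd\<close>.  Expectations of nonnegative quantities that need not be finite
  a priori are taken in \<^typ>\<open>ennreal\<close>.
\<close>

definition joint_distributions ::
    "(real ^ 'd) measure \<Rightarrow> ((real ^ 'd) \<times> real) measure set" where
  "joint_distributions PX = {P. prob_space P \<and> sets P = sets borel \<and> distr P borel fst = PX}"

definition second_moment :: "(real ^ 'd) measure \<Rightarrow> real ^ 'd ^ 'd" where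
  "second_moment PX = (\<chi> i j. LINT x|PX. x $ i * x $ j)"

definition pos_semidef :: "real ^ 'd ^ 'd \<Rightarrow> bool" where
  "pos_semidef A \<longleftrightarrow> transpose A = A \<and> (\<forall>v. 0 \<le> v \<bullet> (A *v v))"

text \<open>The unique positive semidefinite square root; only used for positive semidefinite \<open>A\<close>.\<close>

definition matrix_sqrt :: "real ^ 'd ^ 'd \<Rightarrow> real ^ 'd ^ 'd" where
  "matrix_sqrt A = (THE B. pos_semidef B \<and> B ** B = A)"

definition small_ball :: "(real ^ 'd) measure \<Rightarrow> real \<Rightarrow> real \<Rightarrow> bool" where
  "small_ball PX C \<alpha> \<longleftrightarrow> (\<forall>\<theta> t. \<theta> \<noteq> 0 \<longrightarrow> 0 < t \<longrightarrow>
     measure PX {x. \<bar>\<theta> \<bullet> x\<bar> \<le> t * norm (matrix_sqrt (second_moment PX) *v \<theta>)} \<le> (C * t) powr \<alpha>)"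

definition L2_L4_equiv :: "(real ^ 'd) measure \<Rightarrow> real \<Rightarrow> bool" where
  "L2_L4_equiv PX \<kappa> \<longleftrightarrow> (\<forall>\<theta>.
     (\<integral>\<^sup>+x. ennreal ((\<theta> \<bullet> x) ^ 4) \<partial>PX) \<le> ennreal \<kappa> * (\<integral>\<^sup>+x. ennreal ((\<theta> \<bullet> x)\<^sup>2) \<partial>PX)\<^sup>2)"

definition risk :: "((real ^ 'd) \<times> real) measure \<Rightarrow> real ^ 'd \<Rightarrow> real" where
  "risk P \<beta> = (LINT p|P. (snd p - \<beta> \<bullet> fst p)\<^sup>2)"

definition beta_star :: "((real ^ 'd) \<times> real) measure \<Rightarrow> real ^ 'd" where
  "beta_star P =
     matrix_inv (second_moment (distr P borel fst)) *v (LINT p|P. snd p *\<^sub>R fst p)"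

definition excess_risk :: "((real ^ 'd) \<times> real) measure \<Rightarrow> real ^ 'd \<Rightarrow> real" where
  "excess_risk P \<beta> = risk P \<beta> - risk P (beta_star P)"

definition cond_exp_X ::
    "((real ^ 'd) \<times> real) measure \<Rightarrow> ((real ^ 'd) \<times> real \<Rightarrow> real) \<Rightarrow> (real ^ 'd) \<times> real \<Rightarrow> ennreal" where
  "cond_exp_X P f = nn_cond_exp P (vimage_algebra (space P) fst borel) (\<lambda>p. ennreal (f p))"

definition P_mis :: "(real ^ 'd) measure \<Rightarrow> real \<Rightarrow> ((real ^ 'd) \<times> real) measure set" where
  "P_mis PX v = {P \<in> joint_distributions PX. \<exists>\<beta>.
     integrable P (\<lambda>p. (snd p - \<beta> \<bullet> fst p) *\<^sub>R fst p) \<and>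
     (LINT p|P. (snd p - \<beta> \<bullet> fst p) *\<^sub>R fst p) = 0 \<and>
     (AE p in P. cond_exp_X P (\<lambda>p. (snd p - \<beta> \<bullet> fst p)\<^sup>2) p \<le> ennreal v)}"

definition residual :: "((real ^ 'd) \<times> real) measure \<Rightarrow> (real ^ 'd) \<times> real \<Rightarrow> real" where
  "residual P p = snd p - beta_star P \<bullet> fst p"

definition whitened_norm :: "((real ^ 'd) \<times> real) measure \<Rightarrow> (real ^ 'd) \<times> real \<Rightarrow> real" where
  "whitened_norm P p =
     norm (matrix_inv (matrix_sqrt (second_moment (distr P borel fst))) *v fst p)"

definition chi_moment :: "((real ^ 'd) \<times> real) measure \<Rightarrow> ennreal" where
  "chi_moment P =
     (\<integral>\<^sup>+p. (cond_exp_X P (\<lambda>q. (residual P q)\<^sup>2) p)\<^sup>2 * ennreal (whitened_norm P p ^ 4) \<partial>P)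
       / ennreal (real CARD('d) ^ 2)"

text \<open>
  A sample is a function on \<open>{..<n}\<close>; an i.i.d. sample from \<open>P\<close> has law \<open>PiM {..<n} (\<lambda>_. P)\<close>.
\<close>

definition estimators :: "nat \<Rightarrow> ((nat \<Rightarrow> (real ^ 'd) \<times> real) \<Rightarrow> real ^ 'd) set" where
  "estimators n = borel_measurable (PiM {..<n} (\<lambda>_. borel))"

definition expected_excess_risk ::
    "nat \<Rightarrow> ((real ^ 'd) \<times> real) measure \<Rightarrow> ((nat \<Rightarrow> (real ^ 'd) \<times> real) \<Rightarrow> real ^ 'd) \<Rightarrow> ennreal" where
  "expected_excess_risk n P b =
     (\<integral>\<^sup>+z. ennreal (excess_risk P (b z)) \<partial>PiM {..<n} (\<lambda>_. P))"

definition is_least_squares :: "nat \<Rightarrow> (nat \<Rightarrow> (real ^ 'd) \<times> real) \<Rightarrow> real ^ 'd \<Rightarrow> bool" where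
  "is_least_squares n z = is_arg_min (\<lambda>\<beta>. \<Sum>i<n. (snd (z i) - \<beta> \<bullet> fst (z i))\<^sup>2) (\<lambda>_. True)"

text \<open>
  The minimizer is unique exactly when the empirical second-moment matrix is invertible, which
  under the small-ball condition holds almost surely for \<open>n \<ge> d\<close>; the value \<open>0\<close> on the remaining
  null event is a convention that keeps the estimator measurable.
\<close>

definition ols_estimator :: "nat \<Rightarrow> (nat \<Rightarrow> (real ^ 'd) \<times> real) \<Rightarrow> real ^ 'd" where
  "ols_estimator n z =
     (if \<exists>!\<beta>. is_least_squares n z \<beta> then THE \<beta>. is_least_squares n z \<beta> else 0)"

end

theory Submission
  imports Defs
begin

text \<open>
  After whitening by \<open>\<Sigma>\<^sup>-\<^sup>1\<^sup>/\<^sup>2\<close> the least-squares error \<open>e\<close> solves \<open>A e = v\<close>, where \<open>A\<close> averages \<open>X\<^sub>i X\<^sub>i\<^sup>T\<close> and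
  \<open>v\<close> averages \<open>\<epsilon>\<^sub>i X\<^sub>i\<close>.  The proxy \<open>u\<close>, the average of \<open>\<epsilon>\<^sub>i X\<^sub>i / (1 + norm X\<^sub>i ^ 2 / n)\<close>, has second moment of the
  order of the leading term, and \<open>r = v - A u\<close> is a degenerate U-statistic up to smaller terms; since
  \<open>norm e ^ 2 \<le> norm u ^ 2 + 2 * norm r * norm v / \<lambda> ^ 2\<close> with \<open>\<lambda>\<close> the smallest eigenvalue of \<open>A\<close>, Cauchy-Schwarz reduces
  the second-order term to moments of \<open>1 / \<lambda>\<close>.  These are finite because of the small-ball condition: if the quadratic form of \<open>A\<close>
  is small in one direction, then by Jensen the average of \<open>exp (- L * n * (\<theta> \<bullet> A \<theta>))\<close> over a small ball is large, while its
  expectation factorizes over the sample and each factor is controlled by the small-ball probabilities.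

  For the lower bound, the Gaussian linear model is averaged over a Gaussian prior of variance \<open>\<tau> ^ 2\<close>
  on the whitened coefficients.  Conditionally on the data and on the other coordinates, each
  coordinate is Gaussian with precision \<open>1 / \<tau> ^ 2 + (\<Sum>i. X\<^sub>i\<^sub>k ^ 2) / \<sigma> ^ 2\<close>, whose mean is
  \<open>1 / \<tau> ^ 2 + n / \<sigma> ^ 2\<close>; convexity of \<open>1 / q\<close> and \<open>\<tau> \<rightarrow> \<infinity>\<close> give the claim.
\<close>

section \<open>Second moments of sums over a sample\<close>

text \<open>Two obstacles shape the upper bound. The norm of \<open>X\<close> is unbounded, while
  smoothing over a ball around \<open>\<theta>\<close> costs the sum of \<open>norm X ^ 2\<close>;
  so the lower tail is proved for \<open>X\<close> projected onto the ball of radius sqrt d. This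
  only lowers the quadratic form, and it weakens the small-ball exponent \<alpha> to 2 \<alpha> / 3.
  Moreover \<chi> contains only the conditional variance of \<epsilon> and no fourth moment of
  \<epsilon>. Hence \<epsilon>^2 is replaced by its conditional variance, against functions of the
  design, before Cauchy-Schwarz is applied to it; the eigenvalue bound must then be a function of
  the design alone. Products of two different noise terms are degenerate and are handled by second
  moments. Two Cauchy-Schwarz steps, one producing \<open>norm v ^ 2 / \<lambda> ^ 4\<close> and one
  \<open>1 / \<lambda> ^ 8\<close>, explain the eighth moment; the tail (C' t)^(\<alpha> n / 4) with
  \<alpha> n / 4 \<ge> 24 pays for it. In the lower bound the conditional precision of a coordinate
  depends on the design only, whose law is the same for all parameters. Scalar convexity thus
  replaces an inequality for inverse matrices.\<close>

lemma distr_PiM_resample: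
  assumes "prob_space M" "i \<in> I"
  shows "distr (M \<Otimes>\<^sub>M (\<Pi>\<^sub>M i\<in>I. M)) (\<Pi>\<^sub>M i\<in>I. M) (\<lambda>(x, z). z(i := x)) = (\<Pi>\<^sub>M i\<in>I. M)"
  using distr_pair_PiM_eq_PiM[of I "\<lambda>_. M" i] assms by (simp add: insert_absorb)

lemma measurable_resample:
  assumes "i \<in> I"
  shows "(\<lambda>(x, z). z(i := x)) \<in> M \<Otimes>\<^sub>M (\<Pi>\<^sub>M i\<in>I. M) \<rightarrow>\<^sub>M (\<Pi>\<^sub>M i\<in>I. M)"
proof -
  have "(\<lambda>w. (snd w)(i := fst w)) \<in> M \<Otimes>\<^sub>M (\<Pi>\<^sub>M i\<in>I. M) \<rightarrow>\<^sub>M (\<Pi>\<^sub>M i\<in>I. M)"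
    using assms by (intro measurable_fun_upd[where J=I]) (auto simp: insert_absorb)
  then show ?thesis by (simp add: case_prod_beta')
qed

text \<open>Overwriting one coordinate by an independent draw preserves the product law. One
  coordinate is thereby integrated out while the sample space keeps its index set, so the product
  never has to be split.\<close>

lemma nn_integral_PiM_resample:
  assumes M: "prob_space M" and i: "i \<in> I" and f[measurable]: "f \<in> borel_measurable (\<Pi>\<^sub>M i\<in>I. M)"
  shows "(\<integral>\<^sup>+z. f z \<partial>(\<Pi>\<^sub>M i\<in>I. M)) = (\<integral>\<^sup>+z. \<integral>\<^sup>+x. f (z(i := x)) \<partial>M \<partial>(\<Pi>\<^sub>M i\<in>I. M))"
proof -
  interpret M: prob_space M by fact
  interpret S: prob_space "\<Pi>\<^sub>M i\<in>I. M" by (rule prob_space_PiM) (rule M)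
  interpret pair_sigma_finite M "\<Pi>\<^sub>M i\<in>I. M" ..
  note [measurable] = measurable_resample[OF i, of M]
  have "(\<integral>\<^sup>+z. f z \<partial>(\<Pi>\<^sub>M i\<in>I. M)) = (\<integral>\<^sup>+w. f ((\<lambda>(x, z). z(i := x)) w) \<partial>(M \<Otimes>\<^sub>M (\<Pi>\<^sub>M i\<in>I. M)))"
    by (subst (1) distr_PiM_resample[OF M i, symmetric], subst nn_integral_distr) auto
  also have "\<dots> = (\<integral>\<^sup>+z. \<integral>\<^sup>+x. f ((\<lambda>(x, z). z(i := x)) (x, z)) \<partial>M \<partial>(\<Pi>\<^sub>M i\<in>I. M))"
    by (rule nn_integral_snd[symmetric]) measurable
  finally show ?thesis by simp
qed

lemma integral_PiM_resample:
  fixes f :: "_ \<Rightarrow> _::{banach, second_countable_topology}"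
  assumes M: "prob_space M" and i: "i \<in> I" and f: "integrable (\<Pi>\<^sub>M i\<in>I. M) f"
  shows "(\<integral>z. f z \<partial>(\<Pi>\<^sub>M i\<in>I. M)) = (\<integral>z. \<integral>x. f (z(i := x)) \<partial>M \<partial>(\<Pi>\<^sub>M i\<in>I. M))"
proof -
  interpret M: prob_space M by fact
  interpret S: prob_space "\<Pi>\<^sub>M i\<in>I. M" by (rule prob_space_PiM) (rule M)
  interpret pair_sigma_finite M "\<Pi>\<^sub>M i\<in>I. M" ..
  note [measurable] = measurable_resample[OF i, of M]
  have [measurable]: "f \<in> borel_measurable (\<Pi>\<^sub>M i\<in>I. M)" using f by auto
  have int: "integrable (M \<Otimes>\<^sub>M (\<Pi>\<^sub>M i\<in>I. M)) (\<lambda>(x, z). f (z(i := x)))"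
    using f by (subst (asm) distr_PiM_resample[OF M i, symmetric], subst (asm) integrable_distr_eq)
       (auto simp: case_prod_beta')
  have "(\<integral>z. f z \<partial>(\<Pi>\<^sub>M i\<in>I. M)) = (\<integral>w. f ((\<lambda>(x, z). z(i := x)) w) \<partial>(M \<Otimes>\<^sub>M (\<Pi>\<^sub>M i\<in>I. M)))"
    by (subst (1) distr_PiM_resample[OF M i, symmetric], subst integral_distr) auto
  also have "\<dots> = (\<integral>z. \<integral>x. f (z(i := x)) \<partial>M \<partial>(\<Pi>\<^sub>M i\<in>I. M))"
    using integral_snd[OF int] by (simp add: case_prod_beta')
  finally show ?thesis .
qed

lemma nn_integral_PiM_component:
  assumes M: "prob_space M" and i: "i \<in> I" and [measurable]: "f \<in> borel_measurable M"
  shows "(\<integral>\<^sup>+z. f (z i) \<partial>(\<Pi>\<^sub>M i\<in>I. M)) = (\<integral>\<^sup>+x. f x \<partial>M)"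
proof -
  have "(\<integral>\<^sup>+x. f x \<partial>M) = (\<integral>\<^sup>+x. f x \<partial>distr (\<Pi>\<^sub>M i\<in>I. M) M (\<lambda>z. z i))"
    using distr_PiM_component[of I "\<lambda>_. M" i] M i by simp
  then show ?thesis using i by (subst (asm) nn_integral_distr) auto
qed

lemma integral_PiM_component:
  fixes f :: "_ \<Rightarrow> _::{banach, second_countable_topology}"
  assumes M: "prob_space M" and i: "i \<in> I" and [measurable]: "f \<in> borel_measurable M"
  shows "(\<integral>z. f (z i) \<partial>(\<Pi>\<^sub>M i\<in>I. M)) = (\<integral>x. f x \<partial>M)"
proof -
  have "(\<integral>x. f x \<partial>M) = (\<integral>x. f x \<partial>distr (\<Pi>\<^sub>M i\<in>I. M) M (\<lambda>z. z i))"
    using distr_PiM_component[of I "\<lambda>_. M" i] M i by simp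
  then show ?thesis using i by (subst (asm) integral_distr) auto
qed

lemma nn_integral_PiM_two_components:
  assumes M: "prob_space M" and ij: "i \<in> I" "j \<in> I" "i \<noteq> j"
    and [measurable]: "case_prod f \<in> borel_measurable (M \<Otimes>\<^sub>M M)"
  shows "(\<integral>\<^sup>+z. f (z i) (z j) \<partial>(\<Pi>\<^sub>M i\<in>I. M)) = (\<integral>\<^sup>+x. \<integral>\<^sup>+y. f x y \<partial>M \<partial>M)"
proof -
  interpret M: prob_space M by fact
  have "(\<integral>\<^sup>+z. f (z i) (z j) \<partial>(\<Pi>\<^sub>M i\<in>I. M)) = (\<integral>\<^sup>+z. \<integral>\<^sup>+x. f (z i) x \<partial>M \<partial>(\<Pi>\<^sub>M i\<in>I. M))"
    using ij by (subst nn_integral_PiM_resample[OF M, of j]) auto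
  also have "\<dots> = (\<integral>\<^sup>+x. \<integral>\<^sup>+y. f x y \<partial>M \<partial>M)"
    by (rule nn_integral_PiM_component[OF M ij(1)]) measurable
  finally show ?thesis .
qed

lemma norm_sum_squared:
  fixes a :: "'i \<Rightarrow> 'a::real_inner"
  shows "(norm (\<Sum>i\<in>I. a i))\<^sup>2 = (\<Sum>i\<in>I. \<Sum>j\<in>I. a i \<bullet> a j)"
  by (simp add: power2_norm_eq_inner inner_sum_left inner_sum_right) (subst inner_commute, rule refl)

lemma abs_inner_le_squares:
  fixes a b :: "'a::real_inner"
  shows "\<bar>a \<bullet> b\<bar> \<le> ((norm a)\<^sup>2 + (norm b)\<^sup>2) / 2"
  using Cauchy_Schwarz_ineq2[of a b] sum_squares_bound[of "norm a" "norm b"] by simp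

lemma integrable_inner_of_square_integrable:
  fixes f g :: "_ \<Rightarrow> _::euclidean_space"
  assumes [measurable]: "f \<in> borel_measurable M" "g \<in> borel_measurable M"
    and "integrable M (\<lambda>x. (norm (f x))\<^sup>2)" "integrable M (\<lambda>x. (norm (g x))\<^sup>2)"
  shows "integrable M (\<lambda>x. f x \<bullet> g x)"
proof (rule Bochner_Integration.integrable_bound)
  show "integrable M (\<lambda>x. ((norm (f x))\<^sup>2 + (norm (g x))\<^sup>2) / 2)" using assms by simp
  show "AE x in M. norm (f x \<bullet> g x) \<le> norm (((norm (f x))\<^sup>2 + (norm (g x))\<^sup>2) / 2)"
    using abs_inner_le_squares by (auto intro!: AE_I2)
qed measurable

lemma integrable_of_square_integrable:
  fixes f :: "_ \<Rightarrow> _::euclidean_space"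
  assumes "finite_measure M" and [measurable]: "f \<in> borel_measurable M"
    and "integrable M (\<lambda>x. (norm (f x))\<^sup>2)"
  shows "integrable M f"
proof -
  interpret finite_measure M by fact
  show ?thesis
  proof (rule Bochner_Integration.integrable_bound)
    show "integrable M (\<lambda>x. 1 + (norm (f x))\<^sup>2)" using assms by simp
    have "norm (f x) \<le> 1 + (norm (f x))\<^sup>2" for x
      using sum_squares_bound[of "norm (f x)" 1] norm_ge_zero[of "f x"] unfolding power2_eq_square by linarith
    then show "AE x in M. norm (f x) \<le> norm (1 + (norm (f x))\<^sup>2)" by (auto intro!: AE_I2 order_trans[OF _ abs_ge_self])
  qed measurable
qed

lemma integrableI_square_nn:
  assumes [measurable]: "f \<in> borel_measurable M"
    and "(\<integral>\<^sup>+x. ennreal ((norm (f x))\<^sup>2) \<partial>M) \<le> ennreal B"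
  shows "integrable M (\<lambda>x. (norm (f x))\<^sup>2)"
  using assms(2) by (intro integrableI_bounded) (auto simp: le_less_trans ennreal_less_top)

lemma integral_le_of_nn_integral_le:
  assumes "(\<integral>\<^sup>+x. ennreal (f x) \<partial>M) \<le> ennreal B" "0 \<le> B" "\<And>x. 0 \<le> f x"
  shows "(\<integral>x. f x \<partial>M) \<le> B"
proof (cases "integrable M f")
  case True
  then show ?thesis using assms by (subst (asm) nn_integral_eq_integral) (auto)
qed (use assms in \<open>auto simp: not_integrable_integral_eq\<close>)

text \<open>By independence each off-diagonal pair contributes exactly the squared norm of the mean.
  The same amount is added on the diagonal, where \<open>B\<close> already suffices, to get the
  plain count \<open>(card I)\<^sup>2\<close>.\<close>

lemma sum_second_moment:
  fixes g :: "'a \<Rightarrow> 'b::euclidean_space" and B :: real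
  assumes M: "prob_space M" and I: "finite I"
    and g[measurable]: "g \<in> borel_measurable M"
    and B: "(\<integral>\<^sup>+x. ennreal ((norm (g x))\<^sup>2) \<partial>M) \<le> ennreal B" "0 \<le> B"
  shows "(\<integral>\<^sup>+z. ennreal ((norm (\<Sum>i\<in>I. g (z i)))\<^sup>2) \<partial>(\<Pi>\<^sub>M i\<in>I. M))
           \<le> ennreal (card I * B + (card I)\<^sup>2 * (norm (\<integral>x. g x \<partial>M))\<^sup>2)"
proof -
  interpret M: prob_space M by fact
  let ?S = "\<Pi>\<^sub>M i\<in>I. M" and ?m = "\<integral>x. g x \<partial>M"
  interpret S: prob_space ?S by (rule prob_space_PiM) (rule M)
  have sq: "integrable M (\<lambda>x. (norm (g x))\<^sup>2)" by (rule integrableI_square_nn[OF g B(1)])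
  have gi: "integrable M g" by (rule integrable_of_square_integrable[OF _ g sq]) unfold_locales
  have sqS: "integrable ?S (\<lambda>z. (norm (g (z i)))\<^sup>2)" if "i \<in> I" for i
    using B(1) that
    by (intro integrableI_square_nn[where B=B])
       (auto simp: nn_integral_PiM_component[OF M that, of "\<lambda>x. ennreal ((norm (g x))\<^sup>2)"])
  have int: "integrable ?S (\<lambda>z. g (z i) \<bullet> g (z j))" if "i \<in> I" "j \<in> I" for i j
    using that by (intro integrable_inner_of_square_integrable sqS) auto
  have E: "(\<integral>z. g (z i) \<bullet> g (z j) \<partial>?S) \<le> (if i = j then B else 0) + (norm ?m)\<^sup>2" if "i \<in> I" "j \<in> I" for i j
  proof (cases "i = j")
    case True
    have "(\<integral>z. (norm (g (z i)))\<^sup>2 \<partial>?S) \<le> B"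
      using B that
      by (intro integral_le_of_nn_integral_le)
         (auto simp: nn_integral_PiM_component[OF M that(1), of "\<lambda>x. ennreal ((norm (g x))\<^sup>2)"])
    then show ?thesis using True by (simp add: dot_square_norm add_increasing2)
  next
    case False
    have "(\<integral>z. g (z i) \<bullet> g (z j) \<partial>?S) = (\<integral>z. g (z i) \<bullet> ?m \<partial>?S)"
      using False gi by (subst integral_PiM_resample[OF M that(2) int[OF that]]) simp
    also have "\<dots> = ?m \<bullet> ?m"
      using gi that by (subst integral_PiM_component[OF M, of i I "\<lambda>x. g x \<bullet> ?m"]) auto
    finally show ?thesis using False by (simp add: dot_square_norm)
  qed
  have "(\<integral>\<^sup>+z. ennreal ((norm (\<Sum>i\<in>I. g (z i)))\<^sup>2) \<partial>?S) = (\<integral>z. (\<Sum>i\<in>I. \<Sum>j\<in>I. g (z i) \<bullet> g (z j)) \<partial>?S)"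
  proof (subst norm_sum_squared, rule nn_integral_eq_integral)
    show "AE z in ?S. 0 \<le> (\<Sum>i\<in>I. \<Sum>j\<in>I. g (z i) \<bullet> g (z j))"
      by (intro AE_I2) (simp flip: norm_sum_squared)
  qed (use int in simp)
  also have "(\<integral>z. (\<Sum>i\<in>I. \<Sum>j\<in>I. g (z i) \<bullet> g (z j)) \<partial>?S) = (\<Sum>i\<in>I. \<Sum>j\<in>I. \<integral>z. g (z i) \<bullet> g (z j) \<partial>?S)"
    using int by simp
  also have "\<dots> \<le> (\<Sum>i\<in>I. \<Sum>j\<in>I. (if i = j then B else 0) + (norm ?m)\<^sup>2)"
    using E by (intro sum_mono) auto
  also have "\<dots> = card I * B + (card I)\<^sup>2 * (norm ?m)\<^sup>2"
    using I by (simp add: sum.distrib power2_eq_square algebra_simps)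
  finally show ?thesis by (simp add: ennreal_leI)
qed

text \<open>Degeneracy makes two summands orthogonal unless they carry the same pair of indices.\<close>

lemma degenerate_U_statistic_second_moment:
  fixes f :: "'a \<Rightarrow> 'a \<Rightarrow> 'b::euclidean_space" and I :: "'i set" and B :: real
  assumes M: "prob_space M" and I: "finite I"
    and f[measurable]: "case_prod f \<in> borel_measurable (M \<Otimes>\<^sub>M M)"
    and B: "(\<integral>\<^sup>+x. \<integral>\<^sup>+y. ennreal ((norm (f x y))\<^sup>2) \<partial>M \<partial>M) \<le> ennreal B" "0 \<le> B"
    and int1: "\<And>x. x \<in> space M \<Longrightarrow> integrable M (\<lambda>y. f x y)"
    and int2: "\<And>y. y \<in> space M \<Longrightarrow> integrable M (\<lambda>x. f x y)"
    and deg1: "\<And>x. x \<in> space M \<Longrightarrow> (\<integral>y. f x y \<partial>M) = 0"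
    and deg2: "\<And>y. y \<in> space M \<Longrightarrow> (\<integral>x. f x y \<partial>M) = 0"
  shows "(\<integral>\<^sup>+z. ennreal ((norm (\<Sum>p\<in>{p \<in> I \<times> I. fst p \<noteq> snd p}. f (z (fst p)) (z (snd p))))\<^sup>2) \<partial>(\<Pi>\<^sub>M i\<in>I. M))
           \<le> ennreal (2 * (card I)\<^sup>2 * B)"
proof -
  interpret M: prob_space M by fact
  let ?S = "\<Pi>\<^sub>M i\<in>I. M"
  interpret S: prob_space ?S by (rule prob_space_PiM) (rule M)
  define Q where "Q = {p \<in> I \<times> I. fst p \<noteq> snd p}"
  define g :: "'i \<times> 'i \<Rightarrow> _" where "g p z = f (z (fst p)) (z (snd p))" for p z
  have Q: "finite Q" using I by (auto simp: Q_def intro: finite_subset[of _ "I \<times> I"])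
  have QD: "fst p \<in> I" "snd p \<in> I" "fst p \<noteq> snd p" if "p \<in> Q" for p using that by (auto simp: Q_def)
  have gm[measurable]: "g p \<in> borel_measurable ?S" if "p \<in> Q" for p
  proof -
    have [measurable]: "fst p \<in> I" "snd p \<in> I" using QD[OF that] by auto
    show ?thesis unfolding g_def by measurable
  qed
  have nn: "(\<integral>\<^sup>+z. ennreal ((norm (g p z))\<^sup>2) \<partial>?S) \<le> ennreal B" if "p \<in> Q" for p
    using B(1) unfolding g_def
    by (subst nn_integral_PiM_two_components[OF M QD[OF that], where f="\<lambda>x y. ennreal ((norm (f x y))\<^sup>2)"]) auto
  have sq: "integrable ?S (\<lambda>z. (norm (g p z))\<^sup>2)" if "p \<in> Q" for p
    using nn that by (intro integrableI_square_nn[where B=B]) auto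
  have EB: "(\<integral>z. (norm (g p z))\<^sup>2 \<partial>?S) \<le> B" if "p \<in> Q" for p
    using nn[OF that] B(2) by (intro integral_le_of_nn_integral_le) auto
  have int: "integrable ?S (\<lambda>z. g p z \<bullet> g q z)" if "p \<in> Q" "q \<in> Q" for p q
    using that by (intro integrable_inner_of_square_integrable sq gm)
  have zero: "(\<integral>z. g p z \<bullet> g q z \<partial>?S) = 0" if pq: "p \<in> Q" "q \<in> Q" "q \<noteq> p" "q \<noteq> prod.swap p" for p q
  proof -
    \<comment> \<open>If \<open>q\<close> is neither \<open>p\<close> nor its swap, then some index
      of \<open>p\<close> does not occur in \<open>q\<close>. Integrating out that coordinate leaves
      \<open>g q z\<close> fixed and annihilates \<open>g p z\<close>.\<close>
    consider "fst p \<noteq> fst q" "fst p \<noteq> snd q" | "snd p \<noteq> fst q" "snd p \<noteq> snd q"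
      using QD(3)[OF pq(1)] QD(3)[OF pq(2)] pq(3,4) by (cases p; cases q) auto
    then show ?thesis
    proof cases
      case 1
      have "(\<integral>z. g p z \<bullet> g q z \<partial>?S) = (\<integral>z. \<integral>x. f x (z (snd p)) \<bullet> g q z \<partial>M \<partial>?S)"
        using 1 QD(3)[OF pq(1)]
        by (subst integral_PiM_resample[OF M QD(1)[OF pq(1)] int[OF pq(1,2)]]) (auto simp: g_def)
      also have "\<dots> = (\<integral>z. 0 \<partial>?S)"
      proof (rule Bochner_Integration.integral_cong[OF refl])
        fix z assume "z \<in> space ?S"
        then have "z (snd p) \<in> space M" using QD(2)[OF pq(1)] by (auto simp: space_PiM PiE_iff)
        then show "(\<integral>x. f x (z (snd p)) \<bullet> g q z \<partial>M) = 0" using int2 deg2 by simp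
      qed
      finally show ?thesis by simp
    next
      case 2
      have "(\<integral>z. g p z \<bullet> g q z \<partial>?S) = (\<integral>z. \<integral>x. f (z (fst p)) x \<bullet> g q z \<partial>M \<partial>?S)"
        using 2 QD(3)[OF pq(1)]
        by (subst integral_PiM_resample[OF M QD(2)[OF pq(1)] int[OF pq(1,2)]]) (auto simp: g_def)
      also have "\<dots> = (\<integral>z. 0 \<partial>?S)"
      proof (rule Bochner_Integration.integral_cong[OF refl])
        fix z assume "z \<in> space ?S"
        then have "z (fst p) \<in> space M" using QD(1)[OF pq(1)] by (auto simp: space_PiM PiE_iff)
        then show "(\<integral>x. f (z (fst p)) x \<bullet> g q z \<partial>M) = 0" using int1 deg1 by simp
      qed
      finally show ?thesis by simp
    qed
  qed
  \<comment> \<open>Each \<open>p\<close> keeps only two partners, itself and its swap; this is the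
    factor 2 in the conclusion.\<close>
  have E: "(\<integral>z. g p z \<bullet> g q z \<partial>?S) \<le> (if q = p then B else 0) + (if q = prod.swap p then B else 0)"
    if pq: "p \<in> Q" "q \<in> Q" for p q
  proof (cases "q = p \<or> q = prod.swap p")
    case True
    have "(\<integral>z. g p z \<bullet> g q z \<partial>?S) \<le> (\<integral>z. ((norm (g p z))\<^sup>2 + (norm (g q z))\<^sup>2) / 2 \<partial>?S)"
    proof (rule integral_mono)
      show "g p z \<bullet> g q z \<le> ((norm (g p z))\<^sup>2 + (norm (g q z))\<^sup>2) / 2" for z
        using abs_inner_le_squares[of "g p z" "g q z"] by linarith
    qed (use int sq pq in auto)
    also have "\<dots> \<le> B" using EB[OF pq(1)] EB[OF pq(2)] sq pq by simp
    also have "\<dots> \<le> (if q = p then B else 0) + (if q = prod.swap p then B else 0)" using True B(2) by auto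
    finally show ?thesis .
  qed (use zero[OF pq] in auto)
  have "(\<integral>\<^sup>+z. ennreal ((norm (\<Sum>p\<in>Q. g p z))\<^sup>2) \<partial>?S) = (\<integral>z. (\<Sum>p\<in>Q. \<Sum>q\<in>Q. g p z \<bullet> g q z) \<partial>?S)"
  proof (subst norm_sum_squared, rule nn_integral_eq_integral)
    show "AE z in ?S. 0 \<le> (\<Sum>p\<in>Q. \<Sum>q\<in>Q. g p z \<bullet> g q z)"
      by (intro AE_I2) (simp flip: norm_sum_squared)
  qed (use int in simp)
  also have "(\<integral>z. (\<Sum>p\<in>Q. \<Sum>q\<in>Q. g p z \<bullet> g q z) \<partial>?S) = (\<Sum>p\<in>Q. \<Sum>q\<in>Q. \<integral>z. g p z \<bullet> g q z \<partial>?S)"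
    using int by simp
  also have "\<dots> \<le> (\<Sum>p\<in>Q. \<Sum>q\<in>Q. (if q = p then B else 0) + (if q = prod.swap p then B else 0))"
    using E by (intro sum_mono) auto
  also have "\<dots> \<le> (\<Sum>p\<in>Q. 2 * B)"
    using Q B(2) by (intro sum_mono) (simp add: sum.distrib)
  also have "\<dots> \<le> 2 * (card I)\<^sup>2 * B"
  proof -
    have "card Q \<le> card (I \<times> I)" using I by (intro card_mono) (auto simp: Q_def)
    then have "real (card Q) \<le> (real (card I))\<^sup>2"
      by (simp add: card_cartesian_product power2_eq_square flip: of_nat_mult)
    then show ?thesis using mult_right_mono[of "real (card Q)" "(real (card I))\<^sup>2" "2 * B"] B(2) by (simp add: mult_ac)
  qed
  finally show ?thesis by (simp add: ennreal_leI g_def Q_def)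
qed

section \<open>Averages over balls\<close>

lemma norm_squared_eq_sum_Basis: "(norm x)\<^sup>2 = (\<Sum>b\<in>Basis. (x \<bullet> b)\<^sup>2)"
  unfolding power2_norm_eq_inner by (subst euclidean_inner) (simp add: power2_eq_square)

text \<open>Coordinate reflections and coordinate permutations preserve Lebesgue measure and centred
  balls. These symmetries yield the first and second moments of a uniform point of a ball, in place
  of polar coordinates.\<close>

lemma lborel_distr_reflect:
  fixes b :: "'a::euclidean_space"
  assumes b: "b \<in> Basis"
  shows "distr lborel borel (\<lambda>x::'a. x - (2 * (x \<bullet> b)) *\<^sub>R b) = lborel"
proof -
  define c :: "'a \<Rightarrow> real" where "c j = (if j = b then -1 else 1)" for j
  have eq: "(\<Sum>j\<in>Basis. (c j * (x \<bullet> j)) *\<^sub>R j) = x - (2 * (x \<bullet> b)) *\<^sub>R b" for x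
  proof (rule euclidean_eqI)
    fix i :: 'a assume i: "i \<in> Basis"
    show "(\<Sum>j\<in>Basis. (c j * (x \<bullet> j)) *\<^sub>R j) \<bullet> i = (x - (2 * (x \<bullet> b)) *\<^sub>R b) \<bullet> i"
      using i b by (simp add: c_def inner_diff_left inner_Basis)
  qed
  have "(lborel :: 'a measure) = density (distr lborel borel (\<lambda>x. 0 + (\<Sum>j\<in>Basis. (c j * (x \<bullet> j)) *\<^sub>R j))) (\<lambda>_. (\<Prod>j\<in>Basis. \<bar>c j\<bar>))"
    by (rule lborel_affine_euclidean) (auto simp: c_def)
  moreover have "(\<Prod>j\<in>Basis. \<bar>c j\<bar>) = 1" by (intro prod.neutral) (auto simp: c_def)
  ultimately show ?thesis by (simp add: eq density_1)
qed

text \<open>Lebesgue measure is determined by its values on boxes, and the preimage of a box is the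
  box with permuted corners, whose product of side lengths is the same.\<close>

lemma lborel_distr_permute:
  fixes \<pi> :: "'a::euclidean_space \<Rightarrow> 'a"
  assumes \<pi>: "bij_betw \<pi> Basis Basis"
  shows "distr lborel borel (\<lambda>x::'a. \<Sum>j\<in>Basis. (x \<bullet> \<pi> j) *\<^sub>R j) = lborel"
proof (rule lborel_eqI[symmetric])
  let ?T = "\<lambda>x::'a. \<Sum>j\<in>Basis. (x \<bullet> \<pi> j) *\<^sub>R j"
  define \<rho> where "\<rho> = the_inv_into Basis \<pi>"
  let ?U = "\<lambda>x::'a. \<Sum>j\<in>Basis. (x \<bullet> \<rho> j) *\<^sub>R j"
  have \<rho>: "bij_betw \<rho> Basis Basis" unfolding \<rho>_def by (rule bij_betw_the_inv_into[OF \<pi>])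
  have \<pi>\<rho>: "\<pi> (\<rho> j) = j" "\<rho> j \<in> Basis" "\<rho> (\<pi> j) = j" "\<pi> j \<in> Basis" if "j \<in> Basis" for j
    using that \<pi> \<rho> by (auto simp: \<rho>_def f_the_inv_into_f_bij_betw the_inv_into_f_f bij_betw_def)
  have T: "?T x \<bullet> j = x \<bullet> \<pi> j" "?U x \<bullet> j = x \<bullet> \<rho> j" if "j \<in> Basis" for x j using that by auto
  fix l u :: 'a assume le: "\<And>b. b \<in> Basis \<Longrightarrow> l \<bullet> b \<le> u \<bullet> b"
  have pre: "?T -` box l u = box (?U l) (?U u)"
  proof -
    have "(\<forall>j\<in>Basis. l \<bullet> j < x \<bullet> \<pi> j \<and> x \<bullet> \<pi> j < u \<bullet> j) \<longleftrightarrow> (\<forall>j\<in>Basis. l \<bullet> \<rho> j < x \<bullet> j \<and> x \<bullet> j < u \<bullet> \<rho> j)" (is "?L \<longleftrightarrow> ?R") for x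
    proof
      show ?R if ?L using that \<pi>\<rho> by (metis (no_types, lifting))
      show ?L if ?R using that \<pi>\<rho> by (metis (no_types, lifting))
    qed
    then show ?thesis by (auto simp: box_def)
  qed
  have "emeasure (distr lborel borel ?T) (box l u) = emeasure lborel (box (?U l) (?U u))"
    by (subst emeasure_distr) (auto simp: pre)
  also have "\<dots> = (\<Prod>j\<in>Basis. (?U u - ?U l) \<bullet> j)"
    using le \<pi>\<rho> by (intro emeasure_lborel_box) auto
  also have "(\<Prod>j\<in>Basis. (?U u - ?U l) \<bullet> j) = (\<Prod>j\<in>Basis. (u - l) \<bullet> \<rho> j)"
    by (intro prod.cong) (auto simp: inner_simps)
  also have "\<dots> = (\<Prod>j\<in>Basis. (u - l) \<bullet> j)"
    by (rule prod.reindex_bij_betw[OF \<rho>])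
  finally show "emeasure (distr lborel borel ?T) (box l u) = (\<Prod>j\<in>Basis. (u - l) \<bullet> j)" .
qed simp

lemma integral_cball_reflect:
  fixes f :: "'a::euclidean_space \<Rightarrow> real"
  assumes b: "b \<in> Basis" and [measurable]: "f \<in> borel_measurable borel"
  shows "(LINT x:cball 0 r|lborel. f (x - (2 * (x \<bullet> b)) *\<^sub>R b)) = (LINT x:cball 0 r|lborel. f x)"
proof -
  let ?T = "\<lambda>x::'a. x - (2 * (x \<bullet> b)) *\<^sub>R b"
  have "(norm (?T x))\<^sup>2 = (norm x)\<^sup>2" for x
    using b by (simp add: power2_norm_eq_inner inner_simps inner_commute algebra_simps)
  then have n: "norm (?T x) = norm x" for x by (simp add: power2_eq_iff_nonneg)
  have "(LINT x:cball 0 r|lborel. f x) = (LINT x:cball 0 r|distr lborel borel ?T. f x)"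
    by (simp add: lborel_distr_reflect[OF b])
  also have "\<dots> = (LINT x:cball 0 r|lborel. f (?T x))"
    unfolding set_lebesgue_integral_def by (subst integral_distr) (auto simp: n indicator_def)
  finally show ?thesis by simp
qed

lemma integral_cball_permute:
  fixes f :: "'a::euclidean_space \<Rightarrow> real" and \<pi> :: "'a \<Rightarrow> 'a"
  assumes \<pi>: "bij_betw \<pi> Basis Basis" and [measurable]: "f \<in> borel_measurable borel"
  shows "(LINT x:cball 0 r|lborel. f (\<Sum>j\<in>Basis. (x \<bullet> \<pi> j) *\<^sub>R j)) = (LINT x:cball 0 r|lborel. f x)"
proof -
  let ?T = "\<lambda>x::'a. \<Sum>j\<in>Basis. (x \<bullet> \<pi> j) *\<^sub>R j"
  have n: "norm (?T x) = norm x" for x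
  proof -
    have "(\<Sum>j\<in>Basis. (x \<bullet> \<pi> j)\<^sup>2) = (\<Sum>j\<in>Basis. (x \<bullet> j)\<^sup>2)"
      by (rule sum.reindex_bij_betw[OF \<pi>, of "\<lambda>j. (x \<bullet> j)\<^sup>2"])
    then have "(norm (?T x))\<^sup>2 = (norm x)\<^sup>2" by (simp add: norm_squared_eq_sum_Basis)
    then show ?thesis by (simp add: power2_eq_iff_nonneg)
  qed
  have "(LINT x:cball 0 r|lborel. f x) = (LINT x:cball 0 r|distr lborel borel ?T. f x)"
    by (subst lborel_distr_permute[OF \<pi>]) (rule refl)
  also have "\<dots> = (LINT x:cball 0 r|lborel. f (?T x))"
    unfolding set_lebesgue_integral_def by (subst integral_distr) (auto simp: n indicator_def)
  finally show ?thesis by simp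
qed

lemma set_integrable_cball:
  fixes f :: "'a::euclidean_space \<Rightarrow> real"
  assumes "continuous_on UNIV f"
  shows "set_integrable lborel (cball 0 r) f"
  unfolding set_integrable_def using assms
  by (intro borel_integrable_compact) (auto intro: continuous_on_subset)

lemma set_integral_sum_real:
  fixes f :: "'i \<Rightarrow> 'a \<Rightarrow> real"
  assumes "\<And>i. i \<in> I \<Longrightarrow> set_integrable M A (f i)"
  shows "(LINT x:A|M. \<Sum>i\<in>I. f i x) = (\<Sum>i\<in>I. LINT x:A|M. f i x)"
  using Bochner_Integration.integral_sum[of I M "\<lambda>i x. indicator A x *\<^sub>R f i x"] assms
  by (simp add: set_lebesgue_integral_def set_integrable_def sum_distrib_left)

lemma integral_cball_linear:
  fixes v :: "'a::euclidean_space"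
  shows "(LINT x:cball 0 r|lborel. x \<bullet> v) = 0"
proof -
  have 1: "(LINT x:cball 0 r|lborel. x \<bullet> b) = 0" if b: "b \<in> Basis" for b :: 'a
    using integral_cball_reflect[OF b, of "\<lambda>x. x \<bullet> b" r] b
    by (simp add: inner_simps set_lebesgue_integral_def)
  have "(LINT x:cball 0 r|lborel. x \<bullet> v) = (LINT x:cball 0 r|lborel. (\<Sum>b\<in>Basis. (x \<bullet> b) * (v \<bullet> b)))"
    by (subst euclidean_inner) simp
  also have "\<dots> = (\<Sum>b\<in>Basis. (LINT x:cball 0 r|lborel. x \<bullet> b) * (v \<bullet> b))"
    by (subst set_integral_sum_real) (auto intro!: set_integrable_cball continuous_intros)
  finally show ?thesis using 1 by simp
qed

text \<open>A reflection changes the sign of every mixed moment, and transpositions make all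
  diagonal moments equal. Each diagonal moment is therefore \<open>1 / DIM('a)\<close> of the
  integral of the squared norm, which is at most \<open>r\<^sup>2\<close> times the volume.\<close>

lemma integral_cball_quadratic:
  fixes v :: "'a::euclidean_space"
  assumes r: "0 \<le> r"
  shows "(LINT x:cball 0 r|lborel. (x \<bullet> v)\<^sup>2) \<le> r\<^sup>2 / DIM('a) * (norm v)\<^sup>2 * measure lborel (cball (0::'a) r)"
proof -
  let ?I = "\<lambda>f::'a \<Rightarrow> real. LINT x:cball 0 r|lborel. f x"
  note SI = set_integrable_cball
  have off: "?I (\<lambda>x. (x \<bullet> b) * (x \<bullet> c)) = 0" if bc: "b \<in> Basis" "c \<in> Basis" "b \<noteq> c" for b c :: 'a
  proof -
    have [simp]: "(x - (2 * (x \<bullet> b)) *\<^sub>R b) \<bullet> b = - (x \<bullet> b)" "(x - (2 * (x \<bullet> b)) *\<^sub>R b) \<bullet> c = x \<bullet> c" for x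
      using bc by (simp_all add: inner_diff_left inner_Basis)
    have "?I (\<lambda>x. - ((x \<bullet> b) * (x \<bullet> c))) = ?I (\<lambda>x. (x \<bullet> b) * (x \<bullet> c))"
      using integral_cball_reflect[OF bc(1), of "\<lambda>x. (x \<bullet> b) * (x \<bullet> c)" r] by simp
    then show ?thesis by (simp add: set_lebesgue_integral_def)
  qed
  obtain b0 :: 'a where b0: "b0 \<in> Basis" using nonempty_Basis by blast
  have diag: "?I (\<lambda>x. (x \<bullet> b)\<^sup>2) = ?I (\<lambda>x. (x \<bullet> b0)\<^sup>2)" if b: "b \<in> Basis" for b :: 'a
  proof -
    have "bij_betw (Transposition.transpose b b0) (Basis::'a set) Basis"
      using b b0 by (intro bij_betwI[where g="Transposition.transpose b b0"]) (auto simp: Transposition.transpose_def)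
    from integral_cball_permute[OF this, of "\<lambda>x. (x \<bullet> b)\<^sup>2" r] show ?thesis using b by simp
  qed
  define m where "m = ?I (\<lambda>x. (x \<bullet> b0)\<^sup>2)"
  have "DIM('a) * m = (\<Sum>b\<in>Basis. ?I (\<lambda>x. (x \<bullet> b)\<^sup>2))"
    using diag by (simp add: m_def)
  also have "\<dots> = ?I (\<lambda>x. \<Sum>b\<in>Basis. (x \<bullet> b)\<^sup>2)"
    by (subst set_integral_sum_real) (auto intro!: SI continuous_intros)
  also have "\<dots> \<le> ?I (\<lambda>x. r\<^sup>2)"
  proof (rule set_integral_mono)
    fix x :: 'a assume "x \<in> cball 0 r"
    then show "(\<Sum>b\<in>Basis. (x \<bullet> b)\<^sup>2) \<le> r\<^sup>2"
      unfolding norm_squared_eq_sum_Basis[symmetric] by (intro power_mono) auto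
  qed (auto intro!: SI continuous_intros)
  also have "\<dots> = r\<^sup>2 * measure lborel (cball (0::'a) r)"
    by (simp add: set_lebesgue_integral_def)
  finally have m: "m \<le> r\<^sup>2 / DIM('a) * measure lborel (cball (0::'a) r)"
    by (simp add: field_simps)
  have "?I (\<lambda>x. (x \<bullet> v)\<^sup>2) = ?I (\<lambda>x. \<Sum>b\<in>Basis. \<Sum>c\<in>Basis. (v \<bullet> b) * (v \<bullet> c) * ((x \<bullet> b) * (x \<bullet> c)))"
    unfolding euclidean_inner[of _ v] power2_eq_square sum_product by (simp add: mult_ac)
  also have "\<dots> = (\<Sum>b\<in>Basis. \<Sum>c\<in>Basis. (v \<bullet> b) * (v \<bullet> c) * ?I (\<lambda>x. (x \<bullet> b) * (x \<bullet> c)))"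
    by (subst set_integral_sum_real, (auto intro!: SI continuous_intros)[1], subst set_integral_sum_real,
        (auto intro!: SI continuous_intros)[1]) simp
  also have "\<dots> = (\<Sum>b\<in>Basis. \<Sum>c\<in>Basis. if b = c then (v \<bullet> b)\<^sup>2 * m else 0)"
    using off diag by (intro sum.cong refl) (auto simp: m_def power2_eq_square)
  also have "\<dots> = (norm v)\<^sup>2 * m"
    by (simp add: norm_squared_eq_sum_Basis flip: sum_distrib_right)
  also have "\<dots> \<le> (norm v)\<^sup>2 * (r\<^sup>2 / DIM('a) * measure lborel (cball (0::'a) r))"
    by (intro mult_left_mono m) auto
  finally show ?thesis by (simp add: mult_ac)
qed

text \<open>Jensen's inequality for the uniform distribution on a ball around \<open>\<theta>\<close>, in the
  first-order form \<open>exp (- q) \<ge> exp (- m) * (1 + m - q)\<close>.\<close>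

lemma integral_cball_exp_quadratic:
  fixes x :: "'i \<Rightarrow> 'a::euclidean_space" and \<theta> :: 'a
  assumes r: "0 \<le> r" and L: "0 \<le> L" and I: "finite I"
  defines "m \<equiv> L * ((\<Sum>i\<in>I. (\<theta> \<bullet> x i)\<^sup>2) + r\<^sup>2 / DIM('a) * (\<Sum>i\<in>I. (norm (x i))\<^sup>2))"
  shows "measure lborel (cball (0::'a) r) * exp (- m)
           \<le> (LINT \<eta>:cball 0 r|lborel. exp (- (L * (\<Sum>i\<in>I. ((\<theta> + \<eta>) \<bullet> x i)\<^sup>2))))"
proof -
  let ?I = "\<lambda>f::'a \<Rightarrow> real. LINT x:cball 0 r|lborel. f x"
  let ?V = "measure lborel (cball (0::'a) r)"
  note SI = set_integrable_cball
  let ?q = "\<lambda>\<eta>. L * (\<Sum>i\<in>I. ((\<theta> + \<eta>) \<bullet> x i)\<^sup>2)"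
  define c where "c = (\<Sum>i\<in>I. (\<theta> \<bullet> x i)\<^sup>2)"
  have q: "?q \<eta> = L * (c + 2 * (\<eta> \<bullet> (\<Sum>i\<in>I. (\<theta> \<bullet> x i) *\<^sub>R x i)) + (\<Sum>i\<in>I. (\<eta> \<bullet> x i)\<^sup>2))" for \<eta>
    unfolding c_def by (simp add: inner_simps power2_sum sum.distrib inner_sum_right sum_distrib_left algebra_simps)
  have "?I ?q = L * (c * ?V + 2 * ?I (\<lambda>\<eta>. \<eta> \<bullet> (\<Sum>i\<in>I. (\<theta> \<bullet> x i) *\<^sub>R x i)) + ?I (\<lambda>\<eta>. \<Sum>i\<in>I. (\<eta> \<bullet> x i)\<^sup>2))"
  proof -
    have "?I (\<lambda>\<eta>. c + 2 * (\<eta> \<bullet> (\<Sum>i\<in>I. (\<theta> \<bullet> x i) *\<^sub>R x i)) + (\<Sum>i\<in>I. (\<eta> \<bullet> x i)\<^sup>2))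
       = ?I (\<lambda>\<eta>. c) + 2 * ?I (\<lambda>\<eta>. \<eta> \<bullet> (\<Sum>i\<in>I. (\<theta> \<bullet> x i) *\<^sub>R x i)) + ?I (\<lambda>\<eta>. \<Sum>i\<in>I. (\<eta> \<bullet> x i)\<^sup>2)"
      by (subst set_integral_add(2), (auto intro!: SI continuous_intros)[2],
          subst set_integral_add(2), (auto intro!: SI continuous_intros)[2]) simp
    moreover have "?I (\<lambda>\<eta>. c) = c * ?V" by (simp add: set_lebesgue_integral_def)
    ultimately show ?thesis unfolding q by simp
  qed
  also have "?I (\<lambda>\<eta>. \<eta> \<bullet> (\<Sum>i\<in>I. (\<theta> \<bullet> x i) *\<^sub>R x i)) = 0" by (rule integral_cball_linear)
  also have "?I (\<lambda>\<eta>. \<Sum>i\<in>I. (\<eta> \<bullet> x i)\<^sup>2) = (\<Sum>i\<in>I. ?I (\<lambda>\<eta>. (\<eta> \<bullet> x i)\<^sup>2))"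
    by (intro set_integral_sum_real) (auto intro!: SI continuous_intros)
  finally have "?I ?q = L * (c * ?V + (\<Sum>i\<in>I. ?I (\<lambda>\<eta>. (\<eta> \<bullet> x i)\<^sup>2)))" by simp
  also have "\<dots> \<le> L * (c * ?V + (\<Sum>i\<in>I. r\<^sup>2 / DIM('a) * (norm (x i))\<^sup>2 * ?V))"
    using L r by (intro mult_left_mono add_left_mono sum_mono integral_cball_quadratic) auto
  also have "\<dots> = m * ?V"
    by (simp add: m_def c_def sum_distrib_left sum_distrib_right algebra_simps)
  finally have Iq: "?I ?q \<le> m * ?V" .
  have "?V * exp (- m) \<le> exp (- m) * ((1 + m) * ?V - ?I ?q)"
    using Iq by (simp add: algebra_simps)
  also have "\<dots> = ?I (\<lambda>\<eta>. exp (- m) * ((1 + m) - ?q \<eta>))"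
  proof -
    have "?I (\<lambda>\<eta>. (1 + m) - ?q \<eta>) = ?I (\<lambda>\<eta>. 1 + m) - ?I ?q"
      by (rule set_integral_diff(2)) (auto intro!: SI continuous_intros)
    moreover have "?I (\<lambda>\<eta>. 1 + m) = (1 + m) * ?V" by (simp add: set_lebesgue_integral_def)
    ultimately show ?thesis by simp
  qed
  also have "\<dots> \<le> ?I (\<lambda>\<eta>. exp (- ?q \<eta>))"
  proof (rule set_integral_mono)
    fix \<eta> :: 'a
    have "exp (- m) * (1 + (m - ?q \<eta>)) \<le> exp (- m) * exp (m - ?q \<eta>)"
      by (intro mult_left_mono exp_ge_add_one_self) auto
    then show "exp (- m) * ((1 + m) - ?q \<eta>) \<le> exp (- ?q \<eta>)" by (simp add: mult_exp_exp algebra_simps)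
  qed (auto intro!: SI continuous_intros)
  finally show ?thesis .
qed

text \<open>Layer-cake form of \<open>exp (- y)\<close>: with Tonelli it turns the expectation of an
  exponential into an integral of tail probabilities.\<close>

lemma nn_integral_exp_tail:
  fixes y :: real
  shows "(\<integral>\<^sup>+s. ennreal (exp (- s)) * indicator {y..} s \<partial>lborel) = ennreal (exp (- y))"
proof -
  have "((\<lambda>s::real. - exp (- s)) \<longlongrightarrow> 0) at_top"
    using tendsto_minus[OF filterlim_compose[OF exp_at_bot filterlim_uminus_at_bot_at_top]] by simp
  then have "(\<integral>\<^sup>+s. ennreal (exp (- s)) * indicator {y..} s \<partial>lborel) = ennreal (0 - (- exp (- y)))"
    by (intro nn_integral_FTC_atLeast) (auto intro!: derivative_eq_intros)
  then show ?thesis by simp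
qed

text \<open>The right-hand side is the tangent at \<open>s = 1\<close> of a concave power. It comes
  from Young's inequality with second factor 1.\<close>

lemma powr_le_affine:
  fixes s a :: real
  assumes "0 \<le> s" "0 < a" "a \<le> 1"
  shows "s powr a \<le> (1 - a) + a * s"
proof (cases "s = 0")
  case False
  then show ?thesis using Youngs_inequality_0[of a "1 - a" s 1] assms by simp
qed (use assms in auto)

text \<open>This is Gamma (1 + a) \<le> 1 on (0, 1]. Integrating the affine majorant reduces it to
  Gamma 1 = Gamma 2 = 1.\<close>

lemma nn_integral_powr_exp_le:
  fixes a :: real
  assumes "0 < a" "a \<le> 1"
  shows "(\<integral>\<^sup>+s. ennreal (s powr a * exp (- s)) * indicator {0..} s \<partial>lborel) \<le> 1"
proof -
  have "(\<integral>\<^sup>+s. ennreal (s powr a * exp (- s)) * indicator {0..} s \<partial>lborel)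
      \<le> (\<integral>\<^sup>+s. ennreal (1 - a) * (ennreal (s ^ 0 * exp (- s)) * indicator {0..} s)
            + ennreal a * (ennreal (s ^ 1 * exp (- s)) * indicator {0..} s) \<partial>lborel)"
  proof (intro nn_integral_mono)
    fix s :: real
    have "0 \<le> s \<Longrightarrow> s powr a * exp (- s) \<le> (1 - a) * exp (- s) + a * (s * exp (- s))"
      using mult_right_mono[OF powr_le_affine[of s a], of "exp (- s)"] assms by (simp add: algebra_simps)
    then show "ennreal (s powr a * exp (- s)) * indicator {0..} s \<le>
        ennreal (1 - a) * (ennreal (s ^ 0 * exp (- s)) * indicator {0..} s)
            + ennreal a * (ennreal (s ^ 1 * exp (- s)) * indicator {0..} s)"
      using assms by (auto simp: indicator_def ennreal_mult[symmetric] ennreal_plus[symmetric] simp del: ennreal_plus intro!: ennreal_leI)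
  qed
  also have "\<dots> = ennreal (1 - a) * 1 + ennreal a * 1"
    by (subst nn_integral_add, simp, simp, subst (1 2) nn_integral_cmult)
       (use nn_intergal_power_times_exp_Ici[of 0] nn_intergal_power_times_exp_Ici[of 1] in auto)
  also have "\<dots> = 1" using ennreal_plus[of "1 - a" a] assms by simp
  finally show ?thesis .
qed

section \<open>Lower tail of the empirical second-moment matrix\<close>

text \<open>Describes a design that is already whitened: \<open>isotropic\<close> says that the
  second-moment matrix is the identity, so no matrix root appears. The abstract space
  \<open>M\<close> is later the joint law, with \<open>X\<close> the whitened first
  component.\<close>

locale small_ball_sample = prob_space M for M :: "'a measure" +
  fixes X :: "'a \<Rightarrow> 'b::euclidean_space" and C \<alpha> :: real
  assumes X[measurable]: "X \<in> borel_measurable M"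
    and isotropic: "\<And>\<theta>. (\<integral>\<^sup>+x. ennreal ((\<theta> \<bullet> X x)\<^sup>2) \<partial>M) = ennreal ((norm \<theta>)\<^sup>2)"
    and small_ball_X: "\<And>\<theta> t. \<theta> \<noteq> 0 \<Longrightarrow> 0 < t \<Longrightarrow> prob {x \<in> space M. \<bar>\<theta> \<bullet> X x\<bar> \<le> t * norm \<theta>} \<le> (C * t) powr \<alpha>"
    and C: "1 \<le> C" and \<alpha>: "0 < \<alpha>" "\<alpha> \<le> 1"
begin

lemma nn_integral_norm_squared: "(\<integral>\<^sup>+x. ennreal ((norm (X x))\<^sup>2) \<partial>M) = ennreal DIM('b)"
proof -
  have "(\<integral>\<^sup>+x. ennreal ((norm (X x))\<^sup>2) \<partial>M) = (\<integral>\<^sup>+x. (\<Sum>b\<in>Basis. ennreal ((b \<bullet> X x)\<^sup>2)) \<partial>M)"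
    unfolding norm_squared_eq_sum_Basis inner_commute[of "X _"]
    by (intro nn_integral_cong sum_ennreal[symmetric]) simp
  also have "\<dots> = (\<Sum>b\<in>(Basis::'b set). ennreal ((norm b)\<^sup>2))"
    by (subst nn_integral_sum) (simp_all only: isotropic, measurable)
  also have "\<dots> = ennreal (\<Sum>b\<in>(Basis::'b set). 1)" by (simp add: ennreal_of_nat_eq_real_of_nat)
  finally show ?thesis by (simp add: ennreal_of_nat_eq_real_of_nat)
qed

text \<open>Radial projection onto the ball of radius \<open>sqrt DIM('b)\<close>, the root mean
  square of \<open>norm (X x)\<close>. It makes the smoothing cost bounded for every sample, and it
  only decreases the quadratic form that is to be bounded below. At \<open>X x = 0\<close> the
  quotient is 0 by convention and the value is 0, as it should be.\<close>

definition shrunk :: "'a \<Rightarrow> 'b" where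
  "shrunk x = min 1 (sqrt DIM('b) / norm (X x)) *\<^sub>R X x"

lemma measurable_shrunk[measurable]: "shrunk \<in> borel_measurable M"
  unfolding shrunk_def by measurable

lemma norm_shrunk: "(norm (shrunk x))\<^sup>2 \<le> DIM('b)"
proof -
  have "norm (shrunk x) \<le> sqrt DIM('b)"
  proof (cases "X x = 0")
    case False
    have "norm (shrunk x) = min 1 (sqrt DIM('b) / norm (X x)) * norm (X x)" by (simp add: shrunk_def)
    also have "\<dots> \<le> sqrt DIM('b) / norm (X x) * norm (X x)" by (intro mult_right_mono) auto
    finally show ?thesis using False by simp
  qed (simp add: shrunk_def)
  then have "(norm (shrunk x))\<^sup>2 \<le> (sqrt DIM('b))\<^sup>2" by (intro power_mono) auto
  then show ?thesis by simp
qed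

lemma inner_shrunk_le: "(\<theta> \<bullet> shrunk x)\<^sup>2 \<le> (\<theta> \<bullet> X x)\<^sup>2"
proof -
  let ?c = "min 1 (sqrt DIM('b) / norm (X x))"
  have "\<bar>?c\<bar> \<le> 1" by simp
  then have "?c\<^sup>2 \<le> 1" by (simp add: abs_square_le_1)
  then have "?c\<^sup>2 * (\<theta> \<bullet> X x)\<^sup>2 \<le> 1 * (\<theta> \<bullet> X x)\<^sup>2" by (intro mult_right_mono) auto
  then show ?thesis by (simp add: shrunk_def power_mult_distrib)
qed

lemma prob_norm_gt:
  assumes "0 < K"
  shows "prob {x \<in> space M. K * sqrt DIM('b) < norm (X x)} \<le> 1 / K\<^sup>2"
proof -
  let ?A = "{x \<in> space M. K * sqrt DIM('b) < norm (X x)}"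
  have "ennreal (K\<^sup>2 * DIM('b)) * emeasure M ?A = (\<integral>\<^sup>+x. ennreal (K\<^sup>2 * DIM('b)) * indicator ?A x \<partial>M)"
    by (subst nn_integral_cmult_indicator) auto
  also have "\<dots> \<le> (\<integral>\<^sup>+x. ennreal ((norm (X x))\<^sup>2) \<partial>M)"
  proof (intro nn_integral_mono)
    fix x assume "x \<in> space M"
    have "K\<^sup>2 * DIM('b) \<le> (norm (X x))\<^sup>2" if "x \<in> ?A"
    proof -
      have "(K * sqrt DIM('b))\<^sup>2 \<le> (norm (X x))\<^sup>2" using that assms by (intro power_mono) auto
      then show ?thesis by (simp add: power_mult_distrib)
    qed
    then show "ennreal (K\<^sup>2 * DIM('b)) * indicator ?A x \<le> ennreal ((norm (X x))\<^sup>2)"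
      by (auto simp: indicator_def intro!: ennreal_leI)
  qed
  also have "\<dots> = ennreal DIM('b)" by (rule nn_integral_norm_squared)
  finally have "K\<^sup>2 * DIM('b) * prob ?A \<le> DIM('b)"
    by (simp add: emeasure_eq_measure flip: ennreal_mult)
  then have "K\<^sup>2 * prob ?A \<le> 1"
    using mult_le_cancel_left_pos[of "real DIM('b)" "K\<^sup>2 * prob ?A" 1] by (simp add: mult_ac)
  then show ?thesis using assms by (simp add: field_simps)
qed

text \<open>Either the projection shrinks \<open>X\<close> by more than a factor \<open>K\<close>,
  which by Markov's inequality has probability at most \<open>1 / K\<^sup>2\<close>, or
  \<open>\<theta> \<bullet> X\<close> itself lies in the small ball of radius \<open>K * u\<close>.
  For \<open>C * u \<ge> 1\<close> the bound exceeds 1.\<close>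

lemma small_ball_shrunk:
  assumes \<theta>: "\<theta> \<noteq> 0" and u: "0 < u"
  shows "prob {x \<in> space M. \<bar>\<theta> \<bullet> shrunk x\<bar> \<le> u * norm \<theta>} \<le> 2 * (C * u) powr (2 * \<alpha> / 3)"
proof (cases "C * u \<ge> 1")
  case True
  then have "1 \<le> (C * u) powr (2 * \<alpha> / 3)" using \<alpha> by (intro ge_one_powr_ge_zero) auto
  then show ?thesis using prob_le_1[of "{x \<in> space M. \<bar>\<theta> \<bullet> shrunk x\<bar> \<le> u * norm \<theta>}"] by linarith
next
  case False
  have Cu: "0 < C * u" "C * u < 1" using C u False by auto
  \<comment> \<open>The exponent -1/3 balances the two events: \<open>1 / K\<^sup>2\<close> and
    \<open>C * (K * u)\<close> both equal \<open>(C * u) powr (2 / 3)\<close>. Since this is below 1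
    and \<alpha> \<le> 1, raising it to the power \<alpha> covers both.\<close>
  define K where "K = (C * u) powr (- 1 / 3)"
  have K: "1 \<le> K"
    using Cu powr_mono'[of "- 1 / 3" 0 "C * u"] by (auto simp: K_def split: if_splits)
  let ?A = "{x \<in> space M. K * sqrt DIM('b) < norm (X x)}"
  let ?B = "{x \<in> space M. \<bar>\<theta> \<bullet> X x\<bar> \<le> (K * u) * norm \<theta>}"
  have "{x \<in> space M. \<bar>\<theta> \<bullet> shrunk x\<bar> \<le> u * norm \<theta>} \<subseteq> ?A \<union> ?B"
  proof safe
    fix x assume x: "x \<in> space M" "\<bar>\<theta> \<bullet> shrunk x\<bar> \<le> u * norm \<theta>" "\<not> \<bar>\<theta> \<bullet> X x\<bar> \<le> (K * u) * norm \<theta>"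
    show "K * sqrt DIM('b) < norm (X x)"
    proof (rule ccontr)
      assume le: "\<not> K * sqrt DIM('b) < norm (X x)"
      show False
      proof (cases "X x = 0")
        case True
        then show False using x(3) K u by simp
      next
        case X0: False
        let ?c = "min 1 (sqrt DIM('b) / norm (X x))"
        have "1 / K \<le> ?c" using K le X0 by (auto simp: field_simps)
        then have "1 / K * \<bar>\<theta> \<bullet> X x\<bar> \<le> ?c * \<bar>\<theta> \<bullet> X x\<bar>" by (intro mult_right_mono) auto
        also have "\<dots> = \<bar>\<theta> \<bullet> shrunk x\<bar>" by (simp add: shrunk_def abs_mult)
        finally have "\<bar>\<theta> \<bullet> X x\<bar> \<le> K * \<bar>\<theta> \<bullet> shrunk x\<bar>" using K by (simp add: field_simps)
        also have "\<dots> \<le> K * (u * norm \<theta>)" using x(2) K by (intro mult_left_mono) auto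
        finally have "\<bar>\<theta> \<bullet> X x\<bar> \<le> K * (u * norm \<theta>)" .
        then show False using x(3) by (simp add: mult_ac)
      qed
    qed
  qed
  then have "prob {x \<in> space M. \<bar>\<theta> \<bullet> shrunk x\<bar> \<le> u * norm \<theta>} \<le> prob ?A + prob ?B"
    by (intro order_trans[OF finite_measure_mono measure_Un_le]) auto
  also have "prob ?A \<le> 1 / K\<^sup>2" using K by (intro prob_norm_gt) auto
  also have "prob ?B \<le> (C * (K * u)) powr \<alpha>" using K u \<theta> by (intro small_ball_X) auto
  also have "(C * (K * u)) powr \<alpha> = (C * u) powr (2 * \<alpha> / 3)"
  proof -
    have "C * (K * u) = (C * u) powr (2 / 3)"
      using Cu powr_add[of "C * u" 1 "- 1 / 3"] by (simp add: K_def mult_ac)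
    then show ?thesis by (simp add: powr_powr)
  qed
  also have "1 / K\<^sup>2 \<le> (C * u) powr (2 * \<alpha> / 3)"
  proof -
    have "1 / K\<^sup>2 = (C * u) powr (2 / 3)"
      using Cu powr_minus[of "C * u" "2 / 3"] K
      by (simp add: K_def powr_powr field_simps flip: powr_numeral)
    also have "\<dots> \<le> (C * u) powr (2 * \<alpha> / 3)" using Cu \<alpha> by (intro powr_mono') auto
    finally show ?thesis .
  qed
  finally show ?thesis by simp
qed

text \<open>By the layer-cake formula the left side is the integral of \<open>exp (- s)\<close>
  times the probability that the form is at most \<open>s\<close>. The small-ball bound at radius
  \<open>sqrt (s / L) / norm \<theta>\<close> supplies \<open>s powr (\<alpha> / 3)\<close>, leaving
  a Gamma integral of at most 1.\<close>

lemma laplace_shrunk: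
  assumes \<theta>: "\<theta> \<noteq> 0" and L: "0 < L"
  shows "(\<integral>\<^sup>+x. ennreal (exp (- (L * (\<theta> \<bullet> shrunk x)\<^sup>2))) \<partial>M)
           \<le> ennreal (2 * (C / (norm \<theta> * sqrt L)) powr (2 * \<alpha> / 3))"
proof -
  define k where "k = 2 * (C / (norm \<theta> * sqrt L)) powr (2 * \<alpha> / 3)"
  have k0: "0 \<le> k" by (simp add: k_def)
  interpret pair_sigma_finite M "lborel :: real measure" ..
  have "(\<integral>\<^sup>+x. ennreal (exp (- (L * (\<theta> \<bullet> shrunk x)\<^sup>2))) \<partial>M)
      = (\<integral>\<^sup>+x. (\<integral>\<^sup>+s. ennreal (exp (- s)) * indicator {L * (\<theta> \<bullet> shrunk x)\<^sup>2..} s \<partial>lborel) \<partial>M)"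
    by (simp add: nn_integral_exp_tail)
  also have "\<dots> = (\<integral>\<^sup>+x. (\<integral>\<^sup>+s. ennreal (exp (- s)) * (if L * (\<theta> \<bullet> shrunk x)\<^sup>2 \<le> s then 1 else 0) \<partial>lborel) \<partial>M)"
    by (intro nn_integral_cong) (auto simp: indicator_def)
  also have "\<dots> = (\<integral>\<^sup>+s. (\<integral>\<^sup>+x. ennreal (exp (- s)) * (if L * (\<theta> \<bullet> shrunk x)\<^sup>2 \<le> s then 1 else 0) \<partial>M) \<partial>lborel)"
    by (rule Fubini'[symmetric]) measurable
  also have "\<dots> \<le> (\<integral>\<^sup>+s. ennreal k * (ennreal (s powr (\<alpha> / 3) * exp (- s)) * indicator {0..} s) \<partial>lborel)"
  \<comment> \<open>The point \<open>s = 0\<close> is discarded as a null set because the small-ball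
    bound requires a positive radius.\<close>
  proof (rule nn_integral_mono_AE, rule eventually_mono[OF AE_lborel_singleton[of 0]])
    fix s :: real assume s0: "s \<noteq> 0"
    let ?E = "{x \<in> space M. L * (\<theta> \<bullet> shrunk x)\<^sup>2 \<le> s}"
    have "(\<integral>\<^sup>+x. ennreal (exp (- s)) * (if L * (\<theta> \<bullet> shrunk x)\<^sup>2 \<le> s then 1 else 0) \<partial>M)
        = (\<integral>\<^sup>+x. ennreal (exp (- s)) * indicator ?E x \<partial>M)"
      by (intro nn_integral_cong) (auto simp: indicator_def)
    also have "\<dots> = ennreal (exp (- s)) * emeasure M ?E"
      by (rule nn_integral_cmult_indicator) measurable
    also have "\<dots> \<le> ennreal k * (ennreal (s powr (\<alpha> / 3) * exp (- s)) * indicator {0..} s)"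
    proof (cases "s < 0")
      case True
      have "L * (\<theta> \<bullet> shrunk x)\<^sup>2 \<ge> 0" for x using L by simp
      then have "?E = {}" using True by (auto simp: not_le intro: less_le_trans)
      then show ?thesis by (simp only: emeasure_empty) simp
    next
      case False
      then have s: "0 < s" using s0 by simp
      have E: "?E \<subseteq> {x \<in> space M. \<bar>\<theta> \<bullet> shrunk x\<bar> \<le> (sqrt (s / L) / norm \<theta>) * norm \<theta>}"
      proof safe
        fix x assume "L * (\<theta> \<bullet> shrunk x)\<^sup>2 \<le> s"
        then have "(\<theta> \<bullet> shrunk x)\<^sup>2 \<le> s / L" using L by (simp add: pos_le_divide_eq mult.commute)
        then have "\<bar>\<theta> \<bullet> shrunk x\<bar> \<le> sqrt (s / L)" using real_sqrt_le_iff[of "(\<theta> \<bullet> shrunk x)\<^sup>2"] by simp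
        then show "\<bar>\<theta> \<bullet> shrunk x\<bar> \<le> (sqrt (s / L) / norm \<theta>) * norm \<theta>" using \<theta> by simp
      qed
      have "prob ?E \<le> 2 * (C * (sqrt (s / L) / norm \<theta>)) powr (2 * \<alpha> / 3)"
        by (rule order_trans[OF finite_measure_mono[OF E] small_ball_shrunk]) (use s L \<theta> in auto)
      also have "C * (sqrt (s / L) / norm \<theta>) = (C / (norm \<theta> * sqrt L)) * s powr (1 / 2)"
        using s L by (simp add: real_sqrt_divide powr_half_sqrt)
      also have "2 * \<dots> powr (2 * \<alpha> / 3) = k * s powr (\<alpha> / 3)"
        using C L s by (subst powr_mult) (auto simp: k_def powr_powr)
      finally have "prob ?E \<le> k * s powr (\<alpha> / 3)" .
      then have "exp (- s) * prob ?E \<le> exp (- s) * (k * s powr (\<alpha> / 3))" by (intro mult_left_mono) auto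
      then have "ennreal (exp (- s) * prob ?E) \<le> ennreal (k * (s powr (\<alpha> / 3) * exp (- s)))"
        by (intro ennreal_leI) (simp add: mult_ac)
      then show ?thesis using s k0 by (simp add: emeasure_eq_measure ennreal_mult)
    qed
    finally show "(\<integral>\<^sup>+x. ennreal (exp (- s)) * (if L * (\<theta> \<bullet> shrunk x)\<^sup>2 \<le> s then 1 else 0) \<partial>M)
      \<le> ennreal k * (ennreal (s powr (\<alpha> / 3) * exp (- s)) * indicator {0..} s)" .
  qed
  also have "\<dots> = ennreal k * (\<integral>\<^sup>+s. ennreal (s powr (\<alpha> / 3) * exp (- s)) * indicator {0..} s \<partial>lborel)"
    by (rule nn_integral_cmult) measurable
  also have "\<dots> \<le> ennreal k * 1"
    using \<alpha> by (intro mult_left_mono nn_integral_powr_exp_le) auto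
  finally show ?thesis by (simp add: k_def)
qed

end

section \<open>Lower tail of the quadratic form, uniformly over all directions\<close>

lemma nn_integral_lborel_shift:
  fixes \<theta> :: "'a::euclidean_space"
  assumes [measurable]: "h \<in> borel_measurable borel"
  shows "(\<integral>\<^sup>+\<eta>. h (\<theta> + \<eta>) \<partial>lborel) = (\<integral>\<^sup>+\<eta>. h \<eta> \<partial>lborel)"
proof -
  have "(\<integral>\<^sup>+\<eta>. h \<eta> \<partial>lborel) = (\<integral>\<^sup>+\<eta>. h \<eta> \<partial>distr lborel borel ((+) \<theta>))"
    by (subst lborel_distr_plus) (rule refl)
  also have "\<dots> = (\<integral>\<^sup>+\<eta>. h (\<theta> + \<eta>) \<partial>lborel)" by (subst nn_integral_distr) auto
  finally show ?thesis by simp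
qed

context small_ball_sample
begin

text \<open>The bad direction depends on the sample, so it cannot be inserted into an expectation
  directly. By Jensen, one bad direction forces the integral of \<open>exp (- L * q)\<close> over
  the ball of radius \<delta> around it, hence over a fixed annulus, to be at least
  \<open>c\<close>. Tonelli and independence bound the expectation of that integral by the n-th
  power of a Laplace transform times a volume. The volume ratio
  \<open>(3 / (2 * \<delta>)) ^ DIM('b)\<close> plays the part of the cardinality of a net.\<close>

lemma prob_small_quadratic_form:
  fixes n :: nat and \<delta> L t :: real
  defines "S \<equiv> \<Pi>\<^sub>M i\<in>{..<n}. M"
  assumes \<delta>: "0 < \<delta>" "\<delta> \<le> 1 / 2" and L: "0 < L"
    and A[measurable]: "A \<in> sets S"
    and bad: "\<And>z. z \<in> A \<Longrightarrow> \<exists>\<theta>. norm \<theta> = 1 \<and> (\<Sum>i<n. (\<theta> \<bullet> X (z i))\<^sup>2) \<le> n * t"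
  shows "measure S A \<le> exp (L * n * (t + \<delta>\<^sup>2)) * (3 / (2 * \<delta>)) ^ DIM('b) * (2 * (2 * C / sqrt L) powr (2 * \<alpha> / 3)) ^ n"
proof -
  interpret S: prob_space S unfolding S_def by (rule prob_space_PiM) (rule prob_space_axioms)
  interpret prod: product_sigma_finite "\<lambda>_::nat. M" ..
  interpret pair_sigma_finite S "lborel :: 'b measure" ..
  define V where "V r = measure lborel (cball (0::'b) r)" for r
  have V: "V r = unit_ball_vol DIM('b) * r ^ DIM('b)" if "0 \<le> r" for r
    unfolding V_def using that by (rule content_cball)
  \<comment> \<open>The annulus contains every ball of radius \<delta> \<le> 1/2 around a unit
    vector. Its inner radius makes the Laplace bound uniform, whence the factor 2 in
    \<open>2 * C / sqrt L\<close>; its outer radius enters the volume ratio.\<close>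
  define R :: "'b set" where "R = {\<eta>. 1 / 2 \<le> norm \<eta> \<and> norm \<eta> \<le> 3 / 2}"
  have R[measurable]: "R \<in> sets borel" unfolding R_def by measurable
  define G where "G \<eta> z = exp (- (L * (\<Sum>i<n. (\<eta> \<bullet> shrunk (z i))\<^sup>2)))" for \<eta> :: 'b and z :: "nat \<Rightarrow> 'a"
  define K where "K = 2 * (2 * C / sqrt L) powr (2 * \<alpha> / 3)"
  define c where "c = V \<delta> * exp (- (L * n * (t + \<delta>\<^sup>2)))"
  have K0: "0 \<le> K" by (simp add: K_def)
  have [measurable]: "(\<lambda>z. shrunk (z i)) \<in> borel_measurable S" if "i < n" for i
    using that unfolding S_def
    by (intro measurable_compose[OF _ measurable_shrunk]) auto
  have [measurable]: "case_prod (\<lambda>z \<eta>. G \<eta> z) \<in> borel_measurable (S \<Otimes>\<^sub>M borel)"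
    unfolding G_def split_beta' by measurable
  have point: "ennreal c \<le> (\<integral>\<^sup>+\<eta>. indicator R \<eta> * ennreal (G \<eta> z) \<partial>lborel)" if z: "z \<in> A" for z
  proof -
    obtain \<theta> where \<theta>: "norm \<theta> = 1" and q: "(\<Sum>i<n. (\<theta> \<bullet> X (z i))\<^sup>2) \<le> n * t" using bad[OF z] by blast
    have Gc: "continuous_on UNIV (\<lambda>\<eta>. G (\<theta> + \<eta>) z)"
      unfolding G_def by (intro continuous_intros)
    then have [measurable]: "(\<lambda>\<eta>. G (\<theta> + \<eta>) z) \<in> borel_measurable borel" by (rule borel_measurable_continuous_onI)
    have Gm[measurable]: "(\<lambda>\<eta>. G \<eta> z) \<in> borel_measurable borel"
      unfolding G_def by measurable
    have "(\<Sum>i<n. (\<theta> \<bullet> shrunk (z i))\<^sup>2) \<le> n * t"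
      by (rule order_trans[OF sum_mono[OF inner_shrunk_le] q])
    moreover have "\<delta>\<^sup>2 / DIM('b) * (\<Sum>i<n. (norm (shrunk (z i)))\<^sup>2) \<le> \<delta>\<^sup>2 / DIM('b) * (\<Sum>i<n. DIM('b))"
      by (subst of_nat_sum, intro mult_left_mono sum_mono norm_shrunk) auto
    ultimately have "(\<Sum>i<n. (\<theta> \<bullet> shrunk (z i))\<^sup>2) + \<delta>\<^sup>2 / DIM('b) * (\<Sum>i<n. (norm (shrunk (z i)))\<^sup>2) \<le> n * t + \<delta>\<^sup>2 * n"
      by simp
    then have "L * ((\<Sum>i<n. (\<theta> \<bullet> shrunk (z i))\<^sup>2) + \<delta>\<^sup>2 / DIM('b) * (\<Sum>i<n. (norm (shrunk (z i)))\<^sup>2)) \<le> L * (n * t + \<delta>\<^sup>2 * n)"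
      using L by (intro mult_left_mono) auto
    also have "\<dots> = L * n * (t + \<delta>\<^sup>2)" by (simp add: distrib_left mult_ac)
    finally have m: "L * ((\<Sum>i<n. (\<theta> \<bullet> shrunk (z i))\<^sup>2) + \<delta>\<^sup>2 / DIM('b) * (\<Sum>i<n. (norm (shrunk (z i)))\<^sup>2)) \<le> L * n * (t + \<delta>\<^sup>2)" .
    \<comment> \<open>Jensen is applied to the projected vectors: their form at \<theta> is no
      larger than the original one, and their squared norms sum to at most
      \<open>n * DIM('b)\<close>, so the smoothing cost is at most
      \<open>\<delta>\<^sup>2 * n\<close>.\<close>
    have "c \<le> V \<delta> * exp (- (L * ((\<Sum>i<n. (\<theta> \<bullet> shrunk (z i))\<^sup>2) + \<delta>\<^sup>2 / DIM('b) * (\<Sum>i<n. (norm (shrunk (z i)))\<^sup>2))))"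
      unfolding c_def using m by (intro mult_left_mono) (auto simp: V_def)
    also have "\<dots> \<le> (LINT \<eta>:cball 0 \<delta>|lborel. G (\<theta> + \<eta>) z)"
      unfolding V_def G_def using \<delta> L by (intro integral_cball_exp_quadratic) auto
    finally have "ennreal c \<le> ennreal (LINT \<eta>:cball 0 \<delta>|lborel. G (\<theta> + \<eta>) z)" by (rule ennreal_leI)
    also have "\<dots> = (\<integral>\<^sup>+\<eta>. ennreal (indicator (cball 0 \<delta>) \<eta> *\<^sub>R G (\<theta> + \<eta>) z) \<partial>lborel)"
      unfolding set_lebesgue_integral_def
      using set_integrable_cball[OF Gc, of \<delta>] unfolding set_integrable_def
      by (intro nn_integral_eq_integral[symmetric]) (auto simp: G_def)
    also have "\<dots> = (\<integral>\<^sup>+\<eta>. indicator (cball \<theta> \<delta>) (\<theta> + \<eta>) * ennreal (G (\<theta> + \<eta>) z) \<partial>lborel)"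
      by (intro nn_integral_cong) (auto simp: indicator_def dist_norm)
    also have "\<dots> = (\<integral>\<^sup>+\<eta>. indicator (cball \<theta> \<delta>) \<eta> * ennreal (G \<eta> z) \<partial>lborel)"
      by (intro nn_integral_lborel_shift borel_measurable_times_ennreal borel_measurable_indicator
          measurable_compose[OF Gm measurable_ennreal]) simp
    also have "\<dots> \<le> (\<integral>\<^sup>+\<eta>. indicator R \<eta> * ennreal (G \<eta> z) \<partial>lborel)"
    proof (intro nn_integral_mono mult_right_mono)
      fix \<eta> :: 'b
      have "\<eta> \<in> R" if "\<eta> \<in> cball \<theta> \<delta>"
      proof -
        have d: "norm (\<theta> - \<eta>) \<le> \<delta>" using that by (simp add: dist_norm)
        have "norm \<theta> - norm \<eta> \<le> norm (\<theta> - \<eta>)" "norm \<eta> - norm \<theta> \<le> norm (\<theta> - \<eta>)"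
          using norm_triangle_ineq2[of \<theta> \<eta>] norm_triangle_ineq2[of \<eta> \<theta>] by (auto simp: norm_minus_commute)
        then show ?thesis using d \<theta> \<delta> by (simp add: R_def)
      qed
      then show "indicator (cball \<theta> \<delta>) \<eta> \<le> (indicator R \<eta> :: ennreal)" by (simp add: indicator_def)
    qed simp
    finally show ?thesis .
  qed
  have EG: "(\<integral>\<^sup>+z. ennreal (G \<eta> z) \<partial>S) \<le> ennreal (K ^ n)" if \<eta>: "\<eta> \<in> R" for \<eta>
  proof -
    have "norm \<eta> \<noteq> 0" using \<eta> unfolding R_def by auto
    then have \<eta>0: "\<eta> \<noteq> 0" by simp
    have "(\<integral>\<^sup>+z. ennreal (G \<eta> z) \<partial>S) = (\<integral>\<^sup>+z. (\<Prod>i<n. ennreal (exp (- (L * (\<eta> \<bullet> shrunk (z i))\<^sup>2)))) \<partial>S)"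
      by (intro nn_integral_cong) (simp add: G_def prod_ennreal sum_distrib_left flip: exp_sum sum_negf)
    also have "\<dots> = (\<Prod>i<n. \<integral>\<^sup>+x. ennreal (exp (- (L * (\<eta> \<bullet> shrunk x)\<^sup>2))) \<partial>M)"
      unfolding S_def by (intro prod.product_nn_integral_prod) auto
    also have "\<dots> \<le> (\<Prod>i<n. ennreal K)"
    proof (intro prod_mono_ennreal)
      have "(\<integral>\<^sup>+x. ennreal (exp (- (L * (\<eta> \<bullet> shrunk x)\<^sup>2))) \<partial>M) \<le> ennreal (2 * (C / (norm \<eta> * sqrt L)) powr (2 * \<alpha> / 3))"
        by (rule laplace_shrunk[OF \<eta>0 L])
      also have "\<dots> \<le> ennreal K"
      proof (unfold K_def, intro ennreal_leI mult_left_mono powr_mono2)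
        have "1 * (C / sqrt L) \<le> (2 * norm \<eta>) * (C / sqrt L)"
          using \<eta> C L by (intro mult_right_mono) (auto simp: R_def)
        then show "C / (norm \<eta> * sqrt L) \<le> 2 * C / sqrt L"
          using \<eta>0 L by (simp add: field_simps)
      qed (use \<alpha> C L in auto)
      finally show "(\<integral>\<^sup>+x. ennreal (exp (- (L * (\<eta> \<bullet> shrunk x)\<^sup>2))) \<partial>M) \<le> ennreal K" .
    qed
    also have "\<dots> = ennreal (K ^ n)" using K0 by (simp add: ennreal_power)
    finally show ?thesis .
  qed
  have "ennreal c * emeasure S A = (\<integral>\<^sup>+z. ennreal c * indicator A z \<partial>S)"
    by (rule nn_integral_cmult_indicator[symmetric]) (rule A)
  also have "\<dots> \<le> (\<integral>\<^sup>+z. (\<integral>\<^sup>+\<eta>. indicator R \<eta> * ennreal (G \<eta> z) \<partial>lborel) \<partial>S)"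
    by (intro nn_integral_mono) (use point in \<open>auto simp: indicator_def\<close>)
  also have "\<dots> = (\<integral>\<^sup>+\<eta>. (\<integral>\<^sup>+z. indicator R \<eta> * ennreal (G \<eta> z) \<partial>S) \<partial>lborel)"
    by (rule Fubini'[symmetric]) measurable
  also have "\<dots> = (\<integral>\<^sup>+\<eta>. indicator R \<eta> * (\<integral>\<^sup>+z. ennreal (G \<eta> z) \<partial>S) \<partial>lborel)"
    by (intro nn_integral_cong nn_integral_cmult) measurable
  also have "\<dots> \<le> (\<integral>\<^sup>+\<eta>. ennreal (K ^ n) * indicator (cball (0::'b) (3/2)) \<eta> \<partial>lborel)"
  proof (rule nn_integral_mono)
    fix \<eta> :: 'b
    have "\<eta> \<in> cball 0 (3/2)" if "\<eta> \<in> R" using that by (simp add: R_def)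
    then show "indicator R \<eta> * (\<integral>\<^sup>+z. ennreal (G \<eta> z) \<partial>S) \<le> ennreal (K ^ n) * indicator (cball (0::'b) (3/2)) \<eta>"
      using EG[of \<eta>] by (simp add: indicator_def)
  qed
  also have "\<dots> = ennreal (K ^ n) * emeasure lborel (cball (0::'b) (3/2))"
    by (rule nn_integral_cmult_indicator) simp
  also have "emeasure lborel (cball (0::'b) (3/2)) = ennreal (V (3/2))"
    unfolding V_def by (rule emeasure_eq_ennreal_measure) (use emeasure_lborel_cball_finite[of "0::'b" "3/2"] in auto)
  finally have "ennreal c * ennreal (measure S A) \<le> ennreal (K ^ n) * ennreal (V (3/2))"
    by (simp add: S.emeasure_eq_measure)
  moreover have "0 < c" using \<delta> by (simp add: c_def V)
  ultimately have "c * measure S A \<le> K ^ n * V (3/2)"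
    using K0 by (simp add: V flip: ennreal_mult)
  then have "measure S A \<le> K ^ n * V (3/2) / c" using \<open>0 < c\<close> by (simp add: field_simps)
  also have "\<dots> = exp (L * n * (t + \<delta>\<^sup>2)) * (3 / (2 * \<delta>)) ^ DIM('b) * K ^ n"
  proof -
    have u: "unit_ball_vol (real DIM('b)) \<noteq> 0" by (rule less_imp_neq[OF unit_ball_vol_pos, symmetric]) simp
    have "V (3/2) / V \<delta> = (3 / (2 * \<delta>)) ^ DIM('b)"
      using \<delta> u by (simp add: V flip: power_divide)
    moreover have "k * a / (b * exp (- m)) = exp m * (a / b) * k" for a b k m :: real
      by (simp add: exp_minus field_simps)
    ultimately show ?thesis by (simp only: c_def)
  qed
  finally show ?thesis unfolding K_def .
qed

end

text \<open>Origin of \<open>C'\<close>. After taking logarithms and inserting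
  \<open>d \<le> \<alpha> * n / 6\<close>, the coefficient of \<open>ln t\<close> is \<alpha> (1/3 -
  1/12) = \<alpha> / 4 per observation, which fixes the exponent. The power \<open>C ^ 4\<close>
  dominates the factor 2 \<alpha> / 3 of \<open>ln C\<close>, and the term 9 / \<alpha> in the
  exponential contributes 9/4, enough for the numerical constants, which stay below 1 + 0.7 +
  1/2.\<close>

lemma tail_constants:
  fixes n d :: nat and C \<alpha> t :: real
  assumes C: "1 \<le> C" and \<alpha>: "0 < \<alpha>" "\<alpha> \<le> 1" and t: "0 < t" "t \<le> 1 / 4"
    and d: "real d \<le> \<alpha> * n / 6"
  shows "exp (n :: real) * (3 / (2 * sqrt t)) ^ d * (2 * (2 * C * sqrt (2 * t)) powr (2 * \<alpha> / 3)) ^ n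
           \<le> (3 * C ^ 4 * exp (1 + 9 / \<alpha>) * t) powr (\<alpha> * n / 4)"
proof -
  define c T where "c = ln C" and "T = ln t"
  have c: "0 \<le> c" using C by (simp add: c_def)
  have st: "sqrt t \<le> 1 / 2" using t real_sqrt_le_iff[of t "1/4"] by (simp add: real_sqrt_divide)
  have s0: "0 < sqrt t" using t by simp
  have l1: "ln (3 / (2 * sqrt t)) = ln 3 - ln 2 - T / 2"
    using t by (simp add: T_def ln_div ln_mult ln_sqrt)
  have l1p: "0 \<le> ln (3 / (2 * sqrt t))" using st s0 by (intro ln_ge_zero) (simp add: field_simps)
  have l2: "ln (2 * C * sqrt (2 * t)) = 3 / 2 * ln 2 + c + T / 2"
    using t C by (simp add: T_def c_def ln_mult ln_sqrt field_simps)
  have l3: "ln (3 * C ^ 4 * exp (1 + 9 / \<alpha>) * t) = ln 3 + 4 * c + 1 + 9 / \<alpha> + T"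
    using t C by (simp add: T_def c_def ln_mult ln_realpow)
  have ln2: "ln 2 \<le> (0.7::real)" using ln2_le_25_over_36 by simp
  have ln3: "(1::real) \<le> ln 3" using ln_ge_iff[of 3 1] exp_le by simp
  have "ln (exp (n :: real) * (3 / (2 * sqrt t)) ^ d * (2 * (2 * C * sqrt (2 * t)) powr (2 * \<alpha> / 3)) ^ n)
      = n + d * ln (3 / (2 * sqrt t)) + n * (ln 2 + 2 * \<alpha> / 3 * ln (2 * C * sqrt (2 * t)))"
    using t C s0 by (simp add: ln_mult ln_realpow ln_powr distrib_left)
  also have "\<dots> \<le> n + \<alpha> * n / 6 * ln (3 / (2 * sqrt t)) + n * (ln 2 + 2 * \<alpha> / 3 * ln (2 * C * sqrt (2 * t)))"
    using mult_right_mono[OF d l1p] by simp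
  also have "\<dots> = n * (1 + \<alpha> / 6 * (ln 3 - ln 2 - T / 2) + (ln 2 + 2 * \<alpha> / 3 * (3 / 2 * ln 2 + c + T / 2)))"
    unfolding l1 l2 by (simp add: algebra_simps)
  also have "\<dots> \<le> n * (\<alpha> / 4 * (ln 3 + 4 * c + 1 + 9 / \<alpha> + T))"
  proof (intro mult_left_mono)
    have "\<alpha> * (5 / 6 * ln 2 - 1 / 12 * ln 3 - 1 / 4) \<le> \<alpha> * (1 / 2)"
      using ln2 ln3 \<alpha> by (intro mult_left_mono) auto
    then have 1: "5 / 6 * (\<alpha> * ln 2) - 1 / 12 * (\<alpha> * ln 3) - \<alpha> / 4 \<le> 1 / 2"
      using \<alpha> by (simp add: right_diff_distrib)
    have 2: "0 \<le> \<alpha> * c" using \<alpha> c by simp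
    have 3: "\<alpha> / 4 * (ln 3 + 4 * c + 1 + 9 / \<alpha> + T) = (\<alpha> * ln 3) / 4 + \<alpha> * c + \<alpha> / 4 + (\<alpha> * T) / 4 + 9 / 4"
      using \<alpha> by (simp add: distrib_left)
    have 4: "1 + \<alpha> / 6 * (ln 3 - ln 2 - T / 2) + (ln 2 + 2 * \<alpha> / 3 * (3 / 2 * ln 2 + c + T / 2))
        = 1 + ln 2 + (\<alpha> * ln 3) / 6 + 5 / 6 * (\<alpha> * ln 2) + 2 / 3 * (\<alpha> * c) + (\<alpha> * T) / 4"
      by (simp add: right_diff_distrib distrib_left mult_ac)
    show "1 + \<alpha> / 6 * (ln 3 - ln 2 - T / 2) + (ln 2 + 2 * \<alpha> / 3 * (3 / 2 * ln 2 + c + T / 2))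
        \<le> \<alpha> / 4 * (ln 3 + 4 * c + 1 + 9 / \<alpha> + T)"
      unfolding 3 4 using 1 2 ln2 by linarith
  qed simp
  also have "\<dots> = ln ((3 * C ^ 4 * exp (1 + 9 / \<alpha>) * t) powr (\<alpha> * n / 4))"
    using t C by (subst ln_powr) (auto simp: l3)
  finally show ?thesis
    using t C s0 by (subst (asm) ln_le_cancel_iff) auto
qed

text \<open>If \<open>l < t\<close>, then \<open>l\<close> lies between two consecutive dyadic
  multiples of \<open>t\<close>, say the levels \<open>k\<close> and \<open>Suc k\<close>, and
  \<open>1 / l ^ 8\<close> is at most \<open>256 ^ Suc k / t ^ 8\<close> because 2^8 = 256. The
  summand 1 covers \<open>l \<ge> t\<close>. This discretizes the moment into countably many tail
  probabilities.\<close>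

lemma inverse_power8_dyadic:
  fixes l t :: real
  assumes l: "0 < l" and t: "0 < t"
  shows "ennreal ((1 / l) ^ 8) \<le> ennreal ((1 / t) ^ 8) * (1 + (\<Sum>k. ennreal (256 ^ Suc k) * (if l < (1 / 2) ^ k * t then 1 else 0)))"
proof (cases "l < t")
  case False
  then have "(1 / l) ^ 8 \<le> (1 / t) ^ 8" using t by (intro power_mono) (auto simp: frac_le)
  then have "ennreal ((1 / l) ^ 8) \<le> ennreal ((1 / t) ^ 8) * 1" by (simp add: ennreal_leI)
  also have "\<dots> \<le> ennreal ((1 / t) ^ 8) * (1 + (\<Sum>k. ennreal (256 ^ Suc k) * (if l < (1 / 2) ^ k * t then 1 else 0)))"
    by (intro mult_left_mono) auto
  finally show ?thesis .
next
  case True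
  let ?P = "\<lambda>k. (1 / 2) ^ k * t \<le> l"
  obtain m where "(1 / 2 :: real) ^ m < l / t" using real_arch_pow_inv[of "l / t" "1 / 2"] l t by auto
  then have "?P m" using t by (simp add: field_simps)
  moreover have "\<not> ?P 0" using True by simp
  ultimately obtain k where k: "\<not> ?P k" "?P (Suc k)" using ex_least_nat_less[of ?P m] by blast
  let ?f = "\<lambda>k. ennreal (256 ^ Suc k) * (if l < (1 / 2) ^ k * t then 1 else 0)"
  have "1 / l \<le> 1 / ((1 / 2) ^ Suc k * t)" using k(2) l t by (intro divide_left_mono) auto
  then have "(1 / l) ^ 8 \<le> (1 / ((1 / 2) ^ Suc k * t)) ^ 8" using l by (intro power_mono) auto
  also have "\<dots> = (1 / t) ^ 8 * 256 ^ Suc k"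
  proof -
    have "1 / ((1 / 2) ^ Suc k * t) = 1 / t * 2 ^ Suc k" by (simp add: power_one_over field_simps)
    moreover have "((2::real) ^ Suc k) ^ 8 = (2 ^ 8) ^ Suc k" by (simp only: power_mult[symmetric] mult.commute)
    ultimately show ?thesis by (simp only: power_mult_distrib) simp
  qed
  finally have "ennreal ((1 / l) ^ 8) \<le> ennreal ((1 / t) ^ 8) * ?f k"
    using k(1) t by (simp add: ennreal_leI flip: ennreal_mult)
  also have "?f k \<le> (\<Sum>k. ?f k)"
    using sum_le_suminf[of ?f "{k}"] by simp
  also have "ennreal ((1 / t) ^ 8) * (\<Sum>k. ?f k) \<le> ennreal ((1 / t) ^ 8) * (1 + (\<Sum>k. ?f k))"
    by (intro mult_left_mono) auto
  finally show ?thesis by (simp add: mult_left_mono)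
qed

context small_ball_sample
begin

text \<open>\<open>N\<close> is the reciprocal of the smallest eigenvalue of the empirical matrix,
  given as a measurable function of the design vectors alone. This form matters later, when the
  noise is averaged conditionally on the design with a power of \<open>N\<close> as weight.\<close>

lemma inverse_eigenvalue_moment:
  fixes n :: nat
  defines "S \<equiv> \<Pi>\<^sub>M i\<in>{..<n}. M" and "C' \<equiv> 3 * C ^ 4 * exp (1 + 9 / \<alpha>)"
  assumes n: "96 \<le> \<alpha> * n" "real DIM('b) \<le> \<alpha> * n / 6"
  obtains N where "N \<in> borel_measurable (\<Pi>\<^sub>M i\<in>{..<n}. (borel :: 'b measure))" "\<And>x. 0 \<le> N x"
    "(\<integral>\<^sup>+z. ennreal (N (\<lambda>i\<in>{..<n}. X (z i)) ^ 8) \<partial>S) \<le> ennreal (529 * C' ^ 8)"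
    "AE z in S. \<forall>\<theta>. n * (norm \<theta>)\<^sup>2 \<le> N (\<lambda>i\<in>{..<n}. X (z i)) * (\<Sum>i<n. (\<theta> \<bullet> X (z i))\<^sup>2)"
proof -
  interpret S: prob_space S unfolding S_def by (rule prob_space_PiM) (rule prob_space_axioms)
  have n0: "0 < n" using n \<alpha> by (cases n) auto
  \<comment> \<open>Guarantees that a level with \<open>C' * t \<le> 1\<close> satisfies
    \<open>t \<le> 1 / 4\<close>, so that the smoothing radius \<open>sqrt t\<close> is at most
    1/2.\<close>
  have C'4: "4 \<le> C'"
  proof -
    have "(2::real) \<le> exp 1" by (rule exp_ge_one_plus_x_over_n_power_n[of 1 1, simplified, THEN order_trans[rotated]]) auto
    also have "\<dots> \<le> exp (1 + 9 / \<alpha>)" using \<alpha> by simp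
    finally have "3 * 1 * 2 \<le> 3 * C ^ 4 * exp (1 + 9 / \<alpha>)"
      using C by (intro mult_mono) auto
    then show ?thesis by (simp add: C'_def)
  qed
  have meas[measurable]: "(\<lambda>z. X (z i)) \<in> borel_measurable S" if "i < n" for i
    using that unfolding S_def by (intro measurable_compose[OF _ X]) auto
  obtain D :: "'b set" where D: "countable D" "\<And>U. open U \<Longrightarrow> U \<noteq> {} \<Longrightarrow> \<exists>d\<in>D. d \<in> U"
    by (rule countable_dense_setE) blast
  define E where "E = D - {0}"
  have E: "countable E" using D by (simp add: E_def)
  have Edense: "\<exists>d\<in>E. d \<in> U" if "open U" "U - {0} \<noteq> {}" for U
    using D(2)[of "U - {0}"] that by (auto simp: E_def)
  have E0: "E \<noteq> {}" using Edense[of UNIV] by (auto simp: UNIV_eq_I not_less[symmetric])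
  define q where "q z \<theta> = (\<Sum>i<n. (\<theta> \<bullet> X (z i))\<^sup>2)" for z :: "nat \<Rightarrow> 'a" and \<theta> :: 'b
  have q0: "0 \<le> q z \<theta>" for z \<theta> by (simp add: q_def sum_nonneg)
  \<comment> \<open>The infimum runs over a countable dense set of directions, which makes it
    measurable; 0 is removed because of the quotient. It bounds the form in every direction, since
    the set of violating directions is open.\<close>
  define l where "l z = (INF \<theta>\<in>E. q z \<theta> / (n * (norm \<theta>)\<^sup>2))" for z
  have bdd: "bdd_below ((\<lambda>\<theta>. q z \<theta> / (n * (norm \<theta>)\<^sup>2)) ` E)" for z
    using q0 by (intro bdd_belowI2[where m=0]) auto
  have qm[measurable]: "(\<lambda>z. q z \<theta>) \<in> borel_measurable S" for \<theta> unfolding q_def by measurable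
  have lm[measurable]: "l \<in> borel_measurable S"
    unfolding l_def by (intro borel_measurable_cINF E bdd) measurable
  have l0: "0 \<le> l z" for z unfolding l_def using q0 by (intro cINF_greatest E0) auto
  have lq: "l z * (n * (norm \<theta>)\<^sup>2) \<le> q z \<theta>" for z \<theta>
  proof (rule ccontr)
    assume neg: "\<not> ?thesis"
    define U where "U = {\<eta>. q z \<eta> < l z * (n * (norm \<eta>)\<^sup>2)}"
    have "open U" unfolding U_def q_def by (intro open_Collect_less continuous_intros)
    moreover have "\<theta> \<in> U" using neg by (simp add: U_def)
    moreover have "\<theta> \<noteq> 0" using neg q0[of z 0] by auto
    ultimately obtain d where d: "d \<in> E" "d \<in> U" using Edense[of U] by blast
    then have "l z \<le> q z d / (n * (norm d)\<^sup>2)" unfolding l_def by (intro cINF_lower bdd)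
    then show False using d n0 by (auto simp: U_def E_def field_simps)
  qed
  have tail: "measure S {z \<in> space S. l z < t} \<le> (C' * t) ^ 24" if t: "0 < t" "C' * t \<le> 1" for t
  proof -
    have t4: "t \<le> 1 / 4" using t mult_right_mono[OF C'4, of t] by linarith
    have st: "sqrt t \<le> 1 / 2" using t4 real_sqrt_le_iff[of t "1/4"] by (simp add: real_sqrt_divide)
    \<comment> \<open>The choice \<delta>^2 = t makes the smoothing cost equal to the threshold, and
      L = 1 / (2 t) then reduces the exponential factor to \<open>exp n\<close>.\<close>
    have "measure S {z \<in> space S. l z < t} \<le> exp (1 / (2 * t) * n * (t + (sqrt t)\<^sup>2)) * (3 / (2 * sqrt t)) ^ DIM('b)
        * (2 * (2 * C / sqrt (1 / (2 * t))) powr (2 * \<alpha> / 3)) ^ n"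
      unfolding S_def
    proof (rule prob_small_quadratic_form[where L="1 / (2 * t)" and \<delta>="sqrt t" and t=t])
      fix z assume "z \<in> {z \<in> space (Pi\<^sub>M {..<n} (\<lambda>i. M)). l z < t}"
      then obtain \<theta> where \<theta>: "\<theta> \<in> E" "q z \<theta> / (n * (norm \<theta>)\<^sup>2) < t"
        unfolding l_def using cINF_less_iff[OF E0 bdd] by auto
      have \<theta>0: "norm \<theta> > 0" using \<theta> by (auto simp: E_def)
      have "(\<Sum>i<n. ((\<theta> /\<^sub>R norm \<theta>) \<bullet> X (z i))\<^sup>2) = q z \<theta> / (norm \<theta>)\<^sup>2"
        by (simp add: q_def power_mult_distrib sum_divide_distrib divide_inverse power_inverse sum_distrib_left mult.commute)
      also have "\<dots> \<le> n * t" using \<theta>(2) \<theta>0 n0 by (simp add: field_simps)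
      finally show "\<exists>\<theta>. norm \<theta> = 1 \<and> (\<Sum>i<n. (\<theta> \<bullet> X (z i))\<^sup>2) \<le> n * t"
        using \<theta>0 by (intro exI[of _ "\<theta> /\<^sub>R norm \<theta>"]) auto
    next
      show "{z \<in> space (Pi\<^sub>M {..<n} (\<lambda>i. M)). l z < t} \<in> sets (Pi\<^sub>M {..<n} (\<lambda>i. M))"
        using lm unfolding S_def by measurable
    qed (use t st in auto)
    also have "1 / (2 * t) * n * (t + (sqrt t)\<^sup>2) = n" using t by simp
    also have "2 * C / sqrt (1 / (2 * t)) = 2 * C * sqrt (2 * t)" using t by (simp add: real_sqrt_divide)
    also have "exp n * (3 / (2 * sqrt t)) ^ DIM('b) * (2 * (2 * C * sqrt (2 * t)) powr (2 * \<alpha> / 3)) ^ n \<le> (C' * t) powr (\<alpha> * n / 4)"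
      unfolding C'_def using C \<alpha> t t4 n by (intro tail_constants) auto
    \<comment> \<open>The base is at most 1 and \<alpha> n \<ge> 96, so the exponent \<alpha> n / 4
      may be lowered to 24. That is far above the 8 required for the moment.\<close>
    also have "\<dots> \<le> (C' * t) powr 24" using t C'4 n by (intro powr_mono') auto
    also have "\<dots> = (C' * t) ^ 24" using t C'4 by (simp add: powr_numeral)
    finally show ?thesis .
  qed
  have pos: "AE z in S. 0 < l z"
  proof -
    have "measure S {z \<in> space S. \<not> 0 < l z} \<le> ((1 / 2) ^ 24) ^ k" for k
    proof -
      have "measure S {z \<in> space S. \<not> 0 < l z} \<le> measure S {z \<in> space S. l z < (1 / 2) ^ k / C'}"
        using C'4 by (intro S.finite_measure_mono) (auto simp: not_less intro: le_less_trans)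
      also have "\<dots> \<le> (C' * ((1 / 2) ^ k / C')) ^ 24"
        using C'4 by (intro tail) (auto simp: power_le_one)
      also have "\<dots> = ((1 / 2) ^ 24) ^ k" using C'4 by (simp add: mult.commute flip: power_mult)
      finally show ?thesis .
    qed
    moreover have "(\<lambda>k. ((1 / 2 :: real) ^ 24) ^ k) \<longlonglongrightarrow> 0" by (rule LIMSEQ_power_zero) (simp add: power_one_over)
    ultimately have "measure S {z \<in> space S. \<not> 0 < l z} \<le> 0" by (intro LIMSEQ_le_const) auto
    then have "measure S {z \<in> space S. \<not> 0 < l z} = 0" by (simp add: measure_le_0_iff)
    then show ?thesis by (intro AE_I[of _ _ "{z \<in> space S. \<not> 0 < l z}"]) (auto simp: S.emeasure_eq_measure)
  qed
  define \<nu> where "\<nu> z = 1 / l z" for z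
  \<comment> \<open>Where the infimum is 0, \<open>N\<close> is 0 by the convention for division.
    The inequality can fail there, but \<open>pos\<close> shows that this event is null.\<close>
  define N where "N x = 1 / (INF \<theta>\<in>E. (\<Sum>i<n. (\<theta> \<bullet> x i)\<^sup>2) / (n * (norm \<theta>)\<^sup>2))" for x :: "nat \<Rightarrow> 'b"
  have \<nu>N: "N (\<lambda>i\<in>{..<n}. X (z i)) = \<nu> z" for z
    by (simp add: N_def \<nu>_def l_def q_def)
  show thesis
  proof (rule that[of N], unfold \<nu>N)
    show "N \<in> borel_measurable (\<Pi>\<^sub>M i\<in>{..<n}. (borel :: 'b measure))"
    proof -
      have "(\<lambda>x. (\<Sum>i<n. (\<theta> \<bullet> x i)\<^sup>2) / (n * (norm \<theta>)\<^sup>2)) \<in> borel_measurable (\<Pi>\<^sub>M i\<in>{..<n}. (borel :: 'b measure))" for \<theta> :: 'b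
        by measurable
      then have "(\<lambda>x. INF \<theta>\<in>E. (\<Sum>i<n. (\<theta> \<bullet> x i)\<^sup>2) / (n * (norm \<theta>)\<^sup>2)) \<in> borel_measurable (\<Pi>\<^sub>M i\<in>{..<n}. (borel :: 'b measure))"
        by (intro borel_measurable_cINF_real E)
      then show ?thesis unfolding N_def by measurable
    qed
    show "0 \<le> N x" for x
      unfolding N_def by (intro divide_nonneg_nonneg cINF_greatest E0) (auto intro: sum_nonneg)
    show "AE z in S. \<forall>\<theta>. n * (norm \<theta>)\<^sup>2 \<le> \<nu> z * (\<Sum>i<n. (\<theta> \<bullet> X (z i))\<^sup>2)"
      using pos
    proof eventually_elim
      case (elim z)
      then show ?case using lq[of z] by (auto simp: \<nu>_def q_def field_simps)
    qed
    let ?e = "\<lambda>z k. ennreal (256 ^ Suc k) * (if l z < (1 / 2) ^ k * (1 / C') then 1 else 0)"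
    have "(\<integral>\<^sup>+z. ennreal (\<nu> z ^ 8) \<partial>S) \<le> (\<integral>\<^sup>+z. ennreal (C' ^ 8) * (1 + (\<Sum>k. ?e z k)) \<partial>S)"
    proof (rule nn_integral_mono_AE)
      show "AE z in S. ennreal (\<nu> z ^ 8) \<le> ennreal (C' ^ 8) * (1 + (\<Sum>k. ?e z k))"
        using pos
      proof eventually_elim
        case (elim z)
        then show ?case using inverse_power8_dyadic[of "l z" "1 / C'"] C'4 by (simp add: \<nu>_def)
      qed
    qed
    also have "\<dots> = ennreal (C' ^ 8) * (1 + (\<Sum>k. \<integral>\<^sup>+z. ?e z k \<partial>S))"
      by (subst nn_integral_cmult, measurable, subst nn_integral_add, simp, measurable,
          subst nn_integral_suminf, measurable) (simp add: S.emeasure_space_1)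
    also have "(\<Sum>k. \<integral>\<^sup>+z. ?e z k \<partial>S) \<le> (\<Sum>k. ennreal (256 * (1 / 2) ^ k))"
    proof (rule suminf_le)
      fix k :: nat
      let ?A = "{z \<in> space S. l z < (1 / 2) ^ k * (1 / C')}"
      have "(\<integral>\<^sup>+z. ?e z k \<partial>S) = (\<integral>\<^sup>+z. ennreal (256 ^ Suc k) * indicator ?A z \<partial>S)"
        by (intro nn_integral_cong) (auto simp: indicator_def)
      also have "\<dots> = ennreal (256 ^ Suc k) * emeasure S ?A"
        by (rule nn_integral_cmult_indicator) measurable
      also have "\<dots> = ennreal (256 ^ Suc k * measure S ?A)"
        by (simp add: S.emeasure_eq_measure ennreal_mult)
      also have "\<dots> \<le> ennreal (256 * (1 / 2) ^ k)"
      proof (rule ennreal_leI)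
        have "measure S ?A \<le> (C' * ((1 / 2) ^ k * (1 / C'))) ^ 24"
          using C'4 by (intro tail) (auto simp: power_le_one)
        also have "\<dots> = ((1 / 2) ^ 24) ^ k" using C'4 by (simp add: mult.commute flip: power_mult)
        finally have "256 ^ Suc k * measure S ?A \<le> 256 ^ Suc k * ((1 / 2) ^ 24) ^ k" by (intro mult_left_mono) auto
        also have "\<dots> = 256 * (256 * (1 / 2) ^ 24) ^ k" by (simp add: power_mult_distrib)
        also have "\<dots> \<le> 256 * (1 / 2) ^ k" by (intro mult_left_mono power_mono) (auto simp: power_one_over)
        finally show "256 ^ Suc k * measure S ?A \<le> 256 * (1 / 2) ^ k" .
      qed
      finally show "(\<integral>\<^sup>+z. ?e z k \<partial>S) \<le> ennreal (256 * (1 / 2) ^ k)" .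
    qed auto
    also have "(\<Sum>k. ennreal (256 * (1 / 2) ^ k)) = ennreal (\<Sum>k. 256 * (1 / 2) ^ k)"
      by (rule suminf_ennreal2) (auto intro!: summable_mult summable_geometric)
    also have "(\<Sum>k. 256 * (1 / 2 :: real) ^ k) = 512"
      by (subst suminf_mult) (auto simp: suminf_geometric summable_geometric)
    finally have "(\<integral>\<^sup>+z. ennreal (\<nu> z ^ 8) \<partial>S) \<le> ennreal (C' ^ 8) * (1 + ennreal 512)"
      by (simp add: mult_left_mono add_left_mono)
    also have "\<dots> = ennreal (513 * C' ^ 8)"
    proof -
      have 513: "1 + ennreal 512 = ennreal 513"
        by (subst ennreal_1[symmetric], subst ennreal_plus[symmetric]) auto
      show ?thesis unfolding 513 using C'4 by (subst ennreal_mult[symmetric]) (auto simp: mult.commute)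
    qed
    \<comment> \<open>The dyadic series gives 513 = 1 + 512, its terms being at most
      \<open>256 * (1 / 2) ^ k\<close>. The value 529 = 23^2 is the next perfect square, convenient
      for taking the root in a later Cauchy-Schwarz step.\<close>
    also have "\<dots> \<le> ennreal (529 * C' ^ 8)" using C'4 by (intro ennreal_leI mult_right_mono) auto
    finally show "(\<integral>\<^sup>+z. ennreal (\<nu> z ^ 8) \<partial>S) \<le> ennreal (529 * C' ^ 8)" .
  qed
qed

end

section \<open>Second-order expansion of the least-squares error\<close>

lemma ennreal_le_of_square_le:
  fixes x :: ennreal
  assumes "x\<^sup>2 \<le> ennreal (a\<^sup>2)" "0 \<le> a"
  shows "x \<le> ennreal a"
proof (cases x rule: ennreal_cases)
  case (real r)
  then have "r\<^sup>2 \<le> a\<^sup>2" using assms by (simp add: ennreal_power)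
  then have "r \<le> a" using assms(2) by (rule power2_le_imp_le)
  then show ?thesis using real by (simp add: ennreal_leI)
next
  case top
  then show ?thesis using assms by (simp add: power2_eq_square top_unique)
qed

text \<open>Works with extended nonnegative integrals and explicit bounds, so finiteness of the
  product integral is part of the conclusion rather than a side condition.\<close>

lemma Cauchy_Schwarz_nn_integral_bound:
  assumes [measurable]: "f \<in> borel_measurable M" "g \<in> borel_measurable M"
    and f: "(\<integral>\<^sup>+x. (f x)\<^sup>2 \<partial>M) \<le> ennreal (a\<^sup>2)" and g: "(\<integral>\<^sup>+x. (g x)\<^sup>2 \<partial>M) \<le> ennreal (b\<^sup>2)"
    and ab: "0 \<le> a" "0 \<le> b"
  shows "(\<integral>\<^sup>+x. f x * g x \<partial>M) \<le> ennreal (a * b)"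
proof (rule ennreal_le_of_square_le)
  have "(\<integral>\<^sup>+x. f x * g x \<partial>M)\<^sup>2 \<le> (\<integral>\<^sup>+x. (f x)\<^sup>2 \<partial>M) * (\<integral>\<^sup>+x. (g x)\<^sup>2 \<partial>M)"
    by (rule Cauchy_Schwarz_nn_integral) measurable
  also have "\<dots> \<le> ennreal (a\<^sup>2) * ennreal (b\<^sup>2)" by (intro mult_mono f g) auto
  also have "\<dots> = ennreal ((a * b)\<^sup>2)" by (simp add: power_mult_distrib ennreal_mult)
  finally show "(\<integral>\<^sup>+x. f x * g x \<partial>M)\<^sup>2 \<le> ennreal ((a * b)\<^sup>2)" .
qed (use ab in simp)

section \<open>Moments of the noise and of the weighted proxy\<close>

locale ols_sample = small_ball_sample M X C \<alpha>
  for M :: "'a measure" and X :: "'a \<Rightarrow> 'b::euclidean_space" and C \<alpha> :: real +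
  fixes \<epsilon> :: "'a \<Rightarrow> real" and s :: "'a \<Rightarrow> ennreal" and \<kappa> W :: real
  assumes \<epsilon>[measurable]: "\<epsilon> \<in> borel_measurable M" and s[measurable]: "s \<in> borel_measurable M"
    and cond_exp: "\<And>g :: 'b \<Rightarrow> ennreal. g \<in> borel_measurable borel \<Longrightarrow>
      (\<integral>\<^sup>+x. g (X x) * ennreal ((\<epsilon> x)\<^sup>2) \<partial>M) = (\<integral>\<^sup>+x. g (X x) * s x \<partial>M)"
    and L4: "\<And>\<theta>. (\<integral>\<^sup>+x. ennreal ((\<theta> \<bullet> X x) ^ 4) \<partial>M) \<le> ennreal (\<kappa> * norm \<theta> ^ 4)"
    and \<kappa>0: "0 < \<kappa>"
    and W0: "0 \<le> W" and W: "(\<integral>\<^sup>+x. (s x)\<^sup>2 * ennreal (norm (X x) ^ 4) \<partial>M) \<le> ennreal (W\<^sup>2)"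
    and uncorrelated: "(\<integral>x. \<epsilon> x *\<^sub>R X x \<partial>M) = 0"
begin

definition V :: real where
  "V = enn2real (\<integral>\<^sup>+x. ennreal ((\<epsilon> x)\<^sup>2 * (norm (X x))\<^sup>2) \<partial>M)"

text \<open>After \<epsilon>^2 has been replaced by \<open>s\<close>, Cauchy-Schwarz against the
  constant 1 gives the bound. It shows that the leading term is finite, so \<open>V\<close> loses
  nothing through \<open>enn2real\<close>.\<close>

lemma noise_le_W: "(\<integral>\<^sup>+x. ennreal ((\<epsilon> x)\<^sup>2 * (norm (X x))\<^sup>2) \<partial>M) \<le> ennreal W"
proof -
  have "(\<integral>\<^sup>+x. ennreal ((\<epsilon> x)\<^sup>2 * (norm (X x))\<^sup>2) \<partial>M) = (\<integral>\<^sup>+x. ennreal ((norm (X x))\<^sup>2) * ennreal ((\<epsilon> x)\<^sup>2) \<partial>M)"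
    by (intro nn_integral_cong) (simp add: ennreal_mult mult.commute)
  also have "\<dots> = (\<integral>\<^sup>+x. (ennreal ((norm (X x))\<^sup>2) * s x) * 1 \<partial>M)"
    by (subst cond_exp[of "\<lambda>v. ennreal ((norm v)\<^sup>2)"]) auto
  also have "\<dots> \<le> ennreal (W * 1)"
  proof (rule Cauchy_Schwarz_nn_integral_bound)
    show "(\<integral>\<^sup>+x. (ennreal ((norm (X x))\<^sup>2) * s x)\<^sup>2 \<partial>M) \<le> ennreal (W\<^sup>2)"
      using W by (simp add: power_mult_distrib ennreal_power mult.commute flip: power_mult)
  qed (use W0 in \<open>auto simp: emeasure_space_1\<close>)
  finally show ?thesis by simp
qed

lemma V_eq: "(\<integral>\<^sup>+x. ennreal ((\<epsilon> x)\<^sup>2 * (norm (X x))\<^sup>2) \<partial>M) = ennreal V"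
  using noise_le_W unfolding V_def by (subst ennreal_enn2real) (auto simp: le_less_trans)

lemma V_nonneg: "0 \<le> V" by (simp add: V_def)

lemma V_le_W: "V \<le> W"
  using noise_le_W W0 unfolding V_eq by simp

text \<open>A second moment is at most the root of the fourth; for a unit direction the second
  moment is 1. The bound lets lower-order terms be absorbed into those carrying \<kappa>.\<close>

lemma \<kappa>_ge_1: "1 \<le> \<kappa>"
proof -
  obtain b :: 'b where b: "b \<in> Basis" using nonempty_Basis by blast
  have "(\<integral>\<^sup>+x. ennreal ((b \<bullet> X x)\<^sup>2) * 1 \<partial>M) \<le> ennreal (sqrt \<kappa> * 1)"
  proof (rule Cauchy_Schwarz_nn_integral_bound)
    show "(\<integral>\<^sup>+x. (ennreal ((b \<bullet> X x)\<^sup>2))\<^sup>2 \<partial>M) \<le> ennreal ((sqrt \<kappa>)\<^sup>2)"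
      using L4[of b] b \<kappa>0 by (simp add: ennreal_power flip: power_mult)
  qed (use \<kappa>0 in \<open>auto simp: emeasure_space_1\<close>)
  then have "1 \<le> ennreal (sqrt \<kappa>)" using b by (simp add: isotropic)
  then have "1 \<le> sqrt \<kappa>" using \<kappa>0 by (simp flip: ennreal_1)
  then show ?thesis by simp
qed

text \<open>Expanding \<open>norm (X x) ^ 2\<close> over an orthonormal basis gives
  \<open>DIM('b)\<close> mixed moments, each of which Cauchy-Schwarz reduces to two fourth moments
  in fixed directions.\<close>

lemma norm_inner_fourth_moment:
  "(\<integral>\<^sup>+x. ennreal ((norm (X x))\<^sup>2 * (\<theta> \<bullet> X x)\<^sup>2) \<partial>M) \<le> ennreal (\<kappa> * DIM('b) * (norm \<theta>)\<^sup>2)"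
proof -
  have "(\<integral>\<^sup>+x. ennreal ((norm (X x))\<^sup>2 * (\<theta> \<bullet> X x)\<^sup>2) \<partial>M)
      = (\<integral>\<^sup>+x. (\<Sum>b\<in>Basis. ennreal ((b \<bullet> X x)\<^sup>2) * ennreal ((\<theta> \<bullet> X x)\<^sup>2)) \<partial>M)"
    by (intro nn_integral_cong)
       (simp add: norm_squared_eq_sum_Basis sum_distrib_right inner_commute flip: ennreal_mult)
  also have "\<dots> = (\<Sum>b\<in>Basis. \<integral>\<^sup>+x. ennreal ((b \<bullet> X x)\<^sup>2) * ennreal ((\<theta> \<bullet> X x)\<^sup>2) \<partial>M)"
    by (rule nn_integral_sum) measurable
  also have "\<dots> \<le> (\<Sum>b\<in>(Basis::'b set). ennreal (sqrt \<kappa> * (sqrt \<kappa> * (norm \<theta>)\<^sup>2)))"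
  proof (intro sum_mono Cauchy_Schwarz_nn_integral_bound)
    fix b :: 'b assume b: "b \<in> Basis"
    show "(\<integral>\<^sup>+x. (ennreal ((b \<bullet> X x)\<^sup>2))\<^sup>2 \<partial>M) \<le> ennreal ((sqrt \<kappa>)\<^sup>2)"
      using L4[of b] b \<kappa>0 by (simp add: ennreal_power flip: power_mult)
    show "(\<integral>\<^sup>+x. (ennreal ((\<theta> \<bullet> X x)\<^sup>2))\<^sup>2 \<partial>M) \<le> ennreal ((sqrt \<kappa> * (norm \<theta>)\<^sup>2)\<^sup>2)"
      using L4[of \<theta>] \<kappa>0 by (simp add: ennreal_power power_mult_distrib flip: power_mult)
  qed (use \<kappa>0 in auto)
  also have "\<dots> = ennreal (\<Sum>b\<in>(Basis::'b set). sqrt \<kappa> * (sqrt \<kappa> * (norm \<theta>)\<^sup>2))"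
    using \<kappa>0 by (intro sum_ennreal) auto
  also have "(\<Sum>b\<in>(Basis::'b set). sqrt \<kappa> * (sqrt \<kappa> * (norm \<theta>)\<^sup>2)) = \<kappa> * DIM('b) * (norm \<theta>)\<^sup>2"
    using \<kappa>0 by (simp add: mult.assoc[symmetric] mult_ac(2)[of "real _"])
  finally show ?thesis .
qed

lemma integrable_inner_sq: "integrable M (\<lambda>x. (\<theta> \<bullet> X x)\<^sup>2)"
  and integral_inner_sq: "(\<integral>x. (\<theta> \<bullet> X x)\<^sup>2 \<partial>M) = (norm \<theta>)\<^sup>2"
proof -
  show 1: "integrable M (\<lambda>x. (\<theta> \<bullet> X x)\<^sup>2)"
    by (rule integrableI_nonneg) (auto simp: isotropic)
  show "(\<integral>x. (\<theta> \<bullet> X x)\<^sup>2 \<partial>M) = (norm \<theta>)\<^sup>2"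
    using isotropic[of \<theta>] by (subst integral_eq_nn_integral) auto
qed

lemma integrable_inner_prod: "integrable M (\<lambda>x. (\<theta> \<bullet> X x) * (\<phi> \<bullet> X x))"
  and integral_inner_prod: "(\<integral>x. (\<theta> \<bullet> X x) * (\<phi> \<bullet> X x) \<partial>M) = \<theta> \<bullet> \<phi>"
proof -
  have eq: "(\<theta> \<bullet> X x) * (\<phi> \<bullet> X x) = (((\<theta> + \<phi>) \<bullet> X x)\<^sup>2 - (\<theta> \<bullet> X x)\<^sup>2 - (\<phi> \<bullet> X x)\<^sup>2) / 2" for x
    by (simp add: inner_add_left power2_sum)
  show "integrable M (\<lambda>x. (\<theta> \<bullet> X x) * (\<phi> \<bullet> X x))"
    unfolding eq using integrable_inner_sq by simp
  have "(\<integral>x. (\<theta> \<bullet> X x) * (\<phi> \<bullet> X x) \<partial>M) = ((norm (\<theta> + \<phi>))\<^sup>2 - (norm \<theta>)\<^sup>2 - (norm \<phi>)\<^sup>2) / 2"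
    unfolding eq using integrable_inner_sq by (simp add: integral_inner_sq)
  also have "\<dots> = \<theta> \<bullet> \<phi>" by (simp add: power2_norm_eq_inner inner_add_left inner_add_right inner_commute)
  finally show "(\<integral>x. (\<theta> \<bullet> X x) * (\<phi> \<bullet> X x) \<partial>M) = \<theta> \<bullet> \<phi>" .
qed

text \<open>The matrix I - X X^T applied to \<open>y\<close>. Isotropy makes its expectation vanish,
  which is one of the two degeneracies of the U-statistic.\<close>

definition Z :: "'a \<Rightarrow> 'b \<Rightarrow> 'b" where "Z x y = y - (X x \<bullet> y) *\<^sub>R X x"

lemma Z_add: "Z x (y + y') = Z x y + Z x y'"
  by (simp add: Z_def inner_add_right scaleR_add_left)

text \<open>In the expansion of the square the first two terms integrate to
  \<open>- (norm y)\<^sup>2\<close> and are dropped. The mixed fourth moment remains.\<close>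

lemma second_moment_Z: "(\<integral>\<^sup>+x. ennreal ((norm (Z x y))\<^sup>2) \<partial>M) \<le> ennreal (\<kappa> * DIM('b) * (norm y)\<^sup>2)"
proof -
  let ?h = "\<lambda>x. (norm (X x))\<^sup>2 * (y \<bullet> X x)\<^sup>2"
  have eq: "(norm (Z x y))\<^sup>2 = (norm y)\<^sup>2 - 2 * (y \<bullet> X x)\<^sup>2 + ?h x" for x
    unfolding Z_def power2_norm_eq_inner
    by (simp add: inner_diff_left inner_diff_right inner_commute power2_eq_square algebra_simps)
  have h: "integrable M ?h"
    by (rule integrableI_nonneg) (use norm_inner_fourth_moment[of y] in \<open>auto simp: le_less_trans\<close>)
  have i: "integrable M (\<lambda>x. (norm (Z x y))\<^sup>2)" unfolding eq using h integrable_inner_sq by auto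
  have "(\<integral>x. (norm (Z x y))\<^sup>2 \<partial>M) = (norm y)\<^sup>2 - 2 * (norm y)\<^sup>2 + (\<integral>x. ?h x \<partial>M)"
    unfolding eq using h integrable_inner_sq by (simp add: integral_inner_sq prob_space)
  also have "(\<integral>x. ?h x \<partial>M) \<le> \<kappa> * DIM('b) * (norm y)\<^sup>2"
    using norm_inner_fourth_moment[of y] \<kappa>0 by (intro integral_le_of_nn_integral_le) auto
  finally have "(\<integral>x. (norm (Z x y))\<^sup>2 \<partial>M) \<le> \<kappa> * DIM('b) * (norm y)\<^sup>2"
    using zero_le_power2[of "norm y"] by linarith
  then show ?thesis using i by (subst nn_integral_eq_integral) (auto simp: ennreal_leI)
qed

lemma integrable_Z: "integrable M (\<lambda>x. Z x y)"
proof (rule integrable_of_square_integrable)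
  show "integrable M (\<lambda>x. (norm (Z x y))\<^sup>2)"
    by (rule integrableI_square_nn[OF _ second_moment_Z]) (simp add: Z_def)
qed (unfold_locales, simp add: Z_def)

lemma integral_Z: "(\<integral>x. Z x y \<partial>M) = 0"
proof (rule euclidean_eqI)
  fix b :: 'b assume b: "b \<in> Basis"
  have "(\<integral>x. Z x y \<partial>M) \<bullet> b = (\<integral>x. Z x y \<bullet> b \<partial>M)"
    using integrable_Z by simp
  also have "\<dots> = (\<integral>x. y \<bullet> b - (y \<bullet> X x) * (b \<bullet> X x) \<partial>M)"
    by (intro Bochner_Integration.integral_cong refl)
       (simp add: Z_def inner_diff_left inner_commute[of "X _"])
  also have "\<dots> = 0" using integrable_inner_prod by (simp add: integral_inner_prod prob_space)
  finally show "(\<integral>x. Z x y \<partial>M) \<bullet> b = 0 \<bullet> b" by simp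
qed

text \<open>The weight makes \<open>\<epsilon> X - X X\<^sup>T (weighted n x) / n = weighted n x\<close>, so that the diagonal terms of
  the U-statistic below stay square integrable.\<close>

definition weighted :: "nat \<Rightarrow> 'a \<Rightarrow> 'b" where
  "weighted n x = (\<epsilon> x / (1 + (norm (X x))\<^sup>2 / n)) *\<^sub>R X x"

lemma weight_denominator_pos: "0 < 1 + (norm (X x))\<^sup>2 / real n"
  by (intro add_pos_nonneg) auto

lemma measurable_weighted[measurable]: "weighted n \<in> borel_measurable M"
  unfolding weighted_def by measurable

lemma weighted_identity:
  assumes "0 < n"
  shows "real n *\<^sub>R (\<epsilon> x *\<^sub>R X x) - (X x \<bullet> weighted n x) *\<^sub>R X x = real n *\<^sub>R weighted n x"
proof -
  have p: "1 + (norm (X x))\<^sup>2 / n > 0" by (intro add_pos_nonneg) auto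
  have "real n * \<epsilon> x - \<epsilon> x / (1 + h) * (n * h) = real n * (\<epsilon> x / (1 + h))" if "1 + h \<noteq> 0" for h :: real
    using that by (simp add: field_simps)
  from this[of "(norm (X x))\<^sup>2 / n"] p assms
  have "real n * \<epsilon> x - \<epsilon> x / (1 + (norm (X x))\<^sup>2 / n) * (norm (X x))\<^sup>2 = real n * (\<epsilon> x / (1 + (norm (X x))\<^sup>2 / n))"
    by simp
  then show ?thesis
    by (simp add: weighted_def dot_square_norm flip: scaleR_diff_left)
qed

lemma norm_weighted_le: "(norm (weighted n x))\<^sup>2 \<le> (\<epsilon> x)\<^sup>2 * (norm (X x))\<^sup>2"
proof -
  have p: "1 \<le> 1 + (norm (X x))\<^sup>2 / n" by auto
  have "\<bar>\<epsilon> x / (1 + (norm (X x))\<^sup>2 / n)\<bar> \<le> \<bar>\<epsilon> x\<bar>"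
    using p divide_left_mono[OF p, of "\<bar>\<epsilon> x\<bar>"] weight_denominator_pos[of x n] by (simp add: abs_divide)
  then have "norm (weighted n x) \<le> \<bar>\<epsilon> x\<bar> * norm (X x)"
    unfolding weighted_def norm_scaleR by (rule mult_right_mono) simp
  then have "(norm (weighted n x))\<^sup>2 \<le> (\<bar>\<epsilon> x\<bar> * norm (X x))\<^sup>2" by (rule power_mono) simp
  then show ?thesis by (simp add: power_mult_distrib)
qed

lemma second_moment_weighted: "(\<integral>\<^sup>+x. ennreal ((norm (weighted n x))\<^sup>2) \<partial>M) \<le> ennreal V"
  unfolding V_eq[symmetric] by (intro nn_integral_mono ennreal_leI norm_weighted_le)

lemma square_integrable_weighted: "integrable M (\<lambda>x. (norm (weighted n x))\<^sup>2)"
  by (rule integrableI_square_nn[OF measurable_weighted second_moment_weighted])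

lemma integrable_weighted: "integrable M (weighted n)"
  by (rule integrable_of_square_integrable[OF _ measurable_weighted square_integrable_weighted]) unfold_locales

lemma integrable_noise: "integrable M (\<lambda>x. \<epsilon> x *\<^sub>R X x)"
proof (rule integrable_of_square_integrable)
  show "integrable M (\<lambda>x. (norm (\<epsilon> x *\<^sub>R X x))\<^sup>2)"
    by (rule integrableI_square_nn[where B=V]) (auto simp: power_mult_distrib V_eq)
qed (unfold_locales, simp)

definition mean :: "nat \<Rightarrow> 'b" where "mean n = (\<integral>x. weighted n x \<partial>M)"

text \<open>The weight destroys the centering of \<epsilon> X, so the proxy has a nonzero mean
  \<open>m\<close>. As \<epsilon> X is centred, \<open>norm m ^ 2\<close> is the expectation of
  \<open>(weighted - \<epsilon> X) \<bullet> m\<close>. Cauchy-Schwarz between \<epsilon> times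
  \<open>norm X\<close> and the remaining factor, which is linear in \<open>m\<close>, then lets one
  \<open>norm m\<close> cancel.\<close>

lemma mean_bound:
  assumes B: "0 \<le> B"
    and g: "(\<integral>\<^sup>+x. (ennreal ((1 - 1 / (1 + (norm (X x))\<^sup>2 / n)) * \<bar>X x \<bullet> mean n\<bar> / norm (X x)))\<^sup>2 \<partial>M) \<le> ennreal (B * (norm (mean n))\<^sup>2)"
  shows "(norm (mean n))\<^sup>2 \<le> V * B"
proof -
  let ?m = "mean n" and ?g = "\<lambda>x. (1 - 1 / (1 + (norm (X x))\<^sup>2 / n)) * \<bar>X x \<bullet> mean n\<bar> / norm (X x)"
  have w: "0 \<le> 1 - 1 / (1 + (norm (X x))\<^sup>2 / n)" for x
  proof -
    have "1 \<le> 1 + (norm (X x))\<^sup>2 / n" by simp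
    then show ?thesis using weight_denominator_pos[of x n] by (simp add: divide_le_eq_1)
  qed
  have int: "integrable M (\<lambda>x. (weighted n x - \<epsilon> x *\<^sub>R X x) \<bullet> ?m)"
    using integrable_weighted integrable_noise by auto
  have "(norm ?m)\<^sup>2 = (\<integral>x. (weighted n x - \<epsilon> x *\<^sub>R X x) \<partial>M) \<bullet> ?m"
    using integrable_weighted integrable_noise by (simp add: uncorrelated mean_def dot_square_norm)
  also have "\<dots> = (\<integral>x. (weighted n x - \<epsilon> x *\<^sub>R X x) \<bullet> ?m \<partial>M)"
    using integrable_weighted integrable_noise by (simp del: inner_diff_left)
  finally have "ennreal ((norm ?m)\<^sup>2) = ennreal (norm (\<integral>x. (weighted n x - \<epsilon> x *\<^sub>R X x) \<bullet> ?m \<partial>M))"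
    by (metis abs_of_nonneg real_norm_def zero_le_power2)
  also have "\<dots> \<le> (\<integral>\<^sup>+x. norm ((weighted n x - \<epsilon> x *\<^sub>R X x) \<bullet> ?m) \<partial>M)"
    by (rule integral_norm_bound_ennreal[OF int])
  also have "\<dots> = (\<integral>\<^sup>+x. ennreal (\<bar>\<epsilon> x\<bar> * norm (X x)) * ennreal (?g x) \<partial>M)"
  proof (intro nn_integral_cong)
    fix x
    have "(weighted n x - \<epsilon> x *\<^sub>R X x) = - ((1 - 1 / (1 + (norm (X x))\<^sup>2 / n)) * \<epsilon> x) *\<^sub>R X x"
      by (simp add: weighted_def left_diff_distrib scaleR_diff_left)
    then have "norm ((weighted n x - \<epsilon> x *\<^sub>R X x) \<bullet> ?m) = (1 - 1 / (1 + (norm (X x))\<^sup>2 / n)) * \<bar>\<epsilon> x\<bar> * \<bar>X x \<bullet> ?m\<bar>"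
      using w[of x] by (simp only: inner_scaleR_left real_norm_def abs_mult abs_minus_cancel abs_of_nonneg)
    also have "\<dots> = (\<bar>\<epsilon> x\<bar> * norm (X x)) * ?g x" by (cases "X x = 0") auto
    finally have eq: "norm ((weighted n x - \<epsilon> x *\<^sub>R X x) \<bullet> ?m) = (\<bar>\<epsilon> x\<bar> * norm (X x)) * ?g x" .
    show "ennreal (norm ((weighted n x - \<epsilon> x *\<^sub>R X x) \<bullet> ?m)) = ennreal (\<bar>\<epsilon> x\<bar> * norm (X x)) * ennreal (?g x)"
      unfolding eq by (rule ennreal_mult) (use w[of x] in auto)
  qed
  also have "\<dots> \<le> ennreal (sqrt V * (sqrt B * norm ?m))"
  proof (rule Cauchy_Schwarz_nn_integral_bound)
    show "(\<integral>\<^sup>+x. (ennreal (\<bar>\<epsilon> x\<bar> * norm (X x)))\<^sup>2 \<partial>M) \<le> ennreal ((sqrt V)\<^sup>2)"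
      using V_nonneg by (simp add: ennreal_power power_mult_distrib V_eq)
    show "(\<integral>\<^sup>+x. (ennreal (?g x))\<^sup>2 \<partial>M) \<le> ennreal ((sqrt B * norm ?m)\<^sup>2)"
      using g B by (simp add: power_mult_distrib)
  qed (use V_nonneg B in auto)
  finally have "norm ?m * norm ?m \<le> (sqrt V * sqrt B) * norm ?m"
    using V_nonneg B by (simp add: power2_eq_square mult_ac)
  then have "norm ?m \<le> sqrt V * sqrt B \<or> norm ?m = 0"
    using mult_le_cancel_right[of "norm ?m" "norm ?m" "sqrt V * sqrt B"] by auto
  then have "norm ?m \<le> sqrt V * sqrt B" using V_nonneg B by auto
  then have "(norm ?m)\<^sup>2 \<le> (sqrt V * sqrt B)\<^sup>2" by (rule power_mono) simp
  then show ?thesis using V_nonneg B by (simp add: power_mult_distrib)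
qed

text \<open>With h = \<open>norm (X x) ^ 2 / n\<close> the weight differs from 1 by h / (1 + h),
  whose square is at most h and at most h^2. The first estimate leaves a second moment of
  \<open>m \<bullet> X\<close>, the second a mixed fourth moment. The geometric mean of the two
  conclusions has the order n^(-3/2).\<close>

lemma mean_le:
  assumes n: "0 < n"
  shows "(norm (mean n))\<^sup>2 \<le> V / n" and "(norm (mean n))\<^sup>2 \<le> V * (\<kappa> * DIM('b) / n\<^sup>2)"
proof -
  let ?m = "mean n" and ?g = "\<lambda>x. (1 - 1 / (1 + (norm (X x))\<^sup>2 / n)) * \<bar>X x \<bullet> mean n\<bar> / norm (X x)"
  have g: "0 \<le> ?g x" "(?g x)\<^sup>2 \<le> (mean n \<bullet> X x)\<^sup>2 / n" "(?g x)\<^sup>2 \<le> (norm (X x))\<^sup>2 * (mean n \<bullet> X x)\<^sup>2 / n\<^sup>2" for x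
  proof -
    define h where "h = (norm (X x))\<^sup>2 / n"
    have h0: "0 \<le> h" by (simp add: h_def)
    have w: "1 - 1 / (1 + h) = h / (1 + h)" using h0 by (simp add: field_simps)
    have w1: "h / (1 + h) \<le> h"
      using h0 divide_left_mono[of 1 "1 + h" h] by simp
    have w2: "(h / (1 + h))\<^sup>2 \<le> h"
    proof -
      have "(h / (1 + h))\<^sup>2 = h / (1 + h) * (h / (1 + h))" by (simp add: power2_eq_square)
      also have "\<dots> \<le> 1 * h" using h0 w1 by (intro mult_mono) auto
      finally show ?thesis by simp
    qed
    show "0 \<le> ?g x" unfolding h_def[symmetric] w using h0 by simp
    have G: "(?g x)\<^sup>2 = (h / (1 + h))\<^sup>2 * (mean n \<bullet> X x)\<^sup>2 / (norm (X x))\<^sup>2"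
      unfolding h_def[symmetric] w by (simp add: power_divide power_mult_distrib inner_commute)
    show "(?g x)\<^sup>2 \<le> (mean n \<bullet> X x)\<^sup>2 / n"
    proof (cases "X x = 0")
      case False
      have "(?g x)\<^sup>2 \<le> h * (mean n \<bullet> X x)\<^sup>2 / (norm (X x))\<^sup>2"
        unfolding G using w2 by (intro divide_right_mono mult_right_mono) auto
      also have "\<dots> = (mean n \<bullet> X x)\<^sup>2 / n" using False by (simp add: h_def)
      finally show ?thesis .
    qed simp
    show "(?g x)\<^sup>2 \<le> (norm (X x))\<^sup>2 * (mean n \<bullet> X x)\<^sup>2 / n\<^sup>2"
    proof (cases "X x = 0")
      case False
      have "(?g x)\<^sup>2 \<le> h\<^sup>2 * (mean n \<bullet> X x)\<^sup>2 / (norm (X x))\<^sup>2"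
        unfolding G using w1 h0 by (intro divide_right_mono mult_right_mono power_mono) auto
      also have "\<dots> = (norm (X x))\<^sup>2 * (mean n \<bullet> X x)\<^sup>2 / n\<^sup>2" using False n by (simp add: h_def power_divide field_simps power2_eq_square)
      finally show ?thesis .
    qed simp
  qed
  show "(norm ?m)\<^sup>2 \<le> V / n"
  proof (subst divide_inverse, rule mean_bound)
    have "(\<integral>\<^sup>+x. (ennreal (?g x))\<^sup>2 \<partial>M) \<le> (\<integral>\<^sup>+x. ennreal (1 / n) * ennreal ((?m \<bullet> X x)\<^sup>2) \<partial>M)"
      using g n by (intro nn_integral_mono) (auto simp: ennreal_power ennreal_mult[symmetric] intro!: ennreal_leI)
    also have "\<dots> = ennreal (1 / n) * ennreal ((norm ?m)\<^sup>2)"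
      by (subst nn_integral_cmult) (auto simp: isotropic)
    finally show "(\<integral>\<^sup>+x. (ennreal (?g x))\<^sup>2 \<partial>M) \<le> ennreal (inverse n * (norm ?m)\<^sup>2)"
      by (simp add: inverse_eq_divide flip: ennreal_mult)
  qed simp
  show "(norm ?m)\<^sup>2 \<le> V * (\<kappa> * DIM('b) / n\<^sup>2)"
  proof (rule mean_bound)
    have "(\<integral>\<^sup>+x. (ennreal (?g x))\<^sup>2 \<partial>M) \<le> (\<integral>\<^sup>+x. ennreal (1 / n\<^sup>2) * ennreal ((norm (X x))\<^sup>2 * (?m \<bullet> X x)\<^sup>2) \<partial>M)"
      using g n by (intro nn_integral_mono) (auto simp: ennreal_power ennreal_mult[symmetric] intro!: ennreal_leI)
    also have "\<dots> = ennreal (1 / n\<^sup>2) * (\<integral>\<^sup>+x. ennreal ((norm (X x))\<^sup>2 * (?m \<bullet> X x)\<^sup>2) \<partial>M)"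
      by (rule nn_integral_cmult) measurable
    also have "\<dots> \<le> ennreal (1 / n\<^sup>2) * ennreal (\<kappa> * DIM('b) * (norm ?m)\<^sup>2)"
      by (intro mult_left_mono norm_inner_fourth_moment) auto
    also have "\<dots> = ennreal (\<kappa> * DIM('b) / n\<^sup>2 * (norm ?m)\<^sup>2)"
      using \<kappa>0 by (subst ennreal_mult[symmetric]) auto
    finally show "(\<integral>\<^sup>+x. (ennreal (?g x))\<^sup>2 \<partial>M) \<le> ennreal (\<kappa> * DIM('b) / n\<^sup>2 * (norm ?m)\<^sup>2)" .
  qed (use \<kappa>0 in auto)
qed

lemma variance_weighted: "(\<integral>\<^sup>+x. ennreal ((norm (weighted n x - mean n))\<^sup>2) \<partial>M) \<le> ennreal V"
proof -
  have eq: "(norm (weighted n x - mean n))\<^sup>2 = (norm (weighted n x))\<^sup>2 - 2 * (weighted n x \<bullet> mean n) + (norm (mean n))\<^sup>2" for x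
    by (simp add: power2_norm_eq_inner inner_diff_left inner_diff_right inner_commute)
  have i: "integrable M (\<lambda>x. (norm (weighted n x - mean n))\<^sup>2)"
    unfolding eq using square_integrable_weighted integrable_weighted by auto
  have "(\<integral>x. (norm (weighted n x - mean n))\<^sup>2 \<partial>M) = (\<integral>x. (norm (weighted n x))\<^sup>2 \<partial>M) - (norm (mean n))\<^sup>2"
    unfolding eq using square_integrable_weighted integrable_weighted
    by (simp add: prob_space flip: mean_def) (simp add: dot_square_norm)
  also have "(\<integral>x. (norm (weighted n x))\<^sup>2 \<partial>M) \<le> V"
    by (rule integral_le_of_nn_integral_le[OF second_moment_weighted V_nonneg]) simp
  also have "V - (norm (mean n))\<^sup>2 \<le> V" by simp
  finally show ?thesis using i by (subst nn_integral_eq_integral) (auto simp: ennreal_leI)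
qed

end

lemma sum_square_eq_offdiagonal:
  fixes f :: "'i \<Rightarrow> 'i \<Rightarrow> 'c::ab_group_add"
  assumes I: "finite I"
  shows "(\<Sum>i\<in>I. \<Sum>j\<in>I. f i j) = (\<Sum>p\<in>{p \<in> I \<times> I. fst p \<noteq> snd p}. f (fst p) (snd p)) + (\<Sum>i\<in>I. f i i)"
proof -
  let ?g = "\<lambda>p. f (fst p) (snd p)"
  let ?Q = "{p \<in> I \<times> I. fst p \<noteq> snd p}" and ?D = "(\<lambda>i. (i, i)) ` I"
  have "(\<Sum>i\<in>I. \<Sum>j\<in>I. f i j) = sum ?g (I \<times> I)"
    by (simp add: sum.cartesian_product case_prod_beta')
  also have "I \<times> I = ?Q \<union> ?D" by auto
  also have "sum ?g (?Q \<union> ?D) = sum ?g ?Q + sum ?g ?D"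
    using I by (intro sum.union_disjoint) (auto intro: finite_subset[of _ "I \<times> I"])
  also have "sum ?g ?D = (\<Sum>i\<in>I. f i i)" by (subst sum.reindex) (auto simp: inj_on_def)
  finally show ?thesis .
qed

lemma norm_sum3_squared:
  fixes a b c :: "'a::real_inner"
  shows "(norm (a + b + c))\<^sup>2 \<le> 3 * ((norm a)\<^sup>2 + (norm b)\<^sup>2 + (norm c)\<^sup>2)"
proof -
  have "0 \<le> (norm (a - b))\<^sup>2 + (norm (a - c))\<^sup>2 + (norm (b - c))\<^sup>2" by simp
  then show ?thesis
    by (simp add: power2_norm_eq_inner inner_add_left inner_add_right inner_diff_left inner_diff_right inner_commute)
qed

context small_ball_sample
begin

text \<open>The existence of a finite reciprocal eigenvalue already forces the form to be positive;
  this makes the normal equations solvable almost surely.\<close>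

lemma AE_sample_nondegenerate:
  fixes n :: nat
  assumes n: "96 \<le> \<alpha> * n" "real DIM('b) \<le> \<alpha> * n / 6"
  shows "AE z in (\<Pi>\<^sub>M i\<in>{..<n}. M). \<forall>\<theta>. \<theta> \<noteq> 0 \<longrightarrow> 0 < (\<Sum>i<n. (\<theta> \<bullet> X (z i))\<^sup>2)"
proof -
  have n0: "0 < n" using n \<alpha> by (cases n) auto
  obtain N where "N \<in> borel_measurable (\<Pi>\<^sub>M i\<in>{..<n}. (borel :: 'b measure))" and N: "\<And>x. 0 \<le> N x"
    and "(\<integral>\<^sup>+z. ennreal (N (\<lambda>i\<in>{..<n}. X (z i)) ^ 8) \<partial>(\<Pi>\<^sub>M i\<in>{..<n}. M)) \<le> ennreal (529 * (3 * C ^ 4 * exp (1 + 9 / \<alpha>)) ^ 8)"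
    and AE: "AE z in (\<Pi>\<^sub>M i\<in>{..<n}. M). \<forall>\<theta>. n * (norm \<theta>)\<^sup>2 \<le> N (\<lambda>i\<in>{..<n}. X (z i)) * (\<Sum>i<n. (\<theta> \<bullet> X (z i))\<^sup>2)"
    by (rule inverse_eigenvalue_moment[OF n]) (rule that; assumption)
  show ?thesis
    using AE
  proof eventually_elim
    case (elim z)
    show ?case
    proof (intro allI impI)
      fix \<theta> :: 'b assume "\<theta> \<noteq> 0"
      then have "0 < n * (norm \<theta>)\<^sup>2" using n0 by simp
      also have "\<dots> \<le> N (\<lambda>i\<in>{..<n}. X (z i)) * (\<Sum>i<n. (\<theta> \<bullet> X (z i))\<^sup>2)" using elim by simp
      finally show "0 < (\<Sum>i<n. (\<theta> \<bullet> X (z i))\<^sup>2)"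
        using N[of "\<lambda>i\<in>{..<n}. X (z i)"] sum_nonneg[of "{..<n}" "\<lambda>i. (\<theta> \<bullet> X (z i))\<^sup>2"]
        by (auto simp: zero_less_mult_iff)
    qed
  qed
qed

end

section \<open>The remainder as a degenerate U-statistic, and the error bound\<close>

context ols_sample
begin

definition ols_u :: "nat \<Rightarrow> (nat \<Rightarrow> 'a) \<Rightarrow> 'b" where
  "ols_u n z = (1 / n) *\<^sub>R (\<Sum>i<n. weighted n (z i))"

definition ols_v :: "nat \<Rightarrow> (nat \<Rightarrow> 'a) \<Rightarrow> 'b" where
  "ols_v n z = (1 / n) *\<^sub>R (\<Sum>i<n. \<epsilon> (z i) *\<^sub>R X (z i))"

definition ols_A :: "nat \<Rightarrow> (nat \<Rightarrow> 'a) \<Rightarrow> 'b \<Rightarrow> 'b" where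
  "ols_A n z e = (1 / n) *\<^sub>R (\<Sum>i<n. (X (z i) \<bullet> e) *\<^sub>R X (z i))"

definition ols_r :: "nat \<Rightarrow> (nat \<Rightarrow> 'a) \<Rightarrow> 'b" where
  "ols_r n z = ols_v n z - ols_A n z (ols_u n z)"

text \<open>The weight turns the diagonal of n^2 (v - A u) into n times the sum of the y_i, where
  y_i is the weighted vector. Of these n copies, n - 1 complete the off-diagonal terms -(X_i . y_j)
  X_i to \<open>Z\<close>, and one is left over. Subtracting \<open>mean n\<close> in the second
  argument makes the kernel degenerate in both arguments, at the price of the middle sum.\<close>

lemma ols_r_decomposition:
  assumes n: "0 < n"
  shows "(real n)\<^sup>2 *\<^sub>R ols_r n z =
      (\<Sum>p\<in>{p \<in> {..<n} \<times> {..<n}. fst p \<noteq> snd p}. Z (z (fst p)) (weighted n (z (snd p)) - mean n))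
      + (real n - 1) *\<^sub>R (\<Sum>i<n. Z (z i) (mean n)) + (\<Sum>i<n. weighted n (z i))"
proof -
  let ?Q = "{p \<in> {..<n} \<times> {..<n}. fst p \<noteq> snd p}"
  let ?y = "\<lambda>i. weighted n (z i)" and ?X = "\<lambda>i. X (z i)"
  have off: "(\<Sum>p\<in>?Q. f (fst p) (snd p)) = (\<Sum>i<n. \<Sum>j<n. f i j) - (\<Sum>i<n. f i i)" for f :: "nat \<Rightarrow> nat \<Rightarrow> 'b"
    using sum_square_eq_offdiagonal[of "{..<n}" f] by simp
  have c1: "(\<Sum>p\<in>?Q. f (snd p)) = (real n - 1) *\<^sub>R (\<Sum>i<n. f i)" for f :: "nat \<Rightarrow> 'b"
    using off[of "\<lambda>i j. f j"] by (simp add: scaleR_diff_left scaleR_left.sum sum_constant_scaleR)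
  have c2: "(\<Sum>p\<in>?Q. f (fst p)) = (real n - 1) *\<^sub>R (\<Sum>i<n. f i)" for f :: "nat \<Rightarrow> 'b"
    using off[of "\<lambda>i j. f i"] by (simp add: scaleR_diff_left sum_constant_scaleR scaleR_sum_right sum_subtractf)
  have "(real n)\<^sup>2 *\<^sub>R ols_v n z = (\<Sum>i<n. real n *\<^sub>R (\<epsilon> (z i) *\<^sub>R ?X i))"
    using n by (simp add: ols_v_def power2_eq_square scaleR_sum_right)
  moreover have "(real n)\<^sup>2 *\<^sub>R ols_A n z (ols_u n z) = (\<Sum>i<n. \<Sum>j<n. (?X i \<bullet> ?y j) *\<^sub>R ?X i)"
    using n by (simp add: ols_A_def ols_u_def power2_eq_square scaleR_sum_right inner_sum_right scaleR_sum_left)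
  ultimately have "(real n)\<^sup>2 *\<^sub>R ols_r n z = (\<Sum>i<n. real n *\<^sub>R (\<epsilon> (z i) *\<^sub>R ?X i)) - (\<Sum>i<n. \<Sum>j<n. (?X i \<bullet> ?y j) *\<^sub>R ?X i)"
    by (simp add: ols_r_def scaleR_diff_right)
  also have "\<dots> = (\<Sum>i<n. real n *\<^sub>R (\<epsilon> (z i) *\<^sub>R ?X i) - (?X i \<bullet> ?y i) *\<^sub>R ?X i) - (\<Sum>p\<in>?Q. (?X (fst p) \<bullet> ?y (snd p)) *\<^sub>R ?X (fst p))"
    unfolding off[of "\<lambda>i j. (?X i \<bullet> ?y j) *\<^sub>R ?X i"] by (simp add: sum_subtractf)
  also have "\<dots> = (\<Sum>i<n. real n *\<^sub>R ?y i) - (\<Sum>p\<in>?Q. (?X (fst p) \<bullet> ?y (snd p)) *\<^sub>R ?X (fst p))"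
    using weighted_identity[OF n] by simp
  also have "\<dots> = (\<Sum>p\<in>?Q. Z (z (fst p)) (?y (snd p))) + (\<Sum>i<n. ?y i)"
    using c1[of ?y] by (simp add: Z_def sum_subtractf scaleR_diff_left scaleR_sum_right)
  also have "(\<Sum>p\<in>?Q. Z (z (fst p)) (?y (snd p))) = (\<Sum>p\<in>?Q. Z (z (fst p)) (?y (snd p) - mean n)) + (\<Sum>p\<in>?Q. Z (z (fst p)) (mean n))"
    by (simp flip: sum.distrib Z_add)
  also have "(\<Sum>p\<in>?Q. Z (z (fst p)) (mean n)) = (real n - 1) *\<^sub>R (\<Sum>i<n. Z (z i) (mean n))"
    by (rule c2)
  finally show ?thesis .
qed

abbreviation sample :: "nat \<Rightarrow> (nat \<Rightarrow> 'a) measure" where "sample n \<equiv> \<Pi>\<^sub>M i\<in>{..<n}. M"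

lemma measurable_sample_comp:
  "f \<in> borel_measurable M \<Longrightarrow> i < n \<Longrightarrow> (\<lambda>z. f (z i)) \<in> borel_measurable (sample n)"
  by (rule measurable_compose[OF measurable_component_singleton]) auto

lemma measurable_Z_comp:
  assumes i: "i < n" and [measurable]: "g \<in> borel_measurable (sample n)"
  shows "(\<lambda>z. Z (z i) (g z)) \<in> borel_measurable (sample n)"
proof -
  have [measurable]: "(\<lambda>z. X (z i)) \<in> borel_measurable (sample n)" by (rule measurable_sample_comp[OF X i])
  show ?thesis unfolding Z_def by measurable
qed

lemma sum_weighted_moment:
  "(\<integral>\<^sup>+z. ennreal ((norm (\<Sum>i<n. weighted n (z i)))\<^sup>2) \<partial>sample n) \<le> ennreal (real n * V + (real n)\<^sup>2 * (norm (mean n))\<^sup>2)"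
  unfolding mean_def
  using sum_second_moment[OF prob_space_axioms finite_lessThan measurable_weighted second_moment_weighted V_nonneg, of n n]
  unfolding card_lessThan of_nat_power .

text \<open>The constant is 15 = 3 (2 + 1 + 2): 3 for squaring a sum of three terms, then 2 from the
  U-statistic, 1 from the sum with the mean, whose squared norm is at most \<open>V / n\<close>, and
  2 from the left-over sum, for which n V \<le> n^2 K V by K \<ge> 1.\<close>

lemma ols_r_moment:
  assumes n: "0 < n"
  shows "(\<integral>\<^sup>+z. ennreal ((norm (ols_r n z))\<^sup>2) \<partial>sample n) \<le> ennreal (15 * \<kappa> * DIM('b) * V / n\<^sup>2)"
proof -
  define K where "K = \<kappa> * DIM('b)"
  have K1: "1 \<le> K"
  proof -
    have "1 * 1 \<le> \<kappa> * real DIM('b)" using \<kappa>_ge_1 by (intro mult_mono) (auto simp: Suc_le_eq)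
    then show ?thesis by (simp add: K_def)
  qed
  let ?Q = "{p \<in> {..<n} \<times> {..<n}. fst p \<noteq> snd p}"
  let ?D = "\<lambda>z. \<Sum>p\<in>?Q. Z (z (fst p)) (weighted n (z (snd p)) - mean n)"
  let ?E = "\<lambda>z. \<Sum>i<n. Z (z i) (mean n)"
  let ?Y = "\<lambda>z. \<Sum>i<n. weighted n (z i)"
  have Zm[measurable]: "(\<lambda>x. Z x y) \<in> borel_measurable M" for y by (simp add: Z_def)
  have mu: "(norm (mean n))\<^sup>2 \<le> V / n" by (rule mean_le(1)[OF n])
  have D: "(\<integral>\<^sup>+z. ennreal ((norm (?D z))\<^sup>2) \<partial>sample n) \<le> ennreal (2 * n\<^sup>2 * (K * V))"
  proof -
    have "(\<integral>\<^sup>+z. ennreal ((norm (?D z))\<^sup>2) \<partial>sample n) \<le> ennreal (2 * (card {..<n})\<^sup>2 * (K * V))"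
    proof (rule degenerate_U_statistic_second_moment[OF prob_space_axioms])
      show "(\<lambda>(x, y). Z x (weighted n y - mean n)) \<in> borel_measurable (M \<Otimes>\<^sub>M M)"
        unfolding Z_def by measurable
      \<comment> \<open>Tonelli moves the integral over \<open>x\<close> inside, where
        \<open>second_moment_Z\<close> applies for each fixed second argument.\<close>
      have "(\<integral>\<^sup>+x. \<integral>\<^sup>+y. ennreal ((norm (Z x (weighted n y - mean n)))\<^sup>2) \<partial>M \<partial>M)
          = (\<integral>\<^sup>+y. \<integral>\<^sup>+x. ennreal ((norm (Z x (weighted n y - mean n)))\<^sup>2) \<partial>M \<partial>M)"
      proof (rule pair_sigma_finite.Fubini'[symmetric])
        show "pair_sigma_finite M M" ..
        show "(\<lambda>(x, y). ennreal ((norm (Z x (weighted n y - mean n)))\<^sup>2)) \<in> borel_measurable (M \<Otimes>\<^sub>M M)"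
          unfolding Z_def by measurable
      qed
      also have "\<dots> \<le> (\<integral>\<^sup>+y. ennreal K * ennreal ((norm (weighted n y - mean n))\<^sup>2) \<partial>M)"
        using second_moment_Z K1 by (intro nn_integral_mono) (simp add: K_def flip: ennreal_mult)
      also have "\<dots> = ennreal K * (\<integral>\<^sup>+y. ennreal ((norm (weighted n y - mean n))\<^sup>2) \<partial>M)"
        by (rule nn_integral_cmult) measurable
      also have "\<dots> \<le> ennreal K * ennreal V" by (intro mult_left_mono variance_weighted) auto
      finally show "(\<integral>\<^sup>+x. \<integral>\<^sup>+y. ennreal ((norm (Z x (weighted n y - mean n)))\<^sup>2) \<partial>M \<partial>M) \<le> ennreal (K * V)"
        using K1 V_nonneg by (simp add: ennreal_mult)
      show "integrable M (\<lambda>y. Z x (weighted n y - mean n))" for x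
        unfolding Z_def using integrable_weighted by (auto simp: inner_diff_right)
      show "(\<integral>y. Z x (weighted n y - mean n) \<partial>M) = 0" for x
        unfolding Z_def using integrable_weighted
        by (simp add: mean_def prob_space inner_diff_right scaleR_diff_left)
      show "integrable M (\<lambda>x. Z x (weighted n y - mean n))" "(\<integral>x. Z x (weighted n y - mean n) \<partial>M) = 0" for y
        by (rule integrable_Z, rule integral_Z)
    qed (use K1 V_nonneg in auto)
    then show ?thesis by simp
  qed
  have E: "(\<integral>\<^sup>+z. ennreal ((norm (?E z))\<^sup>2) \<partial>sample n) \<le> ennreal (K * V)"
  proof -
    have "(\<integral>\<^sup>+z. ennreal ((norm (?E z))\<^sup>2) \<partial>sample n) \<le> ennreal (card {..<n} * (K * (norm (mean n))\<^sup>2) + (card {..<n})\<^sup>2 * (norm (\<integral>x. Z x (mean n) \<partial>M))\<^sup>2)"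
      unfolding K_def using \<kappa>0 by (intro sum_second_moment[OF prob_space_axioms] second_moment_Z) auto
    also have "\<dots> \<le> ennreal (K * V)"
    proof (intro ennreal_leI)
      have "K * (n * (norm (mean n))\<^sup>2) \<le> K * (n * (V / n))" using mu K1 by (intro mult_left_mono) auto
      then show "card {..<n} * (K * (norm (mean n))\<^sup>2) + (card {..<n})\<^sup>2 * (norm (\<integral>x. Z x (mean n) \<partial>M))\<^sup>2 \<le> K * V"
        using n by (simp add: integral_Z mult_ac)
    qed
    finally show ?thesis .
  qed
  have Y: "(\<integral>\<^sup>+z. ennreal ((norm (?Y z))\<^sup>2) \<partial>sample n) \<le> ennreal (2 * n * V)"
  proof (rule order_trans[OF sum_weighted_moment ennreal_leI])
    have "(real n)\<^sup>2 * (norm (mean n))\<^sup>2 \<le> (real n)\<^sup>2 * (V / n)" using mu by (intro mult_left_mono) auto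
    then show "real n * V + (real n)\<^sup>2 * (norm (mean n))\<^sup>2 \<le> 2 * n * V" using n by (simp add: power2_eq_square)
  qed
  have [measurable]: "?D \<in> borel_measurable (sample n)"
    by (intro borel_measurable_sum measurable_Z_comp borel_measurable_diff measurable_sample_comp[OF measurable_weighted]) auto
  have [measurable]: "?E \<in> borel_measurable (sample n)" "?Y \<in> borel_measurable (sample n)"
    by (intro borel_measurable_sum measurable_Z_comp measurable_sample_comp[OF measurable_weighted]; simp)+
  have "(\<integral>\<^sup>+z. ennreal ((norm (ols_r n z))\<^sup>2) \<partial>sample n) = (\<integral>\<^sup>+z. ennreal (1 / n ^ 4) * ennreal ((norm ((real n)\<^sup>2 *\<^sub>R ols_r n z))\<^sup>2) \<partial>sample n)"
    using n by (intro nn_integral_cong) (simp add: power_mult_distrib flip: ennreal_mult power_mult)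
  also have "\<dots> \<le> (\<integral>\<^sup>+z. ennreal (3 / n ^ 4) * (ennreal ((norm (?D z))\<^sup>2) + ennreal ((real n - 1)\<^sup>2) * ennreal ((norm (?E z))\<^sup>2) + ennreal ((norm (?Y z))\<^sup>2)) \<partial>sample n)"
  proof (intro nn_integral_mono)
    fix z
    have "(norm ((real n)\<^sup>2 *\<^sub>R ols_r n z))\<^sup>2 \<le> 3 * ((norm (?D z))\<^sup>2 + (real n - 1)\<^sup>2 * (norm (?E z))\<^sup>2 + (norm (?Y z))\<^sup>2)"
      unfolding ols_r_decomposition[OF n] using norm_sum3_squared[of "?D z" "(real n - 1) *\<^sub>R ?E z" "?Y z"]
      by (simp add: power_mult_distrib)
    then have "1 / n ^ 4 * (norm ((real n)\<^sup>2 *\<^sub>R ols_r n z))\<^sup>2 \<le> 1 / n ^ 4 * (3 * ((norm (?D z))\<^sup>2 + (real n - 1)\<^sup>2 * (norm (?E z))\<^sup>2 + (norm (?Y z))\<^sup>2))"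
      by (intro mult_left_mono) auto
    then have "ennreal (1 / n ^ 4 * (norm ((real n)\<^sup>2 *\<^sub>R ols_r n z))\<^sup>2) \<le> ennreal (3 / n ^ 4 * ((norm (?D z))\<^sup>2 + (real n - 1)\<^sup>2 * (norm (?E z))\<^sup>2 + (norm (?Y z))\<^sup>2))"
      by (intro ennreal_leI) simp
    also have "\<dots> = ennreal (3 / n ^ 4) * (ennreal ((norm (?D z))\<^sup>2) + ennreal ((real n - 1)\<^sup>2) * ennreal ((norm (?E z))\<^sup>2) + ennreal ((norm (?Y z))\<^sup>2))"
      by (subst ennreal_mult) (auto simp: ennreal_mult ennreal_plus)
    finally show "ennreal (1 / n ^ 4) * ennreal ((norm ((real n)\<^sup>2 *\<^sub>R ols_r n z))\<^sup>2) \<le> \<dots>"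
      by (subst ennreal_mult[symmetric]) auto
  qed
  also have "\<dots> = ennreal (3 / n ^ 4) * ((\<integral>\<^sup>+z. ennreal ((norm (?D z))\<^sup>2) \<partial>sample n) + ennreal ((real n - 1)\<^sup>2) * (\<integral>\<^sup>+z. ennreal ((norm (?E z))\<^sup>2) \<partial>sample n) + (\<integral>\<^sup>+z. ennreal ((norm (?Y z))\<^sup>2) \<partial>sample n))"
    by (simp add: nn_integral_cmult nn_integral_add)
  also have "\<dots> \<le> ennreal (3 / n ^ 4) * (ennreal (2 * n\<^sup>2 * (K * V)) + ennreal ((real n - 1)\<^sup>2) * ennreal (K * V) + ennreal (2 * n * V))"
    by (intro mult_left_mono add_mono D E Y) auto
  also have "\<dots> = ennreal (3 / n ^ 4 * (2 * n\<^sup>2 * (K * V) + (real n - 1)\<^sup>2 * (K * V) + 2 * n * V))"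
    using K1 V_nonneg by (subst (3) ennreal_mult) (auto simp: ennreal_mult ennreal_plus)
  also have "\<dots> \<le> ennreal (15 * K * V / n\<^sup>2)"
  proof (intro ennreal_leI)
    have KV: "0 \<le> K * V" using K1 V_nonneg by simp
    have n1: "1 \<le> real n" using n by simp
    have "(real n - 1)\<^sup>2 \<le> (real n)\<^sup>2" using n1 by (intro power_mono) auto
    then have 1: "(real n - 1)\<^sup>2 * (K * V) \<le> (real n)\<^sup>2 * (K * V)" using KV by (rule mult_right_mono)
    have "n * V \<le> (real n)\<^sup>2 * (K * V)"
    proof (intro mult_mono)
      show "real n \<le> (real n)\<^sup>2" using n1 by (simp add: power2_eq_square)
      show "V \<le> K * V" using K1 V_nonneg mult_right_mono[of 1 K V] by simp
    qed (use V_nonneg in auto)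
    then have "2 * n\<^sup>2 * (K * V) + (real n - 1)\<^sup>2 * (K * V) + 2 * n * V \<le> 5 * ((real n)\<^sup>2 * (K * V))"
      using 1 unfolding of_nat_mult of_nat_power of_nat_numeral mult.assoc[of 2] by linarith
    then have "3 / n ^ 4 * (2 * n\<^sup>2 * (K * V) + (real n - 1)\<^sup>2 * (K * V) + 2 * n * V) \<le> 3 / n ^ 4 * (5 * ((real n)\<^sup>2 * (K * V)))"
      by (intro mult_left_mono) auto
    also have "\<dots> = 15 * K * V / n\<^sup>2"
    proof -
      have "3 / m ^ 4 * (5 * (m\<^sup>2 * c)) = 15 * c / m\<^sup>2" if "m \<noteq> 0" for m c :: real
        using that by (simp add: power4_eq_xxxx power2_eq_square)
      from this[of "real n" "K * V"] show ?thesis using n by simp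
    qed
    finally show "3 / n ^ 4 * (2 * n\<^sup>2 * (K * V) + (real n - 1)\<^sup>2 * (K * V) + 2 * n * V) \<le> 15 * K * V / n\<^sup>2" .
  qed
  finally show ?thesis by (simp add: K_def mult_ac)
qed

lemma measurable_sample_design:
  "(\<lambda>z. \<lambda>j\<in>{..<n}. X (z j)) \<in> sample n \<rightarrow>\<^sub>M (\<Pi>\<^sub>M j\<in>{..<n}. borel)"
  by (intro measurable_restrict measurable_compose[OF _ X]) auto

text \<open>The weight may depend on the whole design, including the i-th vector. Resampling
  coordinate \<open>i\<close> with the others frozen leaves a function of that one vector as the
  test function, so \<open>cond_exp\<close> applies in a single coordinate.\<close>

lemma cond_exp_sample:
  assumes G[measurable]: "G \<in> borel_measurable (\<Pi>\<^sub>M j\<in>{..<n}. (borel :: 'b measure))" and i: "i < n"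
  shows "(\<integral>\<^sup>+z. G (\<lambda>j\<in>{..<n}. X (z j)) * (ennreal ((norm (X (z i)))\<^sup>2) * ennreal ((\<epsilon> (z i))\<^sup>2)) \<partial>sample n)
       = (\<integral>\<^sup>+z. G (\<lambda>j\<in>{..<n}. X (z j)) * (ennreal ((norm (X (z i)))\<^sup>2) * s (z i)) \<partial>sample n)"
proof -
  note Xm = measurable_sample_design[of n]
  have GX[measurable]: "(\<lambda>z. G (\<lambda>j\<in>{..<n}. X (z j))) \<in> borel_measurable (sample n)"
    by (rule measurable_compose[OF Xm G])
  note [measurable] = measurable_sample_comp[OF X i] measurable_sample_comp[OF \<epsilon> i]
  have [measurable]: "(\<lambda>z. s (z i)) \<in> borel_measurable (sample n)"
    by (rule measurable_sample_comp[OF s i])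
  have upd: "(\<lambda>j\<in>{..<n}. X ((z(i := x)) j)) = (\<lambda>j\<in>{..<n}. X (z j))(i := X x)" for z x
    using i by (auto simp: fun_eq_iff)
  show ?thesis
  proof (subst (1 2) nn_integral_PiM_resample[OF prob_space_axioms, of i])
    show "(\<integral>\<^sup>+z. \<integral>\<^sup>+x. G (\<lambda>j\<in>{..<n}. X ((z(i := x)) j)) * (ennreal ((norm (X ((z(i := x)) i)))\<^sup>2) * ennreal ((\<epsilon> ((z(i := x)) i))\<^sup>2)) \<partial>M \<partial>sample n)
        = (\<integral>\<^sup>+z. \<integral>\<^sup>+x. G (\<lambda>j\<in>{..<n}. X ((z(i := x)) j)) * (ennreal ((norm (X ((z(i := x)) i)))\<^sup>2) * s ((z(i := x)) i)) \<partial>M \<partial>sample n)"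
    proof (rule nn_integral_cong)
      fix z assume z: "z \<in> space (sample n)"
      let ?a = "\<lambda>j\<in>{..<n}. X (z j)"
      have "(\<lambda>b. ?a(i := b)) \<in> borel \<rightarrow>\<^sub>M (\<Pi>\<^sub>M j\<in>{..<n}. borel)"
        using i by (intro measurable_fun_upd[where J="{..<n}"] measurable_const) (auto simp: space_PiM)
      then have [measurable]: "(\<lambda>b. G (?a(i := b))) \<in> borel_measurable borel"
        by (rule measurable_compose[OF _ G])
      have "(\<integral>\<^sup>+x. (G (?a(i := X x)) * ennreal ((norm (X x))\<^sup>2)) * ennreal ((\<epsilon> x)\<^sup>2) \<partial>M)
          = (\<integral>\<^sup>+x. (G (?a(i := X x)) * ennreal ((norm (X x))\<^sup>2)) * s x \<partial>M)"
        by (rule cond_exp) measurable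
      then show "(\<integral>\<^sup>+x. G (\<lambda>j\<in>{..<n}. X ((z(i := x)) j)) * (ennreal ((norm (X ((z(i := x)) i)))\<^sup>2) * ennreal ((\<epsilon> ((z(i := x)) i))\<^sup>2)) \<partial>M)
        = (\<integral>\<^sup>+x. G (\<lambda>j\<in>{..<n}. X ((z(i := x)) j)) * (ennreal ((norm (X ((z(i := x)) i)))\<^sup>2) * s ((z(i := x)) i)) \<partial>M)"
        unfolding upd by (simp add: mult.assoc)
    qed
  qed ((use i in simp), measurable, measurable)
qed

text \<open>The kernel is bilinear in the centred vectors \<epsilon> X, hence degenerate, and by
  Cauchy-Schwarz its second moment is at most the product of two copies of \<open>V\<close>. No
  power of \<epsilon> above the second occurs in a single coordinate.\<close>

lemma noise_cross_moment:
  "(\<integral>\<^sup>+z. ennreal ((\<Sum>p\<in>{p \<in> {..<n} \<times> {..<n}. fst p \<noteq> snd p}.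
      (\<epsilon> (z (fst p)) *\<^sub>R X (z (fst p))) \<bullet> (\<epsilon> (z (snd p)) *\<^sub>R X (z (snd p))))\<^sup>2) \<partial>sample n) \<le> ennreal (2 * (real n)\<^sup>2 * V\<^sup>2)"
proof -
  let ?f = "\<lambda>x y. (\<epsilon> x *\<^sub>R X x) \<bullet> (\<epsilon> y *\<^sub>R X y)"
  have "(\<integral>\<^sup>+z. ennreal ((norm (\<Sum>p\<in>{p \<in> {..<n} \<times> {..<n}. fst p \<noteq> snd p}. ?f (z (fst p)) (z (snd p))))\<^sup>2) \<partial>sample n)
      \<le> ennreal (2 * (card {..<n})\<^sup>2 * V\<^sup>2)"
  proof (rule degenerate_U_statistic_second_moment[OF prob_space_axioms])
    show "(\<lambda>(x, y). ?f x y) \<in> borel_measurable (M \<Otimes>\<^sub>M M)" by measurable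
    have "(\<integral>\<^sup>+x. \<integral>\<^sup>+y. ennreal ((norm (?f x y))\<^sup>2) \<partial>M \<partial>M)
        \<le> (\<integral>\<^sup>+x. \<integral>\<^sup>+y. ennreal ((\<epsilon> x)\<^sup>2 * (norm (X x))\<^sup>2) * ennreal ((\<epsilon> y)\<^sup>2 * (norm (X y))\<^sup>2) \<partial>M \<partial>M)"
    proof (intro nn_integral_mono)
      fix x y
      have "\<bar>?f x y\<bar> \<le> norm (\<epsilon> x *\<^sub>R X x) * norm (\<epsilon> y *\<^sub>R X y)" by (rule Cauchy_Schwarz_ineq2)
      then have "(norm (?f x y))\<^sup>2 \<le> (norm (\<epsilon> x *\<^sub>R X x) * norm (\<epsilon> y *\<^sub>R X y))\<^sup>2"
        by (intro power_mono) auto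
      then show "ennreal ((norm (?f x y))\<^sup>2) \<le> ennreal ((\<epsilon> x)\<^sup>2 * (norm (X x))\<^sup>2) * ennreal ((\<epsilon> y)\<^sup>2 * (norm (X y))\<^sup>2)"
        by (subst ennreal_mult[symmetric]) (auto simp: power_mult_distrib intro!: ennreal_leI)
    qed
    also have "\<dots> = (\<integral>\<^sup>+x. ennreal ((\<epsilon> x)\<^sup>2 * (norm (X x))\<^sup>2) * ennreal V \<partial>M)"
      by (simp add: nn_integral_cmult V_eq)
    also have "\<dots> = ennreal V * ennreal V" by (subst nn_integral_multc) (auto simp: V_eq)
    finally show "(\<integral>\<^sup>+x. \<integral>\<^sup>+y. ennreal ((norm (?f x y))\<^sup>2) \<partial>M \<partial>M) \<le> ennreal (V\<^sup>2)"
      using V_nonneg by (simp add: power2_eq_square ennreal_mult)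
    show "integrable M (\<lambda>y. ?f x y)" "integrable M (\<lambda>y. ?f y x)" for x
      by (intro integrable_inner_right integrable_inner_left integrable_noise)+
    show "(\<integral>y. ?f x y \<partial>M) = 0" for x
      using integral_inner_right[of "\<epsilon> x *\<^sub>R X x" M "\<lambda>y. \<epsilon> y *\<^sub>R X y"] integrable_noise
      by (simp only: uncorrelated inner_zero_right)
    show "(\<integral>y. ?f y x \<partial>M) = 0" for x
      using integral_inner_left[of "\<epsilon> x *\<^sub>R X x" M "\<lambda>y. \<epsilon> y *\<^sub>R X y"] integrable_noise
      by (simp only: uncorrelated inner_zero_left)
  qed auto
  then show ?thesis by simp
qed

text \<open>Applying Cauchy-Schwarz directly to the product of \<open>G\<close> and
  \<open>norm v ^ 2\<close> would call for fourth moments of \<epsilon>. So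
  \<open>norm v ^ 2\<close> is split: on the diagonal \<epsilon>^2 becomes \<open>s\<close> first,
  giving \<open>L * W\<close> for each index, and the off-diagonal sum is controlled by its own
  second moment. The constant 5/2 bounds 1 + sqrt 2.\<close>

lemma ols_v_weighted_moment:
  fixes L :: real
  assumes n: "0 < n" and G[measurable]: "G \<in> borel_measurable (\<Pi>\<^sub>M j\<in>{..<n}. (borel :: 'b measure))" and G0: "\<And>x. 0 \<le> G x"
    and L: "0 \<le> L" and GL: "(\<integral>\<^sup>+z. (ennreal (G (\<lambda>j\<in>{..<n}. X (z j))))\<^sup>2 \<partial>sample n) \<le> ennreal (L\<^sup>2)"
  shows "(\<integral>\<^sup>+z. ennreal (G (\<lambda>j\<in>{..<n}. X (z j)) * (norm (ols_v n z))\<^sup>2) \<partial>sample n) \<le> ennreal (5 / 2 * L * W / n)"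
proof -
  let ?S = "sample n" and ?Q = "{p \<in> {..<n} \<times> {..<n}. fst p \<noteq> snd p}"
  define H where "H z = G (\<lambda>j\<in>{..<n}. X (z j))" for z
  define U where "U z = (\<Sum>p\<in>?Q. (\<epsilon> (z (fst p)) *\<^sub>R X (z (fst p))) \<bullet> (\<epsilon> (z (snd p)) *\<^sub>R X (z (snd p))))" for z
  have H0: "0 \<le> H z" for z by (simp add: H_def G0)
  note Xm = measurable_sample_design[of n]
  have Hm[measurable]: "H \<in> borel_measurable ?S"
    unfolding H_def by (rule measurable_compose[OF Xm G])
  have xi[measurable]: "(\<lambda>z. X (z i)) \<in> borel_measurable ?S" "(\<lambda>z. \<epsilon> (z i)) \<in> borel_measurable ?S" "(\<lambda>z. s (z i)) \<in> borel_measurable ?S" if "i < n" for i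
    using that measurable_sample_comp[OF X] measurable_sample_comp[OF \<epsilon>] measurable_sample_comp[OF s] by auto
  have Um[measurable]: "U \<in> borel_measurable ?S"
    unfolding U_def by (intro borel_measurable_sum borel_measurable_inner borel_measurable_scaleR xi) auto
  interpret S: prob_space ?S by (rule prob_space_PiM) (rule prob_space_axioms)
  have diag: "(\<integral>\<^sup>+z. ennreal (H z) * (ennreal ((norm (X (z i)))\<^sup>2) * ennreal ((\<epsilon> (z i))\<^sup>2)) \<partial>?S) \<le> ennreal (L * W)" if i: "i < n" for i
  proof -
    have "(\<integral>\<^sup>+z. ennreal (H z) * (ennreal ((norm (X (z i)))\<^sup>2) * ennreal ((\<epsilon> (z i))\<^sup>2)) \<partial>?S)
        = (\<integral>\<^sup>+z. ennreal (H z) * (ennreal ((norm (X (z i)))\<^sup>2) * s (z i)) \<partial>?S)"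
      unfolding H_def using i by (intro cond_exp_sample[where G="\<lambda>x. ennreal (G x)"]) auto
    also have "\<dots> \<le> ennreal (L * W)"
    proof (rule Cauchy_Schwarz_nn_integral_bound)
      show "(\<integral>\<^sup>+z. (ennreal (H z))\<^sup>2 \<partial>?S) \<le> ennreal (L\<^sup>2)" unfolding H_def by (rule GL)
      have "(\<integral>\<^sup>+z. (ennreal ((norm (X (z i)))\<^sup>2) * s (z i))\<^sup>2 \<partial>?S) = (\<integral>\<^sup>+x. (ennreal ((norm (X x))\<^sup>2) * s x)\<^sup>2 \<partial>M)"
        using i by (intro nn_integral_PiM_component[OF prob_space_axioms, where f="\<lambda>x. (ennreal ((norm (X x))\<^sup>2) * s x)\<^sup>2"]) auto
      also have "\<dots> = (\<integral>\<^sup>+x. (s x)\<^sup>2 * ennreal (norm (X x) ^ 4) \<partial>M)"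
        by (simp add: power_mult_distrib ennreal_power mult.commute flip: power_mult)
      finally show "(\<integral>\<^sup>+z. (ennreal ((norm (X (z i)))\<^sup>2) * s (z i))\<^sup>2 \<partial>?S) \<le> ennreal (W\<^sup>2)" using W by simp
    qed (use L W0 i in auto)
    finally show ?thesis .
  qed
  have off: "(\<integral>\<^sup>+z. ennreal (H z) * ennreal \<bar>U z\<bar> \<partial>?S) \<le> ennreal (L * (sqrt 2 * n * V))"
  proof (rule Cauchy_Schwarz_nn_integral_bound)
    show "(\<integral>\<^sup>+z. (ennreal (H z))\<^sup>2 \<partial>?S) \<le> ennreal (L\<^sup>2)" unfolding H_def by (rule GL)
    show "(\<integral>\<^sup>+z. (ennreal \<bar>U z\<bar>)\<^sup>2 \<partial>?S) \<le> ennreal ((sqrt 2 * n * V)\<^sup>2)"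
      using noise_cross_moment[of n] by (simp add: U_def ennreal_power power_mult_distrib)
  qed (use L V_nonneg in auto)
  have expand: "(real n)\<^sup>2 * (norm (ols_v n z))\<^sup>2 = (\<Sum>i<n. (norm (X (z i)))\<^sup>2 * (\<epsilon> (z i))\<^sup>2) + U z" for z
  proof -
    have "(real n)\<^sup>2 * (norm (ols_v n z))\<^sup>2 = (norm (\<Sum>i<n. \<epsilon> (z i) *\<^sub>R X (z i)))\<^sup>2"
      using n by (simp add: ols_v_def power_divide)
    also have "\<dots> = U z + (\<Sum>i<n. (\<epsilon> (z i) *\<^sub>R X (z i)) \<bullet> (\<epsilon> (z i) *\<^sub>R X (z i)))"
      unfolding norm_sum_squared U_def by (rule sum_square_eq_offdiagonal) simp
    finally show ?thesis by (simp add: dot_square_norm power_mult_distrib mult.commute add.commute)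
  qed
  have "(\<integral>\<^sup>+z. ennreal (H z * (norm (ols_v n z))\<^sup>2) \<partial>?S)
      \<le> (\<integral>\<^sup>+z. ennreal (1 / (real n)\<^sup>2) * ((\<Sum>i<n. ennreal (H z) * (ennreal ((norm (X (z i)))\<^sup>2) * ennreal ((\<epsilon> (z i))\<^sup>2))) + ennreal (H z) * ennreal \<bar>U z\<bar>) \<partial>?S)"
  proof (intro nn_integral_mono)
    fix z
    have "H z * (norm (ols_v n z))\<^sup>2 = 1 / (real n)\<^sup>2 * (H z * ((real n)\<^sup>2 * (norm (ols_v n z))\<^sup>2))" using n by simp
    also have "\<dots> \<le> 1 / (real n)\<^sup>2 * ((\<Sum>i<n. H z * ((norm (X (z i)))\<^sup>2 * (\<epsilon> (z i))\<^sup>2)) + H z * \<bar>U z\<bar>)"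
      unfolding expand using H0[of z] mult_left_mono[of "U z" "\<bar>U z\<bar>" "H z"]
      by (intro mult_left_mono) (auto simp: distrib_left sum_distrib_left)
    finally have "ennreal (H z * (norm (ols_v n z))\<^sup>2) \<le> ennreal (1 / (real n)\<^sup>2 * ((\<Sum>i<n. H z * ((norm (X (z i)))\<^sup>2 * (\<epsilon> (z i))\<^sup>2)) + H z * \<bar>U z\<bar>))"
      by (rule ennreal_leI)
    also have "\<dots> = ennreal (1 / (real n)\<^sup>2) * ((\<Sum>i<n. ennreal (H z) * (ennreal ((norm (X (z i)))\<^sup>2) * ennreal ((\<epsilon> (z i))\<^sup>2))) + ennreal (H z) * ennreal \<bar>U z\<bar>)"
      using H0[of z] by (subst ennreal_mult) (auto simp: ennreal_plus ennreal_mult sum_nonneg simp flip: sum_ennreal)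
    finally show "ennreal (H z * (norm (ols_v n z))\<^sup>2) \<le> \<dots>" .
  qed
  also have "\<dots> = ennreal (1 / (real n)\<^sup>2) * ((\<Sum>i<n. \<integral>\<^sup>+z. ennreal (H z) * (ennreal ((norm (X (z i)))\<^sup>2) * ennreal ((\<epsilon> (z i))\<^sup>2)) \<partial>?S) + (\<integral>\<^sup>+z. ennreal (H z) * ennreal \<bar>U z\<bar> \<partial>?S))"
  proof -
    have m1: "(\<lambda>z. ennreal (H z) * (ennreal ((norm (X (z i)))\<^sup>2) * ennreal ((\<epsilon> (z i))\<^sup>2))) \<in> borel_measurable ?S" if "i \<in> {..<n}" for i
      using that by measurable
    have m2: "(\<lambda>z. ennreal (H z) * ennreal \<bar>U z\<bar>) \<in> borel_measurable ?S" by measurable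
    show ?thesis
      by (simp only: nn_integral_cmult nn_integral_add nn_integral_sum m1 m2 borel_measurable_add borel_measurable_sum)
  qed
  also have "\<dots> \<le> ennreal (1 / (real n)\<^sup>2) * ((\<Sum>i<n. ennreal (L * W)) + ennreal (L * (sqrt 2 * n * V)))"
    by (intro mult_left_mono add_mono sum_mono diag off) auto
  also have "\<dots> = ennreal (1 / (real n)\<^sup>2 * (n * (L * W) + L * (sqrt 2 * n * V)))"
    using L W0 V_nonneg by (subst ennreal_mult) (auto simp: ennreal_plus ennreal_mult ennreal_of_nat_eq_real_of_nat)
  also have "\<dots> \<le> ennreal (5 / 2 * L * W / n)"
  proof (rule ennreal_leI)
    have "sqrt 2 \<le> (3 / 2 :: real)" by (rule real_le_lsqrt) (auto simp: power2_eq_square)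
    then have s2: "L * (sqrt 2 * n * V) \<le> L * (3 / 2 * n * W)"
      using L V_nonneg V_le_W by (intro mult_left_mono mult_mono) auto
    have "1 / (real n)\<^sup>2 * (n * (L * W) + L * (sqrt 2 * n * V)) \<le> 1 / (real n)\<^sup>2 * (n * (L * W) + L * (3 / 2 * n * W))"
      by (intro mult_left_mono add_left_mono s2) simp
    also have "\<dots> = 1 / (real n)\<^sup>2 * (n * (5 / 2 * L * W))" by simp
    also have "\<dots> = 5 / 2 * L * W / n" using n by (simp add: power2_eq_square)
    finally show "1 / (real n)\<^sup>2 * (n * (L * W) + L * (sqrt 2 * n * V)) \<le> 5 / 2 * L * W / n" .
  qed
  finally show ?thesis by (simp add: H_def)
qed

text \<open>Writing \<open>e = A\<^sup>-\<^sup>1 v = u + A\<^sup>-\<^sup>1 r\<close>, one has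
  \<open>norm e ^ 2 = norm u ^ 2 + 2 * (A\<^sup>-\<^sup>1 r \<bullet> A\<^sup>-\<^sup>1 v) - norm (A\<^sup>-\<^sup>1 r) ^ 2\<close>.\<close>

lemma ols_error_pointwise:
  assumes n: "0 < n" and N0: "0 \<le> N"
    and N: "\<And>\<theta>. n * (norm \<theta>)\<^sup>2 \<le> N * (\<Sum>i<n. (\<theta> \<bullet> X (z i))\<^sup>2)"
    and e: "ols_A n z e = ols_v n z"
  shows "(norm e)\<^sup>2 \<le> (norm (ols_u n z))\<^sup>2 + 2 * (norm (ols_r n z) * (N\<^sup>2 * norm (ols_v n z)))"
proof -
  \<comment> \<open>The hypothesis reads \<open>norm f ^ 2 \<le> N * (A f \<bullet> f)\<close>;
    Cauchy-Schwarz and cancelling one \<open>norm f\<close> turn it into a norm bound for the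
    inverse of A.\<close>
  have inv: "norm f \<le> N * norm (ols_A n z f)" for f
  proof -
    have "(\<Sum>i<n. (f \<bullet> X (z i))\<^sup>2) = n * (ols_A n z f \<bullet> f)"
      using n by (simp add: ols_A_def inner_sum_left power2_eq_square inner_commute[of f])
    then have "n * (norm f)\<^sup>2 \<le> n * (N * (ols_A n z f \<bullet> f))" using N[of f] by (simp add: mult_ac)
    then have "(norm f)\<^sup>2 \<le> N * (ols_A n z f \<bullet> f)" using n by simp
    also have "\<dots> \<le> N * (norm (ols_A n z f) * norm f)"
      using N0 by (intro mult_left_mono norm_cauchy_schwarz)
    finally have "norm f * norm f \<le> (N * norm (ols_A n z f)) * norm f" by (simp add: power2_eq_square mult_ac)
    then show ?thesis using N0 by (cases "f = 0") auto
  qed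
  let ?f = "e - ols_u n z"
  have Af: "ols_A n z ?f = ols_r n z"
    using e by (simp add: ols_r_def ols_A_def inner_diff_right scaleR_diff_left sum_subtractf scaleR_diff_right)
  have f: "norm ?f \<le> N * norm (ols_r n z)" using inv[of ?f] by (simp add: Af)
  have ee: "norm e \<le> N * norm (ols_v n z)" using inv[of e] by (simp add: e)
  have "(norm e)\<^sup>2 = (norm (ols_u n z))\<^sup>2 + 2 * (?f \<bullet> e) - (norm ?f)\<^sup>2"
    by (simp add: power2_norm_eq_inner inner_diff_left inner_diff_right inner_commute algebra_simps)
  also have "\<dots> \<le> (norm (ols_u n z))\<^sup>2 + 2 * (norm ?f * norm e)"
    using norm_cauchy_schwarz[of ?f e] zero_le_power2[of "norm ?f"] by linarith
  also have "norm ?f * norm e \<le> (N * norm (ols_r n z)) * (N * norm (ols_v n z))"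
    using f ee N0 by (intro mult_mono) auto
  finally show ?thesis by (simp add: power2_eq_square mult_ac)
qed

text \<open>The leading term \<open>V / n\<close> comes from the proxy alone. Everything else has
  the order n^(-3/2): the mean of the proxy, and the product of a remainder of order 1 / n with a
  noise average of order n^(-1/2).\<close>

theorem ols_error_bound:
  fixes n :: nat and e :: "(nat \<Rightarrow> 'a) \<Rightarrow> 'b"
  defines "C' \<equiv> 3 * C ^ 4 * exp (1 + 9 / \<alpha>)"
  assumes n: "96 \<le> \<alpha> * n" "real DIM('b) \<le> \<alpha> * n / 6"
    and e: "AE z in sample n. ols_A n z (e z) = ols_v n z"
  shows "(\<integral>\<^sup>+z. ennreal ((norm (e z))\<^sup>2) \<partial>sample n) \<le> ennreal (V / n + 63 * C'\<^sup>2 * (sqrt (\<kappa> * DIM('b)) * W / (n * sqrt n)))"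
proof -
  have n0: "0 < n" using n \<alpha> by (cases n) auto
  have C'1: "1 \<le> C'"
  proof -
    have "1 * 1 * 1 \<le> 3 * C ^ 4 * exp (1 + 9 / \<alpha>)"
      using C \<alpha> by (intro mult_mono) auto
    then show ?thesis by (simp add: C'_def)
  qed
  define K where "K = \<kappa> * DIM('b)"
  have K0: "0 \<le> K" using \<kappa>0 by (simp add: K_def)
  obtain N where Nm[measurable]: "N \<in> borel_measurable (\<Pi>\<^sub>M i\<in>{..<n}. (borel :: 'b measure))" and N0: "\<And>x. 0 \<le> N x"
    and N8: "(\<integral>\<^sup>+z. ennreal (N (\<lambda>i\<in>{..<n}. X (z i)) ^ 8) \<partial>sample n) \<le> ennreal (529 * C' ^ 8)"
    and AEN: "AE z in sample n. \<forall>\<theta>. n * (norm \<theta>)\<^sup>2 \<le> N (\<lambda>i\<in>{..<n}. X (z i)) * (\<Sum>i<n. (\<theta> \<bullet> X (z i))\<^sup>2)"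
    by (rule inverse_eigenvalue_moment[OF n, folded C'_def]) (rule that; assumption)
  define \<nu> where "\<nu> z = N (\<lambda>i\<in>{..<n}. X (z i))" for z
  note Xm = measurable_sample_design[of n]
  have [measurable]: "\<nu> \<in> borel_measurable (sample n)"
    unfolding \<nu>_def by (rule measurable_compose[OF Xm Nm])
  have xi: "(\<lambda>z. X (z i)) \<in> borel_measurable (sample n)" "(\<lambda>z. \<epsilon> (z i)) \<in> borel_measurable (sample n)" "(\<lambda>z. weighted n (z i)) \<in> borel_measurable (sample n)" if "i < n" for i
    using that measurable_sample_comp[OF X] measurable_sample_comp[OF \<epsilon>] measurable_sample_comp[OF measurable_weighted] by auto
  have vm[measurable]: "ols_v n \<in> borel_measurable (sample n)"
    unfolding ols_v_def by (intro borel_measurable_scaleR borel_measurable_const borel_measurable_sum xi) auto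
  have um[measurable]: "ols_u n \<in> borel_measurable (sample n)"
    unfolding ols_u_def by (intro borel_measurable_scaleR borel_measurable_const borel_measurable_sum xi) auto
  have rm[measurable]: "ols_r n \<in> borel_measurable (sample n)"
    unfolding ols_r_def ols_A_def
    by (intro borel_measurable_diff vm borel_measurable_scaleR borel_measurable_const borel_measurable_sum borel_measurable_inner xi um) auto
  \<comment> \<open>Rational square roots: 4^2 = 16 exceeds the 15 of the remainder bound, and 7.7^2
    = 59.29 exceeds 57.5 = (5/2) * 23, where 23 is the root of 529.\<close>
  define a where "a = 4 * sqrt (K * W) / n"
  define b where "b = (77 / 10) * C'\<^sup>2 * sqrt (W / n)"
  have ab0: "0 \<le> a" "0 \<le> b" using K0 W0 by (auto simp: a_def b_def)
  have r: "(\<integral>\<^sup>+z. (ennreal (norm (ols_r n z)))\<^sup>2 \<partial>sample n) \<le> ennreal (a\<^sup>2)"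
  proof -
    have "15 * K * V / n\<^sup>2 \<le> 16 * (K * W) / n\<^sup>2"
      using mult_left_mono[OF V_le_W K0] mult_nonneg_nonneg[OF K0 V_nonneg]
      by (intro divide_right_mono) (linarith, simp)
    also have "\<dots> = a\<^sup>2" using K0 W0 by (simp add: a_def power_divide power_mult_distrib)
    finally show ?thesis using ols_r_moment[OF n0] by (simp add: ennreal_power K_def mult_ac ennreal_leI order_trans[OF _ ennreal_leI])
  qed
  have v: "(\<integral>\<^sup>+z. (ennreal ((\<nu> z)\<^sup>2 * norm (ols_v n z)))\<^sup>2 \<partial>sample n) \<le> ennreal (b\<^sup>2)"
  proof -
    have "(\<integral>\<^sup>+z. ennreal ((N (\<lambda>j\<in>{..<n}. X (z j)) ^ 4) * (norm (ols_v n z))\<^sup>2) \<partial>sample n) \<le> ennreal (5 / 2 * (23 * C' ^ 4) * W / n)"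
    proof (rule ols_v_weighted_moment[OF n0, of "\<lambda>x. N x ^ 4"])
      show "(\<integral>\<^sup>+z. (ennreal (N (\<lambda>j\<in>{..<n}. X (z j)) ^ 4))\<^sup>2 \<partial>sample n) \<le> ennreal ((23 * C' ^ 4)\<^sup>2)"
        using N8 N0 by (simp add: ennreal_power power_mult_distrib flip: power_mult)
    qed (use C'1 N0 in auto)
    also have "\<dots> \<le> ennreal (b\<^sup>2)"
    proof (rule ennreal_leI)
      have "5 / 2 * (23 * C' ^ 4) * W / n = 115 / 2 * (C' ^ 4 * (W / n))" by simp
      also have "\<dots> \<le> 5929 / 100 * (C' ^ 4 * (W / n))" using W0 by (intro mult_right_mono) auto
      also have "\<dots> = b\<^sup>2" using W0 by (simp add: b_def power_mult_distrib power_divide flip: power_mult)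
      finally show "5 / 2 * (23 * C' ^ 4) * W / n \<le> b\<^sup>2" .
    qed
    finally show ?thesis using N0
      by (simp add: \<nu>_def ennreal_power power_mult_distrib flip: power_mult)
  qed
  have u: "(\<integral>\<^sup>+z. ennreal ((norm (ols_u n z))\<^sup>2) \<partial>sample n) \<le> ennreal (V / n + sqrt K * W / (n * sqrt n))"
  proof -
    have "(\<integral>\<^sup>+z. ennreal ((norm (ols_u n z))\<^sup>2) \<partial>sample n) = (\<integral>\<^sup>+z. ennreal (1 / (real n)\<^sup>2) * ennreal ((norm (\<Sum>i<n. weighted n (z i)))\<^sup>2) \<partial>sample n)"
      by (intro nn_integral_cong) (simp add: ols_u_def power_divide flip: ennreal_mult)
    also have "\<dots> = ennreal (1 / (real n)\<^sup>2) * (\<integral>\<^sup>+z. ennreal ((norm (\<Sum>i<n. weighted n (z i)))\<^sup>2) \<partial>sample n)"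
      using xi(3) by (intro nn_integral_cmult measurable_compose[OF _ measurable_ennreal] borel_measurable_power borel_measurable_norm borel_measurable_sum) auto
    also have "\<dots> \<le> ennreal (1 / (real n)\<^sup>2) * ennreal (real n * V + (real n)\<^sup>2 * (norm (mean n))\<^sup>2)"
      by (intro mult_left_mono sum_weighted_moment) auto
    also have "\<dots> = ennreal (1 / (real n)\<^sup>2 * (real n * V + (real n)\<^sup>2 * (norm (mean n))\<^sup>2))"
      using V_nonneg by (intro ennreal_mult[symmetric]) auto
    also have "1 / (real n)\<^sup>2 * (real n * V + (real n)\<^sup>2 * (norm (mean n))\<^sup>2) = V / n + (norm (mean n))\<^sup>2"
      using n0 by (simp add: power2_eq_square field_simps)
    also have "ennreal (V / n + (norm (mean n))\<^sup>2) \<le> ennreal (V / n + sqrt K * W / (n * sqrt n))"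
    proof (intro ennreal_leI add_left_mono)
      \<comment> \<open>Multiplying the two bounds of \<open>mean_le\<close> interpolates between
        them: the factors 1 / n and 1 / n^2 give n^(-3/2) after taking the root, and K enters only
        as \<open>sqrt K\<close>.\<close>
      have "((norm (mean n))\<^sup>2)\<^sup>2 \<le> (V / n) * (V * (K / n\<^sup>2))"
        unfolding power2_eq_square[of "(norm (mean n))\<^sup>2"] K_def
        using mean_le[OF n0] V_nonneg by (intro mult_mono) auto
      also have "\<dots> = (sqrt K * V / (n * sqrt n))\<^sup>2"
        using K0 n0 by (simp add: power_divide power_mult_distrib) (simp add: power2_eq_square mult_ac)
      finally have "(norm (mean n))\<^sup>2 \<le> sqrt K * V / (n * sqrt n)"
        by (rule power2_le_imp_le) (use K0 V_nonneg in auto)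
      also have "\<dots> \<le> sqrt K * W / (n * sqrt n)"
        using K0 V_le_W by (intro divide_right_mono mult_left_mono) auto
      finally show "(norm (mean n))\<^sup>2 \<le> sqrt K * W / (n * sqrt n)" .
    qed
    finally show ?thesis .
  qed
  have "(\<integral>\<^sup>+z. ennreal ((norm (e z))\<^sup>2) \<partial>sample n)
      \<le> (\<integral>\<^sup>+z. ennreal ((norm (ols_u n z))\<^sup>2) + 2 * (ennreal (norm (ols_r n z)) * ennreal ((\<nu> z)\<^sup>2 * norm (ols_v n z))) \<partial>sample n)"
  proof (rule nn_integral_mono_AE)
    show "AE z in sample n. ennreal ((norm (e z))\<^sup>2) \<le> ennreal ((norm (ols_u n z))\<^sup>2) + 2 * (ennreal (norm (ols_r n z)) * ennreal ((\<nu> z)\<^sup>2 * norm (ols_v n z)))"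
      using AEN e
    proof eventually_elim
      case (elim z)
      have "(norm (e z))\<^sup>2 \<le> (norm (ols_u n z))\<^sup>2 + 2 * (norm (ols_r n z) * ((\<nu> z)\<^sup>2 * norm (ols_v n z)))"
        unfolding \<nu>_def by (rule ols_error_pointwise) (use n0 N0 elim in auto)
      then have "ennreal ((norm (e z))\<^sup>2) \<le> ennreal ((norm (ols_u n z))\<^sup>2 + 2 * (norm (ols_r n z) * ((\<nu> z)\<^sup>2 * norm (ols_v n z))))"
        by (rule ennreal_leI)
      then show ?case by (simp add: ennreal_plus ennreal_mult)
    qed
  qed
  also have "\<dots> = (\<integral>\<^sup>+z. ennreal ((norm (ols_u n z))\<^sup>2) \<partial>sample n) + 2 * (\<integral>\<^sup>+z. ennreal (norm (ols_r n z)) * ennreal ((\<nu> z)\<^sup>2 * norm (ols_v n z)) \<partial>sample n)"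
    by (subst nn_integral_add, measurable, subst nn_integral_cmult, measurable)
  also have "\<dots> \<le> ennreal (V / n + sqrt K * W / (n * sqrt n)) + 2 * ennreal (a * b)"
  proof (intro add_mono u mult_left_mono)
    show "(\<integral>\<^sup>+z. ennreal (norm (ols_r n z)) * ennreal ((\<nu> z)\<^sup>2 * norm (ols_v n z)) \<partial>sample n) \<le> ennreal (a * b)"
      by (rule Cauchy_Schwarz_nn_integral_bound[OF _ _ r v ab0]) measurable
  qed simp
  also have "\<dots> = ennreal (V / n + sqrt K * W / (n * sqrt n) + 2 * (a * b))"
    using ab0 V_nonneg W0 K0 by (simp add: ennreal_plus ennreal_mult)
  also have "\<dots> \<le> ennreal (V / n + 63 * C'\<^sup>2 * (sqrt K * W / (n * sqrt n)))"
  proof (rule ennreal_leI)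
    define q where "q = sqrt K * W / (n * sqrt n)"
    have q0: "0 \<le> q" using K0 W0 by (simp add: q_def)
    have "a * b = (154 / 5) * C'\<^sup>2 * q"
    proof -
      have "sqrt (K * W) * sqrt (W / n) = sqrt K * W / sqrt n"
        using W0 by (simp add: real_sqrt_mult real_sqrt_divide)
      moreover have "a * b = (154 / 5) * C'\<^sup>2 * ((sqrt (K * W) * sqrt (W / n)) / n)"
        by (simp add: a_def b_def)
      ultimately show ?thesis by (simp add: q_def mult.commute)
    qed
    \<comment> \<open>The mean of the proxy adds a single \<open>q\<close>, absorbed by C' \<ge> 1.
      In total 1 + 2 * 4 * 7.7 = 62.6, rounded up to 63.\<close>
    moreover have "1 * q \<le> C'\<^sup>2 * q" using C'1 q0 by (intro mult_right_mono) auto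
    moreover have "0 \<le> C'\<^sup>2 * q" using q0 by simp
    ultimately show "V / n + sqrt K * W / (n * sqrt n) + 2 * (a * b) \<le> V / n + 63 * C'\<^sup>2 * (sqrt K * W / (n * sqrt n))"
      unfolding q_def[symmetric] mult.assoc by linarith
  qed
  finally show ?thesis by (simp add: K_def)
qed

end

section \<open>Positive semidefinite square roots\<close>

lemma symmetric_matrix_inner:
  fixes A :: "real ^ 'd ^ 'd"
  assumes "transpose A = A"
  shows "(A *v x) \<bullet> y = x \<bullet> (A *v y)"
  by (metis assms dot_lmul_matrix vector_transpose_matrix)

text \<open>A maximizer \<open>u\<close> of the Rayleigh quotient on the unit sphere of
  \<open>V\<close> works. The residual w = A u - c u lies in \<open>V\<close> and is orthogonal to
  \<open>u\<close>, so by the first-order condition it is orthogonal to A u as well, and thus to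
  itself.\<close>

lemma symmetric_eigenvector_exists:
  fixes A :: "real ^ 'd ^ 'd"
  assumes sym: "transpose A = A" and V: "subspace V" and inv: "\<And>x. x \<in> V \<Longrightarrow> A *v x \<in> V"
    and x0: "x0 \<in> V" "x0 \<noteq> 0"
  obtains u c where "u \<in> V" "norm u = 1" "A *v u = c *\<^sub>R u"
proof -
  have "compact (V \<inter> sphere 0 1)" using closed_subspace[OF V] by (simp add: closed_Int_compact)
  moreover have "x0 /\<^sub>R norm x0 \<in> V \<inter> sphere 0 1" using x0 subspace_scale[OF V] by auto
  moreover have "continuous_on (V \<inter> sphere 0 1) (\<lambda>x. x \<bullet> (A *v x))"
    by (intro continuous_intros linear_continuous_on linear_linear[THEN iffD2]) auto
  ultimately obtain u where u: "u \<in> V \<inter> sphere 0 1" and max: "\<And>x. x \<in> V \<inter> sphere 0 1 \<Longrightarrow> x \<bullet> (A *v x) \<le> u \<bullet> (A *v u)"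
    using continuous_attains_sup[of "V \<inter> sphere 0 1" "\<lambda>x. x \<bullet> (A *v x)"] by blast
  define c where "c = u \<bullet> (A *v u)"
  have uu: "u \<bullet> u = 1" using u by (simp add: dot_square_norm)
  have le: "x \<bullet> (A *v x) \<le> c * (x \<bullet> x)" if "x \<in> V" for x
  proof (cases "x = 0")
    case False
    have "x /\<^sub>R norm x \<in> V \<inter> sphere 0 1" using that False subspace_scale[OF V] by auto
    from max[OF this] have "(x \<bullet> (A *v x)) / (norm x)\<^sup>2 \<le> c"
      by (simp add: c_def matrix_vector_mult_scaleR power2_eq_square divide_inverse mult_ac)
    then show ?thesis using False by (simp add: dot_square_norm divide_le_eq)
  qed simp
  have orth: "w \<bullet> (A *v u) = 0" if w: "w \<in> V" "w \<bullet> u = 0" for w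
  proof -
    define g D where "g = w \<bullet> (A *v u)" and "D = w \<bullet> (A *v w) - c * (w \<bullet> w)"
    have D: "D \<le> 0" using le[OF w(1)] by (simp add: D_def)
    \<comment> \<open>An explicit perturbation replaces differentiation: since D \<le> 0 the
      denominator is positive, and with this \<open>t\<close> the maximality inequality becomes
      \<open>t\<^sup>2 * (2 - D) \<le> 0\<close>.\<close>
    define t where "t = g / (1 - D)"
    have "u + t *\<^sub>R w \<in> V" using u w subspace_add[OF V] subspace_scale[OF V] by auto
    from le[OF this] have "2 * t * g + t\<^sup>2 * D \<le> 0"
      using w(2) uu symmetric_matrix_inner[OF sym, of u w]
      by (simp add: g_def D_def c_def inner_add_left inner_add_right matrix_vector_right_distrib
          matrix_vector_mult_scaleR power2_eq_square inner_commute algebra_simps)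
    moreover have g: "g = t * (1 - D)" using D by (simp add: t_def)
    have "2 * t * g + t\<^sup>2 * D = t\<^sup>2 * (2 - D)"
      unfolding g by (simp add: power2_eq_square algebra_simps)
    ultimately have "t\<^sup>2 * (2 - D) \<le> 0" by simp
    then have "t = 0" using D by (simp add: mult_le_0_iff)
    then show ?thesis using g by (simp add: g_def)
  qed
  define w where "w = A *v u - c *\<^sub>R u"
  have "w \<in> V" using u inv subspace_diff[OF V] subspace_scale[OF V] by (auto simp: w_def)
  moreover have wu: "w \<bullet> u = 0" using uu by (simp add: w_def inner_diff_left c_def inner_commute[of "A *v u" u])
  ultimately have "w \<bullet> (A *v u) = 0" by (rule orth)
  moreover have "w \<bullet> w = w \<bullet> (A *v u) - c * (w \<bullet> u)" by (subst (2) w_def) (simp add: inner_diff_right)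
  ultimately have "w \<bullet> w = 0" using wu by simp
  then have "A *v u = c *\<^sub>R u" by (simp add: w_def)
  then show thesis using that[of u c] u by auto
qed

text \<open>An orthonormal set of eigenvectors of largest cardinality must span: otherwise its
  orthogonal complement is a nonzero invariant subspace and supplies one more eigenvector.\<close>

theorem symmetric_eigenbasis:
  fixes A :: "real ^ 'd ^ 'd"
  assumes sym: "transpose A = A"
  obtains B where "finite B" "pairwise orthogonal B" "\<And>b. b \<in> B \<Longrightarrow> norm b = 1" "span B = UNIV"
    "\<And>b. b \<in> B \<Longrightarrow> \<exists>c. A *v b = c *\<^sub>R b"
proof -
  define P where "P B \<longleftrightarrow> finite B \<and> pairwise orthogonal B \<and> (\<forall>b\<in>B. norm b = 1 \<and> (\<exists>c. A *v b = c *\<^sub>R b))" for B :: "(real ^ 'd) set"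
  have indep: "independent B" if "P B" for B
    using that by (intro pairwise_orthogonal_independent) (auto simp: P_def)
  have bound: "\<forall>B. P B \<longrightarrow> card B \<le> DIM(real ^ 'd)"
    using indep independent_bound by blast
  have "P {}" by (simp add: P_def)
  then have "\<exists>B. P B \<and> (\<forall>B'. P B' \<longrightarrow> card B' \<le> card B)"
    by (rule ex_has_greatest_nat[where b="Suc DIM(real ^ 'd)"]) (use bound in \<open>auto simp: less_Suc_eq_le\<close>)
  then obtain B where B: "P B" and max: "\<And>B'. P B' \<Longrightarrow> card B' \<le> card B" by blast
  have "span B = UNIV"
  proof (rule ccontr)
    assume "span B \<noteq> UNIV"
    then have "span B \<subset> UNIV" by auto
    from orthogonal_to_subspace_exists_gen[of B UNIV] this obtain x where x: "x \<noteq> 0" "\<And>y. y \<in> span B \<Longrightarrow> orthogonal x y"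
      by auto
    define V where "V = {v. \<forall>b\<in>B. v \<bullet> b = 0}"
    have V: "subspace V" by (auto simp: V_def subspace_def inner_add_left)
    have inv: "A *v v \<in> V" if "v \<in> V" for v
      unfolding V_def
    proof (intro CollectI ballI)
      fix b assume b: "b \<in> B"
      then obtain c where "A *v b = c *\<^sub>R b" using B by (auto simp: P_def)
      then show "(A *v v) \<bullet> b = 0" using that b by (simp add: symmetric_matrix_inner[OF sym] V_def)
    qed
    have "x \<in> V" using x(2) span_base by (auto simp: V_def orthogonal_def)
    then obtain u c where u: "u \<in> V" "norm u = 1" "A *v u = c *\<^sub>R u"
      using symmetric_eigenvector_exists[OF sym V inv _ x(1)] by blast
    have "u \<notin> B" using u by (auto simp: V_def)
    moreover have "P (insert u B)"
      using B u by (auto simp: P_def V_def pairwise_insert orthogonal_def inner_commute)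
    ultimately show False using max[of "insert u B"] B by (simp add: P_def)
  qed
  then show thesis using that[of B] B by (auto simp: P_def)
qed

text \<open>The vector w = S b - sqrt c b satisfies S w = - sqrt c w, so positivity of
  \<open>S\<close> kills it when c > 0. When c = 0, the norm of S b is already 0. This determines
  every root on an eigenbasis.\<close>

lemma psd_sqrt_eigenvector:
  fixes S :: "real ^ 'd ^ 'd"
  assumes S: "pos_semidef S" "S ** S = A" and b: "A *v b = c *\<^sub>R b" "norm b = 1"
  shows "0 \<le> c" "S *v b = sqrt c *\<^sub>R b"
proof -
  have sym: "transpose S = S" and psd: "\<And>v. 0 \<le> v \<bullet> (S *v v)" using S by (auto simp: pos_semidef_def)
  have SS: "S *v (S *v b) = c *\<^sub>R b" using b S by (simp add: matrix_vector_mul_assoc)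
  have "(norm (S *v b))\<^sup>2 = b \<bullet> (S *v (S *v b))"
    unfolding power2_norm_eq_inner by (rule symmetric_matrix_inner[OF sym])
  also have "\<dots> = c" unfolding SS using b(2) by (simp add: dot_square_norm)
  finally have c: "c = (norm (S *v b))\<^sup>2" by simp
  then show c0: "0 \<le> c" by simp
  define w where "w = S *v b - sqrt c *\<^sub>R b"
  have Sw: "S *v w = - (sqrt c *\<^sub>R w)"
    using c0 by (simp add: w_def matrix_vector_mult_diff_distrib matrix_vector_mult_scaleR SS scaleR_diff_right)
  show "S *v b = sqrt c *\<^sub>R b"
  proof (cases "c = 0")
    case True
    then show ?thesis using c by (metis norm_eq_zero power_eq_0_iff real_sqrt_zero scaleR_zero_left)
  next
    case False
    have "0 \<le> - (sqrt c * (w \<bullet> w))" using psd[of w] by (simp add: Sw)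
    then have "w \<bullet> w \<le> 0" using False c0 by (simp add: mult_le_0_iff)
    then have "w = 0" by (metis inner_eq_zero_iff inner_ge_zero order_antisym)
    then show ?thesis by (simp add: w_def)
  qed
qed

text \<open>Gives meaning to the definite description in \<open>matrix_sqrt\<close>. Existence takes
  roots of the eigenvalues on an eigenbasis of \<open>A\<close>; uniqueness holds because any root
  acts on that basis in the same way.\<close>

theorem psd_sqrt_unique_exists:
  fixes A :: "real ^ 'd ^ 'd"
  assumes A: "pos_semidef A"
  shows "\<exists>!S. pos_semidef S \<and> S ** S = A"
proof -
  have sym: "transpose A = A" using A by (simp add: pos_semidef_def)
  obtain B where B: "finite B" "pairwise orthogonal B" "\<And>b. b \<in> B \<Longrightarrow> norm b = 1" "span B = UNIV"
    and eig: "\<And>b. b \<in> B \<Longrightarrow> \<exists>c. A *v b = c *\<^sub>R b"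
    by (rule symmetric_eigenbasis[OF sym]) (rule that; assumption)
  define c where "c b = (SOME c. A *v b = c *\<^sub>R b)" for b
  have c: "A *v b = c b *\<^sub>R b" if "b \<in> B" for b using someI_ex[OF eig[OF that]] by (simp add: c_def)
  have c0: "0 \<le> c b" if "b \<in> B" for b
    using A B(3)[OF that] c[OF that] by (auto simp: pos_semidef_def dot_square_norm dest: spec[of _ b])
  have expand: "(\<Sum>b\<in>B. (x \<bullet> b) *\<^sub>R b) = x" for x
    using B by (intro orthonormal_basis_expand) auto
  define f where "f x = (\<Sum>b\<in>B. (sqrt (c b) * (x \<bullet> b)) *\<^sub>R b)" for x
  have lin: "linear f"
    by (auto simp: f_def linear_iff inner_add_left distrib_left scaleR_add_left sum.distrib scaleR_sum_right mult_ac)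
  define S where "S = matrix f"
  have Sf: "S *v x = f x" for x using matrix_works[OF lin[folded linear_matrix_vector_mul_eq]] by (simp add: S_def)
  have fb: "f b = sqrt (c b) *\<^sub>R b" if "b \<in> B" for b
  proof -
    have "f b = (\<Sum>b'\<in>B. if b' = b then sqrt (c b) *\<^sub>R b else 0)"
      unfolding f_def using B that
      by (intro sum.cong) (auto simp: pairwise_def orthogonal_def dot_square_norm)
    then show ?thesis using that B by simp
  qed
  have adj: "f x \<bullet> y = x \<bullet> f y" for x y
    by (simp add: f_def inner_sum_left inner_sum_right inner_commute mult_ac)
  have "transpose S = S"
  proof -
    have "(transpose S *v x) \<bullet> y = (S *v x) \<bullet> y" for x y
      by (metis Sf adj dot_lmul_matrix vector_transpose_matrix transpose_transpose)
    then have "transpose S *v x = S *v x" for x by (metis vector_eq_rdot)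
    then show ?thesis by (metis matrix_eq)
  qed
  moreover have "0 \<le> v \<bullet> (S *v v)" for v
  proof -
    have "v \<bullet> (S *v v) = (\<Sum>b\<in>B. sqrt (c b) * (v \<bullet> b)\<^sup>2)"
      by (simp add: Sf f_def inner_sum_right power2_eq_square mult.assoc)
    then show ?thesis using c0 by (simp add: sum_nonneg)
  qed
  ultimately have psd: "pos_semidef S" by (simp add: pos_semidef_def)
  have eq_on_basis: "M = M'" if "\<And>b. b \<in> B \<Longrightarrow> M *v b = M' *v b" for M M' :: "real ^ 'd ^ 'd"
  proof -
    have "M *v x = M' *v x" for x
      using that by (subst (1 2) expand[of x, symmetric]) (simp add: linear_sum[OF matrix_vector_mul_linear] matrix_vector_mult_scaleR)
    then show ?thesis by (metis matrix_eq)
  qed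
  have SS: "S ** S = A"
  proof (rule eq_on_basis)
    fix b assume b: "b \<in> B"
    have "S *v b = sqrt (c b) *\<^sub>R b" using b by (simp add: Sf fb)
    then show "(S ** S) *v b = A *v b"
      using b c0[OF b] by (simp add: c matrix_vector_mult_scaleR flip: matrix_vector_mul_assoc)
  qed
  show ?thesis
  proof (rule ex1I[of _ S])
    show "pos_semidef S \<and> S ** S = A" using psd SS by simp
    fix S' assume S': "pos_semidef S' \<and> S' ** S' = A"
    show "S' = S"
    proof (rule eq_on_basis)
      fix b assume b: "b \<in> B"
      have "S' *v b = sqrt (c b) *\<^sub>R b"
        by (rule psd_sqrt_eigenvector(2)[OF _ _ c[OF b] B(3)[OF b]]) (use S' in auto)
      moreover have "S *v b = sqrt (c b) *\<^sub>R b"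
        by (rule psd_sqrt_eigenvector(2)[OF psd SS c[OF b] B(3)[OF b]])
      ultimately show "S' *v b = S *v b" by simp
    qed
  qed
qed

lemma matrix_sqrt:
  assumes "pos_semidef A"
  shows "pos_semidef (matrix_sqrt A)" "matrix_sqrt A ** matrix_sqrt A = A"
  using theI'[OF psd_sqrt_unique_exists[OF assms]] by (auto simp: matrix_sqrt_def)

section \<open>Whitening\<close>

lemma borel_measurable_matrix_vector[measurable (raw)]:
  fixes A :: "real ^ 'd ^ 'd" and f :: "'a \<Rightarrow> real ^ 'd"
  assumes "f \<in> borel_measurable M"
  shows "(\<lambda>x. A *v f x) \<in> borel_measurable M"
  by (rule borel_measurable_continuous_on[OF _ assms]) (intro linear_continuous_on linear_linear[THEN iffD2], simp)

locale design = prob_space PX for PX :: "(real ^ 'd) measure" +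
  assumes sets_PX: "sets PX = sets borel"
    and sq_int: "integrable PX (\<lambda>x. (norm x)\<^sup>2)"
    and invertible_moment: "invertible (second_moment PX)"
begin

abbreviation \<Sigma> :: "real ^ 'd ^ 'd" where "\<Sigma> \<equiv> second_moment PX"
abbreviation T :: "real ^ 'd ^ 'd" where "T \<equiv> matrix_sqrt \<Sigma>"
abbreviation R :: "real ^ 'd ^ 'd" where "R \<equiv> matrix_inv T"

lemma measurable_PX: "f \<in> borel_measurable borel \<Longrightarrow> f \<in> borel_measurable PX"
  using measurable_cong_sets[OF sets_PX refl] by blast

lemma integrable_moment: "integrable PX (\<lambda>x. (\<phi> \<bullet> x) * (\<psi> \<bullet> x))"
proof (rule Bochner_Integration.integrable_bound)
  show "integrable PX (\<lambda>x. (norm \<phi> * norm \<psi>) * (norm x)\<^sup>2)" using sq_int by simp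
  show "(\<lambda>x. (\<phi> \<bullet> x) * (\<psi> \<bullet> x)) \<in> borel_measurable PX" by (rule measurable_PX) measurable
  have "\<bar>(\<phi> \<bullet> x) * (\<psi> \<bullet> x)\<bar> \<le> (norm \<phi> * norm x) * (norm \<psi> * norm x)" for x
    unfolding abs_mult by (intro mult_mono Cauchy_Schwarz_ineq2) auto
  then show "AE x in PX. norm ((\<phi> \<bullet> x) * (\<psi> \<bullet> x)) \<le> norm ((norm \<phi> * norm \<psi>) * (norm x)\<^sup>2)"
    by (intro AE_I2) (simp add: power2_eq_square mult_ac)
qed

lemma second_moment_inner: "\<phi> \<bullet> (\<Sigma> *v \<psi>) = (\<integral>x. (\<phi> \<bullet> x) * (\<psi> \<bullet> x) \<partial>PX)"
proof -
  have i: "integrable PX (\<lambda>x. x $ i * x $ j)" for i j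
    using integrable_moment[of "axis i 1" "axis j 1"] by (simp add: inner_axis' )
  have "(\<integral>x. (\<phi> \<bullet> x) * (\<psi> \<bullet> x) \<partial>PX) = (\<integral>x. (\<Sum>i\<in>UNIV. \<Sum>j\<in>UNIV. (\<phi> $ i * \<psi> $ j) * (x $ i * x $ j)) \<partial>PX)"
    by (simp add: inner_vec_def sum_product mult_ac)
  also have "\<dots> = (\<Sum>i\<in>UNIV. \<Sum>j\<in>UNIV. (\<phi> $ i * \<psi> $ j) * (\<integral>x. x $ i * x $ j \<partial>PX))"
    using i by simp
  also have "\<dots> = \<phi> \<bullet> (\<Sigma> *v \<psi>)"
    by (simp add: inner_vec_def matrix_vector_mult_def second_moment_def sum_distrib_left mult_ac)
  finally show ?thesis by simp
qed

lemma pos_semidef_moment: "pos_semidef \<Sigma>"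
proof -
  have "transpose \<Sigma> = \<Sigma>" by (simp add: transpose_def second_moment_def mult.commute vec_eq_iff)
  moreover have "0 \<le> v \<bullet> (\<Sigma> *v v)" for v by (simp add: second_moment_inner)
  ultimately show ?thesis by (simp add: pos_semidef_def)
qed

lemma TT: "T ** T = \<Sigma>" and transpose_T: "transpose T = T"
  using matrix_sqrt[OF pos_semidef_moment] by (auto simp: pos_semidef_def)

lemma RT: "R ** T = mat 1" and TR: "T ** R = mat 1"
proof -
  have "det \<Sigma> \<noteq> 0" using invertible_moment by (simp add: invertible_det_nz)
  then have "det T \<noteq> 0" using det_mul[of T T] by (simp add: TT)
  then have "invertible T" by (simp add: invertible_det_nz)
  then have "T ** R = mat 1 \<and> R ** T = mat 1"
    unfolding invertible_def matrix_inv_def by (rule someI_ex)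
  then show "R ** T = mat 1" "T ** R = mat 1" by auto
qed

lemma RT_v [simp]: "R *v (T *v x) = x" and TR_v [simp]: "T *v (R *v x) = x"
  by (simp_all add: matrix_vector_mul_assoc RT TR)

lemma transpose_R: "transpose R = R"
proof -
  have "transpose R ** T = mat 1"
    using TR matrix_transpose_mul[of T R] by (simp add: transpose_T transpose_mat)
  then have "transpose R ** T ** R = R" by simp
  then show ?thesis by (simp add: matrix_mul_assoc[symmetric] TR)
qed

lemma R_inner: "(R *v x) \<bullet> y = x \<bullet> (R *v y)"
  by (rule symmetric_matrix_inner[OF transpose_R])

lemma T_inner: "(T *v x) \<bullet> y = x \<bullet> (T *v y)"
  by (rule symmetric_matrix_inner[OF transpose_T])

lemma moment_norm_T: "(\<integral>x. (\<phi> \<bullet> x)\<^sup>2 \<partial>PX) = (norm (T *v \<phi>))\<^sup>2"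
  using second_moment_inner[of \<phi> \<phi>]
  by (simp add: power2_eq_square power2_norm_eq_inner[unfolded power2_eq_square] T_inner matrix_vector_mul_assoc TT)

lemma nn_moment: "(\<integral>\<^sup>+x. ennreal ((\<theta> \<bullet> (R *v x))\<^sup>2) \<partial>PX) = ennreal ((norm \<theta>)\<^sup>2)"
proof -
  have "(\<integral>\<^sup>+x. ennreal (((R *v \<theta>) \<bullet> x)\<^sup>2) \<partial>PX) = ennreal (\<integral>x. ((R *v \<theta>) \<bullet> x)\<^sup>2 \<partial>PX)"
    using integrable_moment[of "R *v \<theta>" "R *v \<theta>"] by (intro nn_integral_eq_integral) (auto simp: power2_eq_square)
  then show ?thesis using moment_norm_T[of "R *v \<theta>"] by (simp add: R_inner)
qed

lemma nn_fourth_moment: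
  assumes "L2_L4_equiv PX \<kappa>" "0 < \<kappa>"
  shows "(\<integral>\<^sup>+x. ennreal ((\<theta> \<bullet> (R *v x)) ^ 4) \<partial>PX) \<le> ennreal (\<kappa> * norm \<theta> ^ 4)"
proof -
  have "(\<integral>\<^sup>+x. ennreal (((R *v \<theta>) \<bullet> x) ^ 4) \<partial>PX) \<le> ennreal \<kappa> * (\<integral>\<^sup>+x. ennreal (((R *v \<theta>) \<bullet> x)\<^sup>2) \<partial>PX)\<^sup>2"
    using assms(1) by (auto simp: L2_L4_equiv_def)
  also have "\<dots> = ennreal (\<kappa> * norm \<theta> ^ 4)"
    using nn_moment[of \<theta>] assms(2) by (simp add: R_inner ennreal_mult ennreal_power flip: power_mult)
  finally show ?thesis by (simp add: R_inner)
qed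

lemma jointD:
  assumes "P \<in> joint_distributions PX"
  shows "prob_space P" "sets P = sets borel" "distr P borel fst = PX"
    "fst \<in> borel_measurable P" "snd \<in> borel_measurable P" "space P = UNIV"
proof -
  show P: "prob_space P" "sets P = sets borel" "distr P borel fst = PX"
    using assms by (auto simp: joint_distributions_def)
  show "fst \<in> borel_measurable P" "snd \<in> borel_measurable P"
    unfolding measurable_cong_sets[OF P(2) refl]
    by (intro borel_measurable_continuous_onI continuous_intros)+
  show "space P = UNIV" using sets_eq_imp_space_eq[OF P(2)] by simp
qed

lemma nn_integral_fst_joint:
  assumes P: "P \<in> joint_distributions PX" and [measurable]: "f \<in> borel_measurable borel"
  shows "(\<integral>\<^sup>+p. f (fst p) \<partial>P) = (\<integral>\<^sup>+x. f x \<partial>PX)"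
  using jointD[OF P] by (subst jointD(3)[OF P, symmetric], subst nn_integral_distr) auto

lemma integral_fst_joint:
  fixes f :: "_ \<Rightarrow> real"
  assumes P: "P \<in> joint_distributions PX" and [measurable]: "f \<in> borel_measurable borel"
  shows "(\<integral>p. f (fst p) \<partial>P) = (\<integral>x. f x \<partial>PX)"
  using jointD[OF P] by (subst jointD(3)[OF P, symmetric], subst integral_distr) auto

lemma integrable_fst_joint:
  fixes f :: "_ \<Rightarrow> real"
  assumes P: "P \<in> joint_distributions PX" and [measurable]: "f \<in> borel_measurable borel" and "integrable PX f"
  shows "integrable P (\<lambda>p. f (fst p))"
  using assms(3) jointD[OF P] by (subst (asm) jointD(3)[OF P, symmetric], subst (asm) integrable_distr_eq) auto

text \<open>The condition is applied to the direction \<open>R *v \<theta>\<close>: there the root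
  of the second-moment matrix gives back \<theta>, and symmetry of \<open>R\<close> moves it onto
  the design vector.\<close>

lemma small_ball_sample_whitened:
  assumes P: "P \<in> joint_distributions PX" and sb: "small_ball PX C \<alpha>" and C: "1 \<le> C" and \<alpha>: "0 < \<alpha>" "\<alpha> \<le> 1"
  shows "small_ball_sample P (\<lambda>p. R *v fst p) C \<alpha>"
proof -
  interpret P: prob_space P by (rule jointD(1)[OF P])
  note [measurable] = jointD(4,5)[OF P]
  show ?thesis
  proof unfold_locales
    show "(\<lambda>p. R *v fst p) \<in> borel_measurable P" by measurable
    show "(\<integral>\<^sup>+p. ennreal ((\<theta> \<bullet> (R *v fst p))\<^sup>2) \<partial>P) = ennreal ((norm \<theta>)\<^sup>2)" for \<theta>
      by (subst nn_integral_fst_joint[OF P, of "\<lambda>x. ennreal ((\<theta> \<bullet> (R *v x))\<^sup>2)"]) (auto simp: nn_moment)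
    fix \<theta> :: "real ^ 'd" and t :: real assume \<theta>: "\<theta> \<noteq> 0" and t: "0 < t"
    have "R *v \<theta> \<noteq> 0" using \<theta> TR_v[of \<theta>] by (metis matrix_vector_mult_0_right)
    then have "measure PX {x. \<bar>(R *v \<theta>) \<bullet> x\<bar> \<le> t * norm (T *v (R *v \<theta>))} \<le> (C * t) powr \<alpha>"
      using sb t unfolding small_ball_def by blast
    moreover have "measure PX {x. \<bar>(R *v \<theta>) \<bullet> x\<bar> \<le> t * norm (T *v (R *v \<theta>))} = measure P {p \<in> space P. \<bar>\<theta> \<bullet> (R *v fst p)\<bar> \<le> t * norm \<theta>}"
      by (subst jointD(3)[OF P, symmetric], subst measure_distr) (auto simp: R_inner vimage_def Collect_conj_eq Int_commute)
    ultimately show "measure P {p \<in> space P. \<bar>\<theta> \<bullet> (R *v fst p)\<bar> \<le> t * norm \<theta>} \<le> (C * t) powr \<alpha>" by simp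
  qed (use C \<alpha> in auto)
qed

section \<open>Orthogonality of the residual and excess risk for one joint law\<close>

context
  fixes P assumes P: "P \<in> joint_distributions PX" and y2: "integrable P (\<lambda>p. (snd p)\<^sup>2)"
begin

lemma integrable_moment_joint: "integrable P (\<lambda>p. (\<phi> \<bullet> fst p) * (\<psi> \<bullet> fst p))"
  by (rule integrable_fst_joint[OF P _ integrable_moment]) measurable

lemma integral_moment_joint: "(\<integral>p. (\<phi> \<bullet> fst p) * (\<psi> \<bullet> fst p) \<partial>P) = \<phi> \<bullet> (\<Sigma> *v \<psi>)"
  unfolding second_moment_inner by (rule integral_fst_joint[OF P]) measurable

lemma integrable_norm_fst_sq: "integrable P (\<lambda>p. (norm (fst p))\<^sup>2)"
  by (rule integrable_fst_joint[OF P _ sq_int]) measurable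

lemma square_integrable_residual: "integrable P (\<lambda>p. (snd p - \<beta> \<bullet> fst p)\<^sup>2)"
proof (rule Bochner_Integration.integrable_bound)
  note [measurable] = jointD(4,5)[OF P]
  show "integrable P (\<lambda>p. 2 * (snd p)\<^sup>2 + 2 * ((\<beta> \<bullet> fst p) * (\<beta> \<bullet> fst p)))"
    using y2 integrable_moment_joint by auto
  show "(\<lambda>p. (snd p - \<beta> \<bullet> fst p)\<^sup>2) \<in> borel_measurable P" by measurable
  have "(a - b)\<^sup>2 \<le> 2 * a\<^sup>2 + 2 * (b * b)" for a b :: real
    using zero_le_power2[of "a + b"] by (simp add: power2_eq_square algebra_simps)
  then show "AE p in P. norm ((snd p - \<beta> \<bullet> fst p)\<^sup>2) \<le> norm (2 * (snd p)\<^sup>2 + 2 * ((\<beta> \<bullet> fst p) * (\<beta> \<bullet> fst p)))"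
    by (intro AE_I2) (simp add: order_trans[OF _ abs_ge_self])
qed

lemma integrable_residual_fst: "integrable P (\<lambda>p. (snd p - \<beta> \<bullet> fst p) *\<^sub>R fst p)"
proof (rule Bochner_Integration.integrable_bound)
  note [measurable] = jointD(4,5)[OF P]
  show "integrable P (\<lambda>p. (snd p - \<beta> \<bullet> fst p)\<^sup>2 + (norm (fst p))\<^sup>2)"
    using square_integrable_residual integrable_norm_fst_sq by auto
  show "(\<lambda>p. (snd p - \<beta> \<bullet> fst p) *\<^sub>R fst p) \<in> borel_measurable P" by measurable
  have "\<bar>a\<bar> * b \<le> a\<^sup>2 + b\<^sup>2" if "0 \<le> b" for a b :: real
    using sum_squares_bound[of "\<bar>a\<bar>" b] mult_nonneg_nonneg[OF abs_ge_zero[of a] that]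
    unfolding power2_abs by linarith
  then show "AE p in P. norm ((snd p - \<beta> \<bullet> fst p) *\<^sub>R fst p) \<le> norm ((snd p - \<beta> \<bullet> fst p)\<^sup>2 + (norm (fst p))\<^sup>2)"
    by (intro AE_I2) simp
qed

lemma integral_residual_fst:
  "(\<integral>p. (snd p - \<beta> \<bullet> fst p) *\<^sub>R fst p \<partial>P) = (\<integral>p. snd p *\<^sub>R fst p \<partial>P) - \<Sigma> *v \<beta>"
proof (rule vector_eq_rdot[THEN iffD1], intro allI)
  fix \<phi> :: "real ^ 'd"
  have i: "integrable P (\<lambda>p. snd p *\<^sub>R fst p)" using integrable_residual_fst[of 0] by simp
  have "(\<integral>p. (snd p - \<beta> \<bullet> fst p) *\<^sub>R fst p \<partial>P) \<bullet> \<phi> = (\<integral>p. (snd p *\<^sub>R fst p) \<bullet> \<phi> - (\<phi> \<bullet> fst p) * (\<beta> \<bullet> fst p) \<partial>P)"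
    using integrable_residual_fst by (subst integral_inner_left[symmetric]) (auto simp: inner_commute algebra_simps intro!: Bochner_Integration.integral_cong)
  also have "\<dots> = (\<integral>p. snd p *\<^sub>R fst p \<partial>P) \<bullet> \<phi> - \<phi> \<bullet> (\<Sigma> *v \<beta>)"
    by (subst Bochner_Integration.integral_diff[OF integrable_inner_left[OF i] integrable_moment_joint])
       (simp only: integral_inner_left[OF i] integral_moment_joint)
  finally show "(\<integral>p. (snd p - \<beta> \<bullet> fst p) *\<^sub>R fst p \<partial>P) \<bullet> \<phi> = ((\<integral>p. snd p *\<^sub>R fst p \<partial>P) - \<Sigma> *v \<beta>) \<bullet> \<phi>"
    by (simp add: inner_diff_left inner_diff_right inner_commute)
qed

lemma moment_inv: "matrix_inv \<Sigma> *v (\<Sigma> *v x) = x" "\<Sigma> *v (matrix_inv \<Sigma> *v x) = x"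
proof -
  have "\<Sigma> ** matrix_inv \<Sigma> = mat 1 \<and> matrix_inv \<Sigma> ** \<Sigma> = mat 1"
    using invertible_moment unfolding invertible_def matrix_inv_def by (rule someI_ex)
  then show "matrix_inv \<Sigma> *v (\<Sigma> *v x) = x" "\<Sigma> *v (matrix_inv \<Sigma> *v x) = x"
    by (auto simp: matrix_vector_mul_assoc)
qed

lemma beta_star_uncorrelated: "(\<integral>p. residual P p *\<^sub>R fst p \<partial>P) = 0"
  unfolding residual_def integral_residual_fst by (simp add: beta_star_def jointD(3)[OF P] moment_inv)

lemma beta_star_unique:
  assumes "(\<integral>p. (snd p - \<beta> \<bullet> fst p) *\<^sub>R fst p \<partial>P) = 0"
  shows "beta_star P = \<beta>"
  using assms unfolding integral_residual_fst by (simp add: beta_star_def jointD(3)[OF P] moment_inv)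

text \<open>Pythagoras: the cross term is the pairing of b - \<open>beta_star P\<close> with the
  mean of residual times design vector, which is 0.\<close>

lemma excess_risk_eq: "excess_risk P b = (norm (T *v (b - beta_star P)))\<^sup>2"
proof -
  let ?\<delta> = "b - beta_star P"
  have eq: "(snd p - b \<bullet> fst p)\<^sup>2 = (residual P p)\<^sup>2 - 2 * ((residual P p *\<^sub>R fst p) \<bullet> ?\<delta>) + (?\<delta> \<bullet> fst p) * (?\<delta> \<bullet> fst p)" for p
    by (simp add: residual_def inner_diff_left inner_diff_right inner_commute power2_eq_square algebra_simps)
  have i: "integrable P (\<lambda>p. (residual P p)\<^sup>2)" "integrable P (\<lambda>p. residual P p *\<^sub>R fst p)"
    unfolding residual_def using square_integrable_residual integrable_residual_fst by auto
  have "risk P b = (\<integral>p. (residual P p)\<^sup>2 \<partial>P) - 2 * ((\<integral>p. residual P p *\<^sub>R fst p \<partial>P) \<bullet> ?\<delta>) + ?\<delta> \<bullet> (\<Sigma> *v ?\<delta>)"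
  proof -
    have iB: "integrable P (\<lambda>p. 2 * ((residual P p *\<^sub>R fst p) \<bullet> ?\<delta>))"
      by (intro integrable_mult_right integrable_inner_left i)
    have B: "(\<integral>p. 2 * ((residual P p *\<^sub>R fst p) \<bullet> ?\<delta>) \<partial>P) = 2 * ((\<integral>p. residual P p *\<^sub>R fst p \<partial>P) \<bullet> ?\<delta>)"
      by (simp only: integral_mult_right_zero integral_inner_left[OF i(2)])
    show ?thesis
      unfolding risk_def eq
        Bochner_Integration.integral_add[OF Bochner_Integration.integrable_diff[OF i(1) iB] integrable_moment_joint]
        Bochner_Integration.integral_diff[OF i(1) iB] B integral_moment_joint ..
  qed
  then have "risk P b = risk P (beta_star P) + ?\<delta> \<bullet> (\<Sigma> *v ?\<delta>)"
    unfolding beta_star_uncorrelated by (simp add: risk_def residual_def)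
  moreover have "?\<delta> \<bullet> (\<Sigma> *v ?\<delta>) = (norm (T *v ?\<delta>))\<^sup>2"
    by (simp add: power2_norm_eq_inner T_inner matrix_vector_mul_assoc TT)
  ultimately show ?thesis by (simp add: excess_risk_def)
qed

end

end

section \<open>The least-squares estimator\<close>

text \<open>Sums instead of averages, since the common factor 1 / n cancels in the normal
  equations.\<close>

definition gram :: "nat \<Rightarrow> (nat \<Rightarrow> (real ^ 'd) \<times> real) \<Rightarrow> real ^ 'd ^ 'd" where
  "gram n z = (\<chi> i j. \<Sum>k<n. fst (z k) $ i * fst (z k) $ j)"

definition cross_moment :: "nat \<Rightarrow> (nat \<Rightarrow> (real ^ 'd) \<times> real) \<Rightarrow> real ^ 'd" where
  "cross_moment n z = (\<chi> i. \<Sum>k<n. snd (z k) * fst (z k) $ i)"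

lemma gram_mult: "gram n z *v b = (\<Sum>k<n. (b \<bullet> fst (z k)) *\<^sub>R fst (z k))"
proof (rule vec_eq_iff[THEN iffD2], intro allI)
  fix i
  have "(gram n z *v b) $ i = (\<Sum>j\<in>UNIV. \<Sum>k<n. fst (z k) $ i * fst (z k) $ j * b $ j)"
    by (simp add: gram_def matrix_vector_mult_def sum_distrib_right)
  also have "\<dots> = (\<Sum>k<n. \<Sum>j\<in>UNIV. fst (z k) $ i * fst (z k) $ j * b $ j)" by (rule sum.swap)
  also have "\<dots> = (\<Sum>k<n. (b \<bullet> fst (z k)) *\<^sub>R fst (z k)) $ i"
    by (simp add: inner_vec_def sum_distrib_right sum_distrib_left mult_ac)
  finally show "(gram n z *v b) $ i = (\<Sum>k<n. (b \<bullet> fst (z k)) *\<^sub>R fst (z k)) $ i" .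
qed

lemma cross_moment_eq: "cross_moment n z = (\<Sum>k<n. snd (z k) *\<^sub>R fst (z k))"
  by (simp add: cross_moment_def vec_eq_iff)

lemma is_least_squares_iff: "is_least_squares n z b \<longleftrightarrow> gram n z *v b = cross_moment n z"
proof -
  let ?f = "\<lambda>b. \<Sum>i<n. (snd (z i) - b \<bullet> fst (z i))\<^sup>2"
  define g where "g = cross_moment n z - gram n z *v b"
  have expand: "?f (b + \<delta>) = ?f b - 2 * (\<delta> \<bullet> g) + (\<Sum>i<n. (\<delta> \<bullet> fst (z i))\<^sup>2)" for \<delta>
  proof -
    have "(snd (z i) - (b + \<delta>) \<bullet> fst (z i))\<^sup>2 = (snd (z i) - b \<bullet> fst (z i))\<^sup>2
        - 2 * (snd (z i) * (\<delta> \<bullet> fst (z i)) - (b \<bullet> fst (z i)) * (\<delta> \<bullet> fst (z i))) + (\<delta> \<bullet> fst (z i))\<^sup>2" for i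
      by (simp add: inner_add_left power2_eq_square algebra_simps)
    moreover have "\<delta> \<bullet> g = (\<Sum>i<n. snd (z i) * (\<delta> \<bullet> fst (z i)) - (b \<bullet> fst (z i)) * (\<delta> \<bullet> fst (z i)))"
      by (simp add: g_def gram_mult cross_moment_eq inner_diff_right inner_sum_right sum_subtractf)
    ultimately show ?thesis by (simp add: sum.distrib sum_subtractf sum_distrib_left)
  qed
  show ?thesis
  proof
    assume "gram n z *v b = cross_moment n z"
    then have "g = 0" by (simp add: g_def)
    then have "?f b \<le> ?f c" for c
      using expand[of "c - b"] sum_nonneg[of "{..<n}" "\<lambda>i. ((c - b) \<bullet> fst (z i))\<^sup>2"] by simp
    then show "is_least_squares n z b" by (auto simp: is_least_squares_def is_arg_min_def not_less)
  next
    assume ls: "is_least_squares n z b"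
    have min: "?f b \<le> ?f (b + \<delta>)" for \<delta>
      using ls by (auto simp: is_least_squares_def is_arg_min_def not_less)
    define q where "q = (\<Sum>i<n. (g \<bullet> fst (z i))\<^sup>2)"
    \<comment> \<open>A step along the gradient direction whose length makes the change of the
      objective equal to \<open>- t\<^sup>2 * (q + 2)\<close>. The summand 1 keeps the denominator
      positive even if the form vanishes in direction \<open>g\<close>.\<close>
    define t where "t = (g \<bullet> g) / (q + 1)"
    have q0: "0 \<le> q" by (simp add: q_def sum_nonneg)
    have gg: "g \<bullet> g = t * (q + 1)" using q0 by (simp add: t_def)
    have "(\<Sum>i<n. ((t *\<^sub>R g) \<bullet> fst (z i))\<^sup>2) = t\<^sup>2 * q"
      by (simp add: q_def power_mult_distrib sum_distrib_left)
    then have "0 \<le> - 2 * (t * (g \<bullet> g)) + t\<^sup>2 * q"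
      using min[of "t *\<^sub>R g"] expand[of "t *\<^sub>R g"] by simp
    also have "\<dots> = - (t\<^sup>2 * (q + 2))" unfolding gg by (simp add: power2_eq_square algebra_simps)
    finally have "t\<^sup>2 * (q + 2) \<le> 0" by simp
    then have "t = 0" using q0 by (simp add: mult_le_0_iff)
    then have "g \<bullet> g = 0" using gg by simp
    then show "gram n z *v b = cross_moment n z" by (simp add: g_def)
  qed
qed

text \<open>Cramer's rule turns the definite description into a rational function of the data, from
  which measurability follows. If the determinant is 0, a kernel vector added to a minimizer gives a
  second one, so the default value 0 applies.\<close>

lemma ols_estimator_eq:
  "ols_estimator n z = (if det (gram n z) \<noteq> 0
     then (\<chi> k. det (\<chi> i j. if j = k then cross_moment n z $ i else gram n z $ i $ j) / det (gram n z)) else 0)"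
proof (cases "det (gram n z) = 0")
  case False
  let ?b = "\<chi> k. det (\<chi> i j. if j = k then cross_moment n z $ i else gram n z $ i $ j) / det (gram n z)"
  have "is_least_squares n z b \<longleftrightarrow> b = ?b" for b
    unfolding is_least_squares_iff by (rule cramer[OF False])
  then have "\<exists>!b. is_least_squares n z b" "(THE b. is_least_squares n z b) = ?b" by auto
  then show ?thesis unfolding ols_estimator_def using False by (simp only: if_True not_False_eq_True)
next
  case True
  have "\<not> (\<exists>B. B ** gram n z = mat 1)"
    using True invertible_det_nz[of "gram n z"] by (simp add: invertible_left_inverse)
  then obtain v where v: "gram n z *v v = 0" "v \<noteq> 0" by (auto simp: matrix_left_invertible_ker)
  have "\<not> (\<exists>!b. is_least_squares n z b)"
  proof
    assume "\<exists>!b. is_least_squares n z b"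
    then obtain b where b: "is_least_squares n z b" "\<And>c. is_least_squares n z c \<Longrightarrow> c = b" by blast
    have "is_least_squares n z (b + v)"
      using b(1) v by (simp add: is_least_squares_iff matrix_vector_right_distrib)
    then show False using b(2) v by fastforce
  qed
  then show ?thesis using True by (simp add: ols_estimator_def)
qed

lemma ols_estimator_normal_equations:
  assumes "\<And>\<theta>. \<theta> \<noteq> 0 \<Longrightarrow> 0 < (\<Sum>k<n. (\<theta> \<bullet> fst (z k))\<^sup>2)"
  shows "gram n z *v ols_estimator n z = cross_moment n z"
proof -
  have "v = 0" if "gram n z *v v = 0" for v
  proof (rule ccontr)
    assume "v \<noteq> 0"
    have "(\<Sum>k<n. (v \<bullet> fst (z k))\<^sup>2) = v \<bullet> (gram n z *v v)"
      by (simp add: gram_mult inner_sum_right power2_eq_square)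
    then show False using assms[OF \<open>v \<noteq> 0\<close>] that by simp
  qed
  then have "det (gram n z) \<noteq> 0"
    using invertible_det_nz[of "gram n z"] by (simp add: invertible_left_inverse matrix_left_invertible_ker)
  then show ?thesis
    using cramer[of "gram n z" "ols_estimator n z" "cross_moment n z"] by (simp add: ols_estimator_eq)
qed

lemma borel_measurable_det:
  assumes "\<And>i j. (\<lambda>x. A x $ i $ j) \<in> borel_measurable M"
  shows "(\<lambda>x. det (A x :: real ^ 'd ^ 'd)) \<in> borel_measurable M"
  unfolding det_def
  by (intro borel_measurable_sum borel_measurable_times borel_measurable_const borel_measurable_prod assms)

lemma borel_measurable_vec_lambda:
  assumes "\<And>k. (\<lambda>x. f x k) \<in> borel_measurable M"
  shows "(\<lambda>x. \<chi> k. f x k :: real ^ 'd) \<in> borel_measurable M"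
  by (rule borel_measurable_euclidean_space[THEN iffD2]) (auto simp: Basis_vec_def inner_axis assms)

lemma ols_estimator_estimators: "(ols_estimator n :: _ \<Rightarrow> real ^ 'd) \<in> estimators n"
proof -
  let ?M = "\<Pi>\<^sub>M i\<in>{..<n}. (borel :: ((real ^ 'd) \<times> real) measure)"
  have X: "(\<lambda>z. fst (z k) $ i) \<in> borel_measurable ?M" and Y: "(\<lambda>z. snd (z k)) \<in> borel_measurable ?M" if "k < n" for k i
  proof -
    have "(\<lambda>p :: (real ^ 'd) \<times> real. fst p $ i) \<in> borel_measurable borel" "(snd :: (real ^ 'd) \<times> real \<Rightarrow> real) \<in> borel_measurable borel"
      by (intro borel_measurable_continuous_onI continuous_intros)+
    from measurable_compose[OF _ this(1), of "\<lambda>z. z k" ?M] measurable_compose[OF _ this(2), of "\<lambda>z. z k" ?M]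
    show "(\<lambda>z. fst (z k) $ i) \<in> borel_measurable ?M" "(\<lambda>z. snd (z k)) \<in> borel_measurable ?M" using that by auto
  qed
  have G: "(\<lambda>z. gram n z $ i $ j) \<in> borel_measurable ?M" for i j
    unfolding gram_def by (simp, intro borel_measurable_sum borel_measurable_times X) auto
  have H: "(\<lambda>z. cross_moment n z $ i) \<in> borel_measurable ?M" for i
    unfolding cross_moment_def by (simp, intro borel_measurable_sum borel_measurable_times X Y) auto
  have dG[measurable]: "(\<lambda>z. det (gram n z)) \<in> borel_measurable ?M" by (intro borel_measurable_det G)
  have "(\<lambda>z. det (\<chi> i j. if j = k then cross_moment n z $ i else gram n z $ i $ j)) \<in> borel_measurable ?M" for k
    by (intro borel_measurable_det) (use G H in auto)
  then have [measurable]: "(\<lambda>z. \<chi> k. det (\<chi> i j. if j = k then cross_moment n z $ i else gram n z $ i $ j) / det (gram n z)) \<in> borel_measurable ?M"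
    by (intro borel_measurable_vec_lambda borel_measurable_divide dG)
  show ?thesis unfolding estimators_def ols_estimator_eq by measurable
qed

section \<open>Risk bounds for least squares\<close>

context design
begin

lemma cond_exp_X_intg:
  assumes P: "P \<in> joint_distributions PX" and f[measurable]: "f \<in> borel_measurable P"
    and g: "g \<in> borel_measurable (vimage_algebra (space P) fst borel)"
  shows "(\<integral>\<^sup>+p. g p * cond_exp_X P f p \<partial>P) = (\<integral>\<^sup>+p. g p * ennreal (f p) \<partial>P)"
proof -
  have "sets (vimage_algebra (space P) fst borel) = {fst -` A \<inter> space P | A. A \<in> sets borel}"
    by (rule sets_vimage_algebra2) simp
  also have "\<dots> \<subseteq> sets P" using measurable_sets[OF jointD(4)[OF P]] by blast
  finally have "subalgebra P (vimage_algebra (space P) fst borel)"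
    by (simp add: subalgebra_def)
  then interpret finite_measure_subalgebra P "vimage_algebra (space P) fst borel"
    by (intro finite_measure_subalgebra.intro finite_measure_subalgebra_axioms.intro prob_space.axioms(1)[OF jointD(1)[OF P]])
  show ?thesis unfolding cond_exp_X_def by (rule nn_cond_exp_intg[OF g]) measurable
qed

lemma measurable_fst_subalgebra:
  "g \<in> borel_measurable borel \<Longrightarrow> (\<lambda>p. g (fst p)) \<in> borel_measurable (vimage_algebra (space P) fst borel)"
  by (rule measurable_compose[OF measurable_vimage_algebra1]) auto

lemma measurable_cond_exp_X:
  "cond_exp_X P f \<in> borel_measurable (vimage_algebra (space P) fst borel)" "cond_exp_X P f \<in> borel_measurable P"
  by (simp_all add: cond_exp_X_def)

lemma whitened_norm_eq: "P \<in> joint_distributions PX \<Longrightarrow> whitened_norm P p = norm (R *v fst p)"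
  by (simp add: whitened_norm_def jointD(3))

lemma measurable_residual: "P \<in> joint_distributions PX \<Longrightarrow> residual P \<in> borel_measurable P"
  unfolding residual_def using jointD(4,5)[of P] by measurable

lemma ols_sample_whitened:
  assumes P: "P \<in> joint_distributions PX" and y2: "integrable P (\<lambda>p. (snd p)\<^sup>2)"
    and sb: "small_ball PX C \<alpha>" and C: "1 \<le> C" and \<alpha>: "0 < \<alpha>" "\<alpha> \<le> 1"
    and \<kappa>: "0 < \<kappa>" and L24: "L2_L4_equiv PX \<kappa>"
    and W: "0 \<le> W" "(\<integral>\<^sup>+p. (cond_exp_X P (\<lambda>q. (residual P q)\<^sup>2) p)\<^sup>2 * ennreal (norm (R *v fst p) ^ 4) \<partial>P) \<le> ennreal (W\<^sup>2)"
  shows "ols_sample P (\<lambda>p. R *v fst p) C \<alpha> (residual P) (cond_exp_X P (\<lambda>q. (residual P q)\<^sup>2)) \<kappa> W"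
proof -
  interpret S: small_ball_sample P "\<lambda>p. R *v fst p" C \<alpha>
    by (rule small_ball_sample_whitened[OF P sb C \<alpha>])
  note [measurable] = measurable_residual[OF P]
  show ?thesis
  proof unfold_locales
    fix g :: "real ^ 'd \<Rightarrow> ennreal" assume [measurable]: "g \<in> borel_measurable borel"
    show "(\<integral>\<^sup>+p. g (R *v fst p) * ennreal ((residual P p)\<^sup>2) \<partial>P) = (\<integral>\<^sup>+p. g (R *v fst p) * cond_exp_X P (\<lambda>q. (residual P q)\<^sup>2) p \<partial>P)"
    proof (rule cond_exp_X_intg[OF P, symmetric])
      show "(\<lambda>p. (residual P p)\<^sup>2) \<in> borel_measurable P" by measurable
      show "(\<lambda>p. g (R *v fst p)) \<in> borel_measurable (vimage_algebra (space P) fst borel)"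
        by (rule measurable_fst_subalgebra[of "\<lambda>x. g (R *v x)"]) measurable
    qed
  next
    show "(\<integral>\<^sup>+p. ennreal ((\<theta> \<bullet> (R *v fst p)) ^ 4) \<partial>P) \<le> ennreal (\<kappa> * norm \<theta> ^ 4)" for \<theta>
      using nn_fourth_moment[OF L24 \<kappa>, of \<theta>]
      by (subst nn_integral_fst_joint[OF P, of "\<lambda>x. ennreal ((\<theta> \<bullet> (R *v x)) ^ 4)"]) auto
  next
    have i: "integrable P (\<lambda>p. residual P p *\<^sub>R fst p)"
      unfolding residual_def by (rule integrable_residual_fst[OF P y2])
    have "(\<integral>p. residual P p *\<^sub>R (R *v fst p) \<partial>P) = (\<integral>p. R *v (residual P p *\<^sub>R fst p) \<partial>P)"
      by (simp add: matrix_vector_mult_scaleR)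
    also have "\<dots> = R *v (\<integral>p. residual P p *\<^sub>R fst p \<partial>P)"
      by (rule integral_bounded_linear[OF _ i]) (simp add: linear_linear)
    finally show "(\<integral>p. residual P p *\<^sub>R (R *v fst p) \<partial>P) = 0"
      by (simp add: beta_star_uncorrelated[OF P y2])
  qed (use \<kappa> W in \<open>auto simp: measurable_cond_exp_X measurable_residual[OF P]\<close>)
qed

lemma expected_excess_risk_ols_le:
  assumes P: "P \<in> joint_distributions PX" and y2: "integrable P (\<lambda>p. (snd p)\<^sup>2)"
    and sb: "small_ball PX C \<alpha>" and C: "1 \<le> C" and \<alpha>: "0 < \<alpha>" "\<alpha> \<le> 1"
    and \<kappa>: "0 < \<kappa>" and L24: "L2_L4_equiv PX \<kappa>"
    and n: "real n \<ge> max 96 (6 * real CARD('d)) / \<alpha>"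
    and C': "C' = 3 * C ^ 4 * exp (1 + 9 / \<alpha>)"
    and chi: "chi_moment P < \<infinity>"
  shows "expected_excess_risk n P (ols_estimator n)
      \<le> ennreal (1 / real n) * (\<integral>\<^sup>+p. ennreal ((residual P p)\<^sup>2 * (whitened_norm P p)\<^sup>2) \<partial>P)
         + ennreal (276 * C'\<^sup>2 * sqrt (\<kappa> * enn2real (chi_moment P)) * (real CARD('d) / real n) powr (3 / 2))"
proof -
  let ?s = "cond_exp_X P (\<lambda>q. (residual P q)\<^sup>2)"
  let ?J = "\<integral>\<^sup>+p. (?s p)\<^sup>2 * ennreal (norm (R *v fst p) ^ 4) \<partial>P"
  define d where "d = real CARD('d)"
  define x where "x = enn2real (chi_moment P)"
  \<comment> \<open>With this choice \<open>W\<^sup>2\<close> is the numerator of \<chi>, and sqrt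
    (\<kappa> d) W / n^(3/2) becomes sqrt (\<kappa> \<chi>) (d / n)^(3/2).\<close>
  define W where "W = d * sqrt x"
  have d1: "1 \<le> d" by (simp add: d_def Suc_le_eq)
  have x0: "0 \<le> x" by (simp add: x_def)
  have chiJ: "chi_moment P = ?J / ennreal (d\<^sup>2)" by (simp add: chi_moment_def whitened_norm_eq[OF P] d_def)
  have "?J = chi_moment P * ennreal (d\<^sup>2)"
    unfolding chiJ using d1 by (simp add: ennreal_divide_times ennreal_divide_self)
  also have "chi_moment P = ennreal x" using chi by (simp add: x_def less_top)
  also have "ennreal x * ennreal (d\<^sup>2) = ennreal (W\<^sup>2)"
    using x0 by (simp add: W_def power_mult_distrib mult.commute flip: ennreal_mult)
  finally have J: "?J \<le> ennreal (W\<^sup>2)" by simp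
  have W0: "0 \<le> W" using d1 x0 by (simp add: W_def)
  interpret O: ols_sample P "\<lambda>p. R *v fst p" C \<alpha> "residual P" ?s \<kappa> W
    by (rule ols_sample_whitened[OF P y2 sb C \<alpha> \<kappa> L24 W0 J])
  have n': "96 \<le> \<alpha> * n" "real DIM(real ^ 'd) \<le> \<alpha> * n / 6"
  proof -
    have "max 96 (6 * d) \<le> n * \<alpha>" using n \<alpha> by (simp add: pos_divide_le_eq d_def)
    then show "96 \<le> \<alpha> * n" "real DIM(real ^ 'd) \<le> \<alpha> * n / 6" by (auto simp: mult.commute d_def)
  qed
  have n0: "0 < n" using n' \<alpha> by (cases n) auto
  \<comment> \<open>The whitened error: its squared norm is the excess risk, and conjugating the
    normal equations by \<open>R\<close> gives the equation A e = v.\<close>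
  define e where "e z = T *v (ols_estimator n z - beta_star P)" for z
  have normal: "AE z in O.sample n. O.ols_A n z (e z) = O.ols_v n z"
    using O.AE_sample_nondegenerate[OF n']
  proof eventually_elim
    case (elim z)
    have nd: "0 < (\<Sum>k<n. (\<phi> \<bullet> fst (z k))\<^sup>2)" if "\<phi> \<noteq> 0" for \<phi>
    proof -
      have "T *v \<phi> \<noteq> 0" using that RT_v[of \<phi>] by (metis matrix_vector_mult_0_right)
      then have "0 < (\<Sum>k<n. ((T *v \<phi>) \<bullet> (R *v fst (z k)))\<^sup>2)" using elim by blast
      then show ?thesis by (simp add: T_inner)
    qed
    have ne: "gram n z *v ols_estimator n z = cross_moment n z"
      using nd by (rule ols_estimator_normal_equations)
    let ?b = "ols_estimator n z - beta_star P"
    have "(\<Sum>k<n. (?b \<bullet> fst (z k)) *\<^sub>R fst (z k)) = (\<Sum>k<n. residual P (z k) *\<^sub>R fst (z k))"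
      using ne by (simp add: gram_mult cross_moment_eq residual_def inner_diff_left scaleR_diff_left sum_subtractf)
    then have "R *v (\<Sum>k<n. (?b \<bullet> fst (z k)) *\<^sub>R fst (z k)) = R *v (\<Sum>k<n. residual P (z k) *\<^sub>R fst (z k))" by simp
    then have "(\<Sum>k<n. (?b \<bullet> fst (z k)) *\<^sub>R (R *v fst (z k))) = (\<Sum>k<n. residual P (z k) *\<^sub>R (R *v fst (z k)))"
      by (simp add: linear_sum[OF matrix_vector_mul_linear] matrix_vector_mult_scaleR)
    moreover have "(R *v x) \<bullet> e z = ?b \<bullet> x" for x
      by (simp add: e_def R_inner inner_commute)
    ultimately show ?case by (simp add: O.ols_A_def O.ols_v_def)
  qed
  have "expected_excess_risk n P (ols_estimator n) = (\<integral>\<^sup>+z. ennreal ((norm (e z))\<^sup>2) \<partial>O.sample n)"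
    by (simp add: expected_excess_risk_def excess_risk_eq[OF P y2] e_def)
  also have "\<dots> \<le> ennreal (O.V / n + 63 * C'\<^sup>2 * (sqrt (\<kappa> * DIM(real ^ 'd)) * W / (n * sqrt n)))"
    unfolding C' by (rule O.ols_error_bound[OF n' normal])
  also have "\<dots> \<le> ennreal (O.V / n + 276 * C'\<^sup>2 * sqrt (\<kappa> * x) * (d / n) powr (3 / 2))"
  proof (intro ennreal_leI add_left_mono)
    have "(d / n) powr (3 / 2) = d * sqrt d / (n * sqrt n)"
      using d1 n0 powr_add[of "d / n" 1 "1 / 2"] by (simp add: powr_half_sqrt real_sqrt_divide)
    then have "63 * C'\<^sup>2 * (sqrt (\<kappa> * DIM(real ^ 'd)) * W / (n * sqrt n)) = 63 * (C'\<^sup>2 * (sqrt (\<kappa> * x) * (d / n) powr (3 / 2)))"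
      by (simp add: W_def real_sqrt_mult mult_ac flip: d_def)
    \<comment> \<open>The expansion yields the constant 63, relaxed here to the stated 276.\<close>
    also have "\<dots> \<le> 276 * (C'\<^sup>2 * (sqrt (\<kappa> * x) * (d / n) powr (3 / 2)))"
      using \<kappa> x0 by (intro mult_right_mono) auto
    finally show "63 * C'\<^sup>2 * (sqrt (\<kappa> * DIM(real ^ 'd)) * W / (n * sqrt n)) \<le> 276 * C'\<^sup>2 * sqrt (\<kappa> * x) * (d / n) powr (3 / 2)"
      by (simp add: mult_ac)
  qed
  also have "\<dots> = ennreal (1 / n) * ennreal O.V + ennreal (276 * C'\<^sup>2 * sqrt (\<kappa> * x) * (d / n) powr (3 / 2))"
    using O.V_nonneg \<kappa> x0 by (subst ennreal_plus) (auto simp flip: ennreal_mult)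
  finally show ?thesis by (simp add: O.V_eq[symmetric] whitened_norm_eq[OF P] x_def d_def)
qed

text \<open>The square of a sum of d squared coordinates is at most d times the sum of their fourth
  powers, and each coordinate has fourth moment at most \<kappa>.\<close>

lemma nn_norm_fourth_moment:
  assumes L24: "L2_L4_equiv PX \<kappa>" and \<kappa>: "0 < \<kappa>"
  shows "(\<integral>\<^sup>+x. ennreal (norm (R *v x) ^ 4) \<partial>PX) \<le> ennreal (\<kappa> * (real CARD('d))\<^sup>2)"
proof -
  have le: "norm v ^ 4 \<le> real CARD('d) * (\<Sum>b\<in>Basis. (b \<bullet> v) ^ 4)" for v :: "real ^ 'd"
  proof -
    have "norm v ^ 4 = (\<Sum>b\<in>Basis. (v \<bullet> b)\<^sup>2)\<^sup>2"
      unfolding norm_squared_eq_sum_Basis[symmetric] by (simp flip: power_mult)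
    also have "\<dots> \<le> real (card (Basis :: (real ^ 'd) set)) * (\<Sum>b\<in>Basis. ((v \<bullet> b)\<^sup>2)\<^sup>2)"
      using sum_squared_le_sum_of_squares[of "\<lambda>b. (v \<bullet> b)\<^sup>2" "Basis :: (real ^ 'd) set"] by (simp add: mult.commute)
    finally show ?thesis by (simp add: inner_commute flip: power_mult)
  qed
  note m = measurable_PX
  have "(\<integral>\<^sup>+x. ennreal (norm (R *v x) ^ 4) \<partial>PX) \<le> (\<integral>\<^sup>+x. ennreal (real CARD('d)) * (\<Sum>b\<in>Basis. ennreal ((b \<bullet> (R *v x)) ^ 4)) \<partial>PX)"
  proof (rule nn_integral_mono)
    fix x
    have "ennreal (norm (R *v x) ^ 4) \<le> ennreal (real CARD('d) * (\<Sum>b\<in>Basis. (b \<bullet> (R *v x)) ^ 4))" by (rule ennreal_leI[OF le])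
    also have "\<dots> = ennreal (real CARD('d)) * (\<Sum>b\<in>Basis. ennreal ((b \<bullet> (R *v x)) ^ 4))"
      by (subst ennreal_mult) (auto simp: sum_ennreal intro!: sum_nonneg)
    finally show "ennreal (norm (R *v x) ^ 4) \<le> ennreal (real CARD('d)) * (\<Sum>b\<in>Basis. ennreal ((b \<bullet> (R *v x)) ^ 4))" .
  qed
  also have "\<dots> = ennreal (real CARD('d)) * (\<Sum>b\<in>Basis. \<integral>\<^sup>+x. ennreal ((b \<bullet> (R *v x)) ^ 4) \<partial>PX)"
    by (subst nn_integral_cmult, rule m, measurable, subst nn_integral_sum, rule m, measurable)
  also have "\<dots> \<le> ennreal (real CARD('d)) * (\<Sum>b\<in>(Basis :: (real ^ 'd) set). ennreal (\<kappa> * norm b ^ 4))"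
    by (intro mult_left_mono sum_mono nn_fourth_moment[OF L24 \<kappa>]) auto
  also have "\<dots> = ennreal (real CARD('d)) * (\<Sum>b\<in>(Basis :: (real ^ 'd) set). ennreal \<kappa>)"
    by (intro arg_cong2[where f="(*)"] sum.cong) auto
  also have "\<dots> = ennreal (\<kappa> * (real CARD('d))\<^sup>2)"
    using \<kappa> by (simp add: ennreal_of_nat_eq_real_of_nat power2_eq_square mult_ac flip: ennreal_mult)
  finally show ?thesis .
qed

text \<open>Conditional Jensen: truncating \<open>s\<close> makes the term subtracted below finite.\<close>

lemma cond_exp_square_le:
  assumes P: "P \<in> joint_distributions PX" and y2: "integrable P (\<lambda>p. (snd p)\<^sup>2)"
    and L24: "L2_L4_equiv PX \<kappa>" and \<kappa>: "0 < \<kappa>"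
  shows "(\<integral>\<^sup>+p. (cond_exp_X P (\<lambda>q. (residual P q)\<^sup>2) p)\<^sup>2 * ennreal (norm (R *v fst p) ^ 4) \<partial>P)
       \<le> (\<integral>\<^sup>+p. ennreal (residual P p ^ 4 * norm (R *v fst p) ^ 4) \<partial>P)" (is "_ \<le> ?J")
proof -
  let ?F = "vimage_algebra (space P) fst borel"
  define s where "s = cond_exp_X P (\<lambda>q. (residual P q)\<^sup>2)"
  define Wt where "Wt p = ennreal (norm (R *v fst p) ^ 4)" for p :: "(real ^ 'd) \<times> real"
  \<comment> \<open>The truncation is set to 0 where \<open>s\<close> is infinite. The sequence is
    then eventually constant at every point, and its limit agrees with \<open>s\<close> almost
    everywhere because \<open>s\<close> is integrable.\<close>
  define a where "a i p = (if s p = top then 0 else min (s p) (of_nat i))" for i :: nat and p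
  note [measurable] = jointD(4,5)[OF P] measurable_residual[OF P]
  have sF[measurable]: "s \<in> borel_measurable ?F" and sP[measurable]: "s \<in> borel_measurable P"
    unfolding s_def by (rule measurable_cond_exp_X)+
  have WF[measurable]: "Wt \<in> borel_measurable ?F" unfolding Wt_def
    by (rule measurable_fst_subalgebra[of "\<lambda>x. ennreal (norm (R *v x) ^ 4)"]) measurable
  have WP[measurable]: "Wt \<in> borel_measurable P" unfolding Wt_def by measurable
  have aF[measurable]: "a i \<in> borel_measurable ?F" and aP[measurable]: "a i \<in> borel_measurable P" for i
    unfolding a_def by measurable
  have as: "a i p \<le> s p" "a i p \<le> of_nat i" for i p by (auto simp: a_def)
  have fin: "AE p in P. s p \<noteq> \<infinity>"
  proof (rule nn_integral_PInf_AE[OF sP])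
    have "(\<integral>\<^sup>+p. s p \<partial>P) = (\<integral>\<^sup>+p. ennreal ((residual P p)\<^sup>2) \<partial>P)"
      using cond_exp_X_intg[OF P, of "\<lambda>q. (residual P q)\<^sup>2" "\<lambda>_. 1"] by (simp add: s_def)
    also have "\<dots> < \<infinity>"
      using square_integrable_residual[OF P y2, of "beta_star P"]
      by (simp add: residual_def nn_integral_eq_integral)
    finally show "(\<integral>\<^sup>+p. s p \<partial>P) \<noteq> \<infinity>" by simp
  qed
  have step: "(\<integral>\<^sup>+p. (a i p)\<^sup>2 * Wt p \<partial>P) \<le> ?J" for i
  proof -
    let ?K = "\<integral>\<^sup>+p. (a i p)\<^sup>2 * Wt p \<partial>P"
    have "?K \<le> (\<integral>\<^sup>+p. ennreal ((real i)\<^sup>2) * Wt p \<partial>P)"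
    proof (intro nn_integral_mono mult_right_mono)
      show "(a i p)\<^sup>2 \<le> ennreal ((real i)\<^sup>2)" for p
        using power_mono_ennreal[OF as(2)[of i p], of 2] by (simp add: ennreal_of_nat_eq_real_of_nat ennreal_power)
    qed simp
    also have "\<dots> = ennreal ((real i)\<^sup>2) * (\<integral>\<^sup>+p. Wt p \<partial>P)" by (rule nn_integral_cmult) measurable
    also have "(\<integral>\<^sup>+p. Wt p \<partial>P) = (\<integral>\<^sup>+x. ennreal (norm (R *v x) ^ 4) \<partial>PX)"
      unfolding Wt_def by (rule nn_integral_fst_joint[OF P]) measurable
    also have "ennreal ((real i)\<^sup>2) * \<dots> < \<infinity>"
      using nn_norm_fourth_moment[OF L24 \<kappa>] by (auto simp: ennreal_mult_less_top le_less_trans)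
    finally have Kfin: "?K \<noteq> \<infinity>" by simp
    \<comment> \<open>From a \<le> s and the defining property of \<open>s\<close>, twice K is at
      most the integral of 2 a \<epsilon>^2 times the weight. Then 2 a \<epsilon>^2 \<le>
      \<epsilon>^4 + a^2 bounds it by J + K, and the finite K cancels.\<close>
    have "?K + ?K \<le> (\<integral>\<^sup>+p. 2 * ((a i p * Wt p) * s p) \<partial>P)"
    proof -
      have "?K + ?K = (\<integral>\<^sup>+p. (a i p)\<^sup>2 * Wt p + (a i p)\<^sup>2 * Wt p \<partial>P)" by (rule nn_integral_add[symmetric]) measurable
      also have "\<dots> \<le> (\<integral>\<^sup>+p. 2 * ((a i p * Wt p) * s p) \<partial>P)"
      proof (rule nn_integral_mono)
        fix p
        have "(a i p)\<^sup>2 * Wt p \<le> (a i p * Wt p) * s p"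
          using mult_left_mono[OF as(1)[of i p], of "a i p * Wt p"] by (simp add: power2_eq_square mult_ac)
        then show "(a i p)\<^sup>2 * Wt p + (a i p)\<^sup>2 * Wt p \<le> 2 * ((a i p * Wt p) * s p)"
          using add_mono by (simp only: mult_2)
      qed
      finally show ?thesis .
    qed
    also have "\<dots> = 2 * (\<integral>\<^sup>+p. (a i p * Wt p) * s p \<partial>P)" by (rule nn_integral_cmult) measurable
    also have "(\<integral>\<^sup>+p. (a i p * Wt p) * s p \<partial>P) = (\<integral>\<^sup>+p. (a i p * Wt p) * ennreal ((residual P p)\<^sup>2) \<partial>P)"
      unfolding s_def by (rule cond_exp_X_intg[OF P]) measurable
    also have "2 * \<dots> = (\<integral>\<^sup>+p. 2 * ((a i p * Wt p) * ennreal ((residual P p)\<^sup>2)) \<partial>P)"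
      by (rule nn_integral_cmult[symmetric]) measurable
    also have "\<dots> \<le> (\<integral>\<^sup>+p. ennreal (residual P p ^ 4 * norm (R *v fst p) ^ 4) + (a i p)\<^sup>2 * Wt p \<partial>P)"
    proof (rule nn_integral_mono)
      fix p
      have "a i p < \<infinity>" using as(2)[of i p] by (auto intro: le_less_trans simp: of_nat_less_top)
      then obtain r where r: "a i p = ennreal r" "0 \<le> r" by (cases "a i p" rule: ennreal_cases) auto
      have "2 * (r * (residual P p)\<^sup>2) \<le> residual P p ^ 4 + r\<^sup>2"
        using sum_squares_bound[of "(residual P p)\<^sup>2" r] by (simp add: mult_ac flip: power_mult)
      then have "2 * (r * (residual P p)\<^sup>2) * norm (R *v fst p) ^ 4 \<le> (residual P p ^ 4 + r\<^sup>2) * norm (R *v fst p) ^ 4"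
        by (rule mult_right_mono) simp
      then have "ennreal (2 * (r * (residual P p)\<^sup>2) * norm (R *v fst p) ^ 4) \<le> ennreal (residual P p ^ 4 * norm (R *v fst p) ^ 4 + r\<^sup>2 * norm (R *v fst p) ^ 4)"
        by (intro ennreal_leI) (simp add: distrib_right)
      then show "2 * ((a i p * Wt p) * ennreal ((residual P p)\<^sup>2)) \<le> ennreal (residual P p ^ 4 * norm (R *v fst p) ^ 4) + (a i p)\<^sup>2 * Wt p"
        using r by (simp add: Wt_def ennreal_mult ennreal_power mult_ac)
    qed
    also have "\<dots> = ?J + ?K" by (rule nn_integral_add) measurable
    finally show ?thesis using Kfin by (simp add: add.commute[of ?J] ennreal_add_left_cancel_le)
  qed
  let ?u = "\<lambda>p. (if s p = top then 0 else s p)\<^sup>2 * Wt p"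
  have "(\<lambda>i. \<integral>\<^sup>+p. (a i p)\<^sup>2 * Wt p \<partial>P) \<longlonglongrightarrow> (\<integral>\<^sup>+p. ?u p \<partial>P)"
  proof (rule nn_integral_LIMSEQ)
    show "incseq (\<lambda>i p. (a i p)\<^sup>2 * Wt p)"
    proof (intro incseq_SucI le_funI mult_right_mono power_mono_ennreal)
      show "a i p \<le> a (Suc i) p" for i p
        by (auto simp: a_def min_def intro: order_trans[of _ "of_nat i"])
    qed simp
    show "(\<lambda>i. (a i p)\<^sup>2 * Wt p) \<longlonglongrightarrow> ?u p" for p
    proof (rule tendsto_eventually, cases "s p" rule: ennreal_cases)
      case (real r)
      obtain k :: nat where k: "r \<le> real k" using real_arch_simple by blast
      show "\<forall>\<^sub>F i in sequentially. (a i p)\<^sup>2 * Wt p = ?u p"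
        using eventually_ge_at_top[of k]
      proof eventually_elim
        case (elim i)
        have "s p \<le> of_nat i" using real k elim by (simp add: ennreal_of_nat_eq_real_of_nat ennreal_leI)
        then show ?case by (simp add: a_def min_absorb1)
      qed
    qed (simp add: a_def)
  qed measurable
  then have "(\<integral>\<^sup>+p. ?u p \<partial>P) \<le> ?J" by (rule LIMSEQ_le_const2) (use step in auto)
  moreover have "(\<integral>\<^sup>+p. (s p)\<^sup>2 * Wt p \<partial>P) = (\<integral>\<^sup>+p. ?u p \<partial>P)"
    by (rule nn_integral_cong_AE) (use fin in \<open>auto simp: infinity_ennreal_def elim!: eventually_mono\<close>)
  ultimately show ?thesis by (simp add: s_def Wt_def)
qed

lemma square_integrable_response:
  assumes J: "P \<in> joint_distributions PX" and e2: "integrable P (\<lambda>p. (snd p - \<beta> \<bullet> fst p)\<^sup>2)"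
  shows "integrable P (\<lambda>p. (snd p)\<^sup>2)"
proof (rule Bochner_Integration.integrable_bound)
  note [measurable] = jointD(4,5)[OF J]
  have "integrable P (\<lambda>p. (\<beta> \<bullet> fst p) * (\<beta> \<bullet> fst p))"
    by (rule integrable_fst_joint[OF J _ integrable_moment]) measurable
  then show "integrable P (\<lambda>p. 2 * (snd p - \<beta> \<bullet> fst p)\<^sup>2 + 2 * ((\<beta> \<bullet> fst p) * (\<beta> \<bullet> fst p)))" using e2 by auto
  show "(\<lambda>p. (snd p)\<^sup>2) \<in> borel_measurable P" by measurable
  have "y\<^sup>2 \<le> 2 * (y - b)\<^sup>2 + 2 * (b * b)" for y b :: real
    using zero_le_power2[of "y - 2 * b"] by (simp add: power2_eq_square algebra_simps)
  then show "AE p in P. norm ((snd p)\<^sup>2) \<le> norm (2 * (snd p - \<beta> \<bullet> fst p)\<^sup>2 + 2 * ((\<beta> \<bullet> fst p) * (\<beta> \<bullet> fst p)))"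
    by (intro AE_I2) (simp add: order_trans[OF _ abs_ge_self])
qed

text \<open>Testing the conditional variance bound with the constant 1 gives a finite second moment
  of the noise, hence of the response. Only then can the coefficient vector in the definition of the
  class be identified with \<open>beta_star P\<close>, by uniqueness of the solution of the moment
  equation.\<close>

lemma P_misD:
  assumes P: "P \<in> P_mis PX v"
  shows "P \<in> joint_distributions PX" "integrable P (\<lambda>p. (snd p)\<^sup>2)"
    "AE p in P. cond_exp_X P (\<lambda>q. (residual P q)\<^sup>2) p \<le> ennreal v"
proof -
  show J: "P \<in> joint_distributions PX" using P by (simp add: P_mis_def)
  interpret P: prob_space P by (rule jointD(1)[OF J])
  note [measurable] = jointD(4,5)[OF J]
  obtain \<beta> where zero: "(\<integral>p. (snd p - \<beta> \<bullet> fst p) *\<^sub>R fst p \<partial>P) = 0"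
    and ce: "AE p in P. cond_exp_X P (\<lambda>p. (snd p - \<beta> \<bullet> fst p)\<^sup>2) p \<le> ennreal v"
    using P by (auto simp: P_mis_def)
  have "(\<integral>\<^sup>+p. ennreal ((snd p - \<beta> \<bullet> fst p)\<^sup>2) \<partial>P) = (\<integral>\<^sup>+p. cond_exp_X P (\<lambda>p. (snd p - \<beta> \<bullet> fst p)\<^sup>2) p \<partial>P)"
    using cond_exp_X_intg[OF J, of "\<lambda>p. (snd p - \<beta> \<bullet> fst p)\<^sup>2" "\<lambda>_. 1"] by simp
  also have "\<dots> \<le> (\<integral>\<^sup>+p. ennreal v \<partial>P)" by (rule nn_integral_mono_AE[OF ce])
  also have "\<dots> < \<infinity>" by (simp add: P.emeasure_space_1)
  finally have e2: "integrable P (\<lambda>p. (snd p - \<beta> \<bullet> fst p)\<^sup>2)" by (intro integrableI_nonneg) auto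
  show y2: "integrable P (\<lambda>p. (snd p)\<^sup>2)" by (rule square_integrable_response[OF J e2])
  show "AE p in P. cond_exp_X P (\<lambda>q. (residual P q)\<^sup>2) p \<le> ennreal v"
    using ce by (simp add: residual_def beta_star_unique[OF J y2 zero])
qed

text \<open>A conditional variance of at most v bounds the leading moment by v d and \<chi> by v^2
  \<kappa>, so sqrt (\<kappa> \<chi>) is at most \<kappa> v.\<close>

lemma ols_risk_P_mis_le:
  assumes P: "P \<in> P_mis PX v" and v: "0 < v"
    and sb: "small_ball PX C \<alpha>" and C: "1 \<le> C" and \<alpha>: "0 < \<alpha>" "\<alpha> \<le> 1"
    and \<kappa>: "0 < \<kappa>" and L24: "L2_L4_equiv PX \<kappa>"
    and n: "real n \<ge> max 96 (6 * real CARD('d)) / \<alpha>"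
    and C': "C' = 3 * C ^ 4 * exp (1 + 9 / \<alpha>)"
  shows "expected_excess_risk n P (ols_estimator n)
      \<le> ennreal (v * real CARD('d) / real n * (1 + 276 * C'\<^sup>2 * \<kappa> * sqrt (real CARD('d) / real n)))"
proof -
  note J = P_misD(1)[OF P] and y2 = P_misD(2)[OF P] and ce = P_misD(3)[OF P]
  note [measurable] = jointD(4,5)[OF J] measurable_residual[OF J]
  let ?s = "cond_exp_X P (\<lambda>q. (residual P q)\<^sup>2)"
  define d where "d = real CARD('d)"
  have d1: "1 \<le> d" by (simp add: d_def Suc_le_eq)
  have n0: "0 < real n" using n \<alpha> by (auto simp: pos_divide_le_eq intro!: gr0I)
  have "(\<integral>\<^sup>+p. (?s p)\<^sup>2 * ennreal (norm (R *v fst p) ^ 4) \<partial>P) \<le> (\<integral>\<^sup>+p. ennreal (v\<^sup>2) * ennreal (norm (R *v fst p) ^ 4) \<partial>P)"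
  proof (rule nn_integral_mono_AE)
    show "AE p in P. (?s p)\<^sup>2 * ennreal (norm (R *v fst p) ^ 4) \<le> ennreal (v\<^sup>2) * ennreal (norm (R *v fst p) ^ 4)"
      using ce
    proof eventually_elim
      case (elim p)
      then have "(?s p)\<^sup>2 \<le> ennreal (v\<^sup>2)" using power_mono_ennreal[OF elim, of 2] v by (simp add: ennreal_power)
      then show ?case by (intro mult_right_mono) auto
    qed
  qed
  also have "\<dots> = ennreal (v\<^sup>2) * (\<integral>\<^sup>+p. ennreal (norm (R *v fst p) ^ 4) \<partial>P)" by (rule nn_integral_cmult) measurable
  also have "(\<integral>\<^sup>+p. ennreal (norm (R *v fst p) ^ 4) \<partial>P) \<le> ennreal (\<kappa> * d\<^sup>2)"
    using nn_norm_fourth_moment[OF L24 \<kappa>] unfolding d_def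
    by (subst nn_integral_fst_joint[OF J, of "\<lambda>x. ennreal (norm (R *v x) ^ 4)"]) auto
  finally have "(\<integral>\<^sup>+p. (?s p)\<^sup>2 * ennreal (norm (R *v fst p) ^ 4) \<partial>P) \<le> ennreal (v\<^sup>2) * ennreal (\<kappa> * d\<^sup>2)"
    by (simp add: mult_left_mono)
  then have "chi_moment P \<le> ennreal (v\<^sup>2) * ennreal (\<kappa> * d\<^sup>2) / ennreal (d\<^sup>2)"
    unfolding chi_moment_def whitened_norm_eq[OF J] d_def[symmetric] by (rule divide_right_mono_ennreal)
  also have "\<dots> = ennreal (v\<^sup>2 * \<kappa>)"
    using d1 \<kappa> by (simp add: divide_ennreal flip: ennreal_mult)
  finally have chi: "chi_moment P \<le> ennreal (v\<^sup>2 * \<kappa>)" .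
  then have chi_fin: "chi_moment P < \<infinity>" by (auto intro: le_less_trans)
  define x where "x = enn2real (chi_moment P)"
  have x: "0 \<le> x" "x \<le> v\<^sup>2 * \<kappa>" using chi \<kappa> unfolding x_def by (auto intro: enn2real_leI)
  have "(\<integral>\<^sup>+p. ennreal ((residual P p)\<^sup>2 * (whitened_norm P p)\<^sup>2) \<partial>P) = (\<integral>\<^sup>+p. ennreal ((norm (R *v fst p))\<^sup>2) * ennreal ((residual P p)\<^sup>2) \<partial>P)"
    by (intro nn_integral_cong) (simp add: whitened_norm_eq[OF J] mult.commute flip: ennreal_mult)
  also have "\<dots> = (\<integral>\<^sup>+p. ennreal ((norm (R *v fst p))\<^sup>2) * ?s p \<partial>P)"
  proof (rule cond_exp_X_intg[OF J, symmetric])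
    show "(\<lambda>p. (residual P p)\<^sup>2) \<in> borel_measurable P" by measurable
    show "(\<lambda>p. ennreal ((norm (R *v fst p))\<^sup>2)) \<in> borel_measurable (vimage_algebra (space P) fst borel)"
      by (rule measurable_fst_subalgebra[of "\<lambda>x. ennreal ((norm (R *v x))\<^sup>2)"]) measurable
  qed
  also have "\<dots> \<le> (\<integral>\<^sup>+p. ennreal ((norm (R *v fst p))\<^sup>2) * ennreal v \<partial>P)"
    by (rule nn_integral_mono_AE) (use ce in \<open>auto elim!: eventually_mono intro!: mult_left_mono\<close>)
  also have "\<dots> = (\<integral>\<^sup>+p. ennreal ((norm (R *v fst p))\<^sup>2) \<partial>P) * ennreal v" by (rule nn_integral_multc) measurable
  also have "(\<integral>\<^sup>+p. ennreal ((norm (R *v fst p))\<^sup>2) \<partial>P) = ennreal d"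
    using small_ball_sample.nn_integral_norm_squared[OF small_ball_sample_whitened[OF J sb C \<alpha>]] by (simp add: d_def)
  finally have first: "(\<integral>\<^sup>+p. ennreal ((residual P p)\<^sup>2 * (whitened_norm P p)\<^sup>2) \<partial>P) \<le> ennreal (v * d)"
    using d1 v by (simp add: mult.commute ennreal_mult)
  have "expected_excess_risk n P (ols_estimator n)
      \<le> ennreal (1 / real n) * (\<integral>\<^sup>+p. ennreal ((residual P p)\<^sup>2 * (whitened_norm P p)\<^sup>2) \<partial>P)
         + ennreal (276 * C'\<^sup>2 * sqrt (\<kappa> * x) * (d / real n) powr (3 / 2))"
    unfolding x_def d_def by (rule expected_excess_risk_ols_le[OF J y2 sb C \<alpha> \<kappa> L24 n C' chi_fin])
  also have "\<dots> \<le> ennreal (1 / real n) * ennreal (v * d) + ennreal (276 * C'\<^sup>2 * (\<kappa> * v) * ((d / real n) * sqrt (d / real n)))"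
  proof (intro add_mono mult_left_mono first ennreal_leI mult_mono)
    have "\<kappa> * x \<le> \<kappa> * (v\<^sup>2 * \<kappa>)" using x \<kappa> by (intro mult_left_mono) auto
    also have "\<dots> = (\<kappa> * v)\<^sup>2" by (simp add: power2_eq_square)
    finally show "sqrt (\<kappa> * x) \<le> \<kappa> * v" using \<kappa> v by (intro real_le_lsqrt) (auto simp: x)
    show "(d / real n) powr (3 / 2) \<le> d / real n * sqrt (d / real n)"
      using d1 n0 powr_add[of "d / n" 1 "1 / 2"] by (simp add: powr_half_sqrt)
  qed (use \<kappa> v in auto)
  also have "\<dots> = ennreal (v * d / real n * (1 + 276 * C'\<^sup>2 * \<kappa> * sqrt (d / real n)))"
    using d1 v \<kappa> n0 by (simp add: distrib_left mult_ac flip: ennreal_plus ennreal_mult)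
  finally show ?thesis by (simp add: d_def)
qed

end

section \<open>Bayesian lower bound\<close>

text \<open>Completing the square shows that the weight is a multiple of a normal density with mean
  B / q and variance 1 / q. The mean squared distance to any point \<open>c\<close> is at least the
  variance.\<close>

lemma gaussian_quadratic_lower_bound:
  fixes q A B c :: real
  assumes q: "0 < q"
  shows "ennreal (1 / q) * (\<integral>\<^sup>+t. ennreal (exp (A + B * t - q * t\<^sup>2 / 2)) \<partial>lborel)
      \<le> (\<integral>\<^sup>+t. ennreal ((c - t)\<^sup>2 * exp (A + B * t - q * t\<^sup>2 / 2)) \<partial>lborel)"
proof -
  define m where "m = B / q"
  define s where "s = 1 / sqrt q"
  define L where "L = sqrt (2 * pi * s\<^sup>2) * exp (A + B * m / 2)"
  have s: "0 < s" "s\<^sup>2 = 1 / q" using q by (auto simp: s_def power_divide)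
  have L: "0 < L" using s(1) by (simp add: L_def)
  have eq: "exp (A + B * t - q * t\<^sup>2 / 2) = L * normal_density m s t" for t
  proof -
    have B: "B = q * m" using q by (simp add: m_def)
    have e: "- (t - m)\<^sup>2 / (2 * s\<^sup>2) = - (q * (t - m)\<^sup>2 / 2)" using q by (simp add: s(2))
    have "L * normal_density m s t = exp (A + B * m / 2) * exp (- (q * (t - m)\<^sup>2 / 2))"
      using s(1) unfolding L_def normal_density_def e by simp
    also have "\<dots> = exp (A + B * t - q * t\<^sup>2 / 2)"
      unfolding B exp_add[symmetric] by (simp add: power2_eq_square add_divide_distrib diff_divide_distrib algebra_simps)
    finally show ?thesis by simp
  qed
  have 0: "has_bochner_integral lborel (normal_density m s) 1"
    using normal_moment_even[OF s(1), of m 0] by simp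
  have 1: "has_bochner_integral lborel (\<lambda>t. normal_density m s t * (t - m)) 0"
    using normal_moment_odd[OF s(1), of m 0] by simp
  have 2: "has_bochner_integral lborel (\<lambda>t. normal_density m s t * (t - m)\<^sup>2) (s\<^sup>2)"
    using normal_moment_even[OF s(1), of m 1] by (simp add: fact_numeral)
  have "has_bochner_integral lborel (\<lambda>t. (normal_density m s t * (t - m)\<^sup>2 + (2 * (m - c)) * (normal_density m s t * (t - m))) + (m - c)\<^sup>2 * normal_density m s t)
      ((s\<^sup>2 + (2 * (m - c)) * 0) + (m - c)\<^sup>2 * 1)"
    by (intro has_bochner_integral_add has_bochner_integral_mult_right 0 1 2)
  moreover have "(normal_density m s t * (t - m)\<^sup>2 + (2 * (m - c)) * (normal_density m s t * (t - m))) + (m - c)\<^sup>2 * normal_density m s t = (c - t)\<^sup>2 * normal_density m s t" for t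
    by (simp add: power2_eq_square algebra_simps)
  ultimately have "has_bochner_integral lborel (\<lambda>t. (c - t)\<^sup>2 * normal_density m s t) (s\<^sup>2 + (m - c)\<^sup>2)"
    by simp
  then have V: "(\<integral>\<^sup>+t. ennreal ((c - t)\<^sup>2 * normal_density m s t) \<partial>lborel) = ennreal (s\<^sup>2 + (m - c)\<^sup>2)"
    by (simp add: nn_integral_eq_integral has_bochner_integral_iff)
  have E: "(\<integral>\<^sup>+t. ennreal (normal_density m s t) \<partial>lborel) = 1"
    using 0 by (simp add: nn_integral_eq_integral has_bochner_integral_iff)
  have "(\<integral>\<^sup>+t. ennreal (exp (A + B * t - q * t\<^sup>2 / 2)) \<partial>lborel) = ennreal L"
    using L by (simp add: eq ennreal_mult nn_integral_cmult E)
  then have "ennreal (1 / q) * (\<integral>\<^sup>+t. ennreal (exp (A + B * t - q * t\<^sup>2 / 2)) \<partial>lborel) = ennreal (L * s\<^sup>2)"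
    using L q by (simp add: s(2) mult.commute flip: ennreal_mult)
  also have "\<dots> \<le> ennreal (L * (s\<^sup>2 + (m - c)\<^sup>2))"
    using L by (intro ennreal_leI mult_left_mono) auto
  also have "\<dots> = ennreal L * (\<integral>\<^sup>+t. ennreal ((c - t)\<^sup>2 * normal_density m s t) \<partial>lborel)"
    unfolding V using L by (intro ennreal_mult) auto
  also have "\<dots> = (\<integral>\<^sup>+t. ennreal L * ennreal ((c - t)\<^sup>2 * normal_density m s t) \<partial>lborel)"
    by (rule nn_integral_cmult[symmetric]) measurable
  also have "\<dots> = (\<integral>\<^sup>+t. ennreal ((c - t)\<^sup>2 * exp (A + B * t - q * t\<^sup>2 / 2)) \<partial>lborel)"
    unfolding eq using L by (intro nn_integral_cong, subst ennreal_mult[symmetric]) (auto simp: mult_ac)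
  finally show ?thesis .
qed

text \<open>Change of measure for a whole sample: it gives the samples under all parameters a
  likelihood with respect to the one sample law at parameter 0.\<close>

lemma PiM_density:
  assumes I: "finite I" and M: "prob_space M" and g[measurable]: "g \<in> borel_measurable M"
    and D: "prob_space (density M g)"
  shows "(\<Pi>\<^sub>M i\<in>I. density M g) = density (\<Pi>\<^sub>M i\<in>I. M) (\<lambda>z. \<Prod>i\<in>I. g (z i))"
proof -
  interpret M: prob_space M by fact
  interpret D: prob_space "density M g" by fact
  interpret pM: product_sigma_finite "\<lambda>_. M" ..
  interpret pD: product_sigma_finite "\<lambda>_. density M g" ..
  have gm: "(\<lambda>z. \<Prod>i\<in>I. g (z i)) \<in> borel_measurable (\<Pi>\<^sub>M i\<in>I. M)"
  proof (rule borel_measurable_prod_ennreal)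
    show "(\<lambda>z. g (z i)) \<in> borel_measurable (\<Pi>\<^sub>M i\<in>I. M)" if "i \<in> I" for i
      using measurable_component_singleton[OF that, of "\<lambda>_. M"] g by (rule measurable_compose)
  qed
  have "density (\<Pi>\<^sub>M i\<in>I. M) (\<lambda>z. \<Prod>i\<in>I. g (z i)) = (\<Pi>\<^sub>M i\<in>I. density M g)"
  proof (rule pD.PiM_eqI[OF I])
    show "sets (density (\<Pi>\<^sub>M i\<in>I. M) (\<lambda>z. \<Prod>i\<in>I. g (z i))) = sets (\<Pi>\<^sub>M i\<in>I. density M g)"
      by (simp add: sets_PiM_cong[of I I "\<lambda>_. M" "\<lambda>_. density M g"])
    fix A assume "\<And>i. i \<in> I \<Longrightarrow> A i \<in> sets (density M g)"
    then have A: "\<And>i. i \<in> I \<Longrightarrow> A i \<in> sets M" by simp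
    have "emeasure (density (\<Pi>\<^sub>M i\<in>I. M) (\<lambda>z. \<Prod>i\<in>I. g (z i))) (Pi\<^sub>E I A)
        = (\<integral>\<^sup>+z. (\<Prod>i\<in>I. g (z i)) * indicator (Pi\<^sub>E I A) z \<partial>(\<Pi>\<^sub>M i\<in>I. M))"
      by (rule emeasure_density[OF gm]) (intro sets_PiM_I_finite I A)
    also have "\<dots> = (\<integral>\<^sup>+z. (\<Prod>i\<in>I. g (z i) * indicator (A i) (z i)) \<partial>(\<Pi>\<^sub>M i\<in>I. M))"
    proof (rule nn_integral_cong)
      fix z assume z: "z \<in> space (\<Pi>\<^sub>M i\<in>I. M)"
      have "(indicator (Pi\<^sub>E I A) z :: ennreal) = (\<Prod>i\<in>I. indicator (A i) (z i))"
        using z I by (auto simp: space_PiM PiE_iff indicator_def prod_zero_iff)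
      then show "(\<Prod>i\<in>I. g (z i)) * indicator (Pi\<^sub>E I A) z = (\<Prod>i\<in>I. g (z i) * indicator (A i) (z i))"
        by (simp add: prod.distrib)
    qed
    also have "\<dots> = (\<Prod>i\<in>I. \<integral>\<^sup>+x. g x * indicator (A i) x \<partial>M)"
    proof (rule pM.product_nn_integral_prod[OF I])
      fix i assume "i \<in> I"
      then have [measurable]: "A i \<in> sets M" by (rule A)
      show "(\<lambda>x. g x * indicator (A i) x) \<in> borel_measurable M" by measurable
    qed
    also have "\<dots> = (\<Prod>i\<in>I. emeasure (density M g) (A i))"
      by (intro prod.cong refl emeasure_density[symmetric] g A)
    finally show "emeasure (density (\<Pi>\<^sub>M i\<in>I. M) (\<lambda>z. \<Prod>i\<in>I. g (z i))) (Pi\<^sub>E I A) = (\<Prod>i\<in>I. emeasure (density M g) (A i))" .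
  qed
  then show ?thesis by simp
qed

section \<open>The Gaussian linear model inside the class\<close>

abbreviation gauss :: "real \<Rightarrow> real measure" where
  "gauss s \<equiv> density lborel (\<lambda>t. ennreal (normal_density 0 s t))"

text \<open>The likelihood ratio at the response between the normal densities with means
  \<open>\<beta> \<bullet> X\<close> and 0 and common standard deviation \<open>s\<close>. A common
  dominating measure lets Tonelli exchange the prior with the sample.\<close>

definition gaussian_tilt :: "real \<Rightarrow> real ^ 'd \<Rightarrow> (real ^ 'd) \<times> real \<Rightarrow> real" where
  "gaussian_tilt s \<beta> p = exp ((2 * snd p * (\<beta> \<bullet> fst p) - (\<beta> \<bullet> fst p)\<^sup>2) / (2 * s\<^sup>2))"

text \<open>The law of \<open>(X, \<beta> \<bullet> X + t)\<close> with \<open>t\<close> centered Gaussian and independent of \<open>X\<close>,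
  written as a density with respect to its value at \<open>\<beta> = 0\<close>.\<close>

definition gaussian_model :: "(real ^ 'd) measure \<Rightarrow> real \<Rightarrow> real ^ 'd \<Rightarrow> ((real ^ 'd) \<times> real) measure" where
  "gaussian_model PX s \<beta> = density (PX \<Otimes>\<^sub>M gauss s) (\<lambda>p. ennreal (gaussian_tilt s \<beta> p))"

lemma gaussian_tilt_pos [simp]: "0 < gaussian_tilt s \<beta> p"
  by (simp add: gaussian_tilt_def)

lemma normal_density_tilt:
  "normal_density 0 s y * gaussian_tilt s \<beta> (x, y) = normal_density 0 s (y - \<beta> \<bullet> x)"
proof -
  have "- y\<^sup>2 / (2 * s\<^sup>2) + (2 * y * b - b\<^sup>2) / (2 * s\<^sup>2) = - (y - b)\<^sup>2 / (2 * s\<^sup>2)" for b :: real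
    unfolding add_divide_distrib[symmetric] by (simp add: power2_eq_square algebra_simps)
  then show ?thesis
    by (simp add: normal_density_def gaussian_tilt_def mult.assoc flip: exp_add)
qed

lemma borel_measurable_gaussian_tilt: "gaussian_tilt s \<beta> \<in> borel_measurable borel"
proof -
  have [measurable]: "(fst :: (real ^ 'd) \<times> real \<Rightarrow> _) \<in> borel_measurable borel" "(snd :: (real ^ 'd) \<times> real \<Rightarrow> _) \<in> borel_measurable borel"
    by (intro borel_measurable_continuous_onI continuous_intros)+
  show ?thesis unfolding gaussian_tilt_def by measurable
qed

context design
begin

lemma sets_model: "sets (PX \<Otimes>\<^sub>M gauss s) = sets borel"
  unfolding borel_prod[symmetric] by (rule sets_pair_measure_cong) (auto simp: sets_PX)

lemma measurable_model: "f \<in> borel_measurable borel \<Longrightarrow> f \<in> borel_measurable (PX \<Otimes>\<^sub>M gauss s)"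
  using measurable_cong_sets[OF sets_model refl] by blast

context
  fixes s :: real assumes s: "0 < s"
begin

lemma prob_space_gauss: "prob_space (gauss s)"
  by (rule prob_space_normal_density[OF s])

lemma prob_space_base: "prob_space (PX \<Otimes>\<^sub>M gauss s)"
proof -
  interpret N: prob_space "gauss s" by (rule prob_space_gauss)
  interpret pair_prob_space PX "gauss s" ..
  show ?thesis by (rule prob_space_axioms)
qed

text \<open>For fixed \<open>x\<close> the tilted density is the centred one shifted by
  \<open>\<beta> \<bullet> x\<close>, and translation invariance of Lebesgue measure recentres
  it.\<close>

lemma nn_integral_gaussian_model:
  assumes h: "h \<in> borel_measurable borel"
  shows "(\<integral>\<^sup>+p. h p \<partial>gaussian_model PX s \<beta>) = (\<integral>\<^sup>+x. \<integral>\<^sup>+t. h (x, \<beta> \<bullet> x + t) \<partial>gauss s \<partial>PX)"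
proof -
  interpret N: prob_space "gauss s" by (rule prob_space_gauss)
  interpret pair_prob_space PX "gauss s" ..
  have gm: "gaussian_tilt s \<beta> \<in> borel_measurable (PX \<Otimes>\<^sub>M gauss s)" by (rule measurable_model[OF borel_measurable_gaussian_tilt])
  have hm: "h \<in> borel_measurable (PX \<Otimes>\<^sub>M gauss s)" by (rule measurable_model[OF h])
  have sec: "(\<lambda>y. f (x, c + y)) \<in> borel_measurable borel" if "f \<in> borel_measurable borel" for f :: "(real ^ 'd) \<times> real \<Rightarrow> 'z::topological_space" and x c
    by (rule measurable_compose[OF _ that]) (intro borel_measurable_continuous_onI continuous_intros)
  have "(\<integral>\<^sup>+p. h p \<partial>gaussian_model PX s \<beta>) = (\<integral>\<^sup>+p. ennreal (gaussian_tilt s \<beta> p) * h p \<partial>(PX \<Otimes>\<^sub>M gauss s))"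
    unfolding gaussian_model_def using gm hm by (intro nn_integral_density) auto
  also have "\<dots> = (\<integral>\<^sup>+x. \<integral>\<^sup>+y. ennreal (gaussian_tilt s \<beta> (x, y)) * h (x, y) \<partial>gauss s \<partial>PX)"
    using gm hm by (intro N.nn_integral_fst[symmetric]) auto
  also have "\<dots> = (\<integral>\<^sup>+x. \<integral>\<^sup>+t. h (x, \<beta> \<bullet> x + t) \<partial>gauss s \<partial>PX)"
  proof (rule nn_integral_cong)
    fix x
    have g0: "(\<lambda>y. gaussian_tilt s \<beta> (x, y)) \<in> borel_measurable borel" and h0: "(\<lambda>y. h (x, y)) \<in> borel_measurable borel"
      using sec[OF borel_measurable_gaussian_tilt, of s \<beta> x 0] sec[OF h, of x 0] by simp_all
    note [measurable] = g0 h0 sec[OF h, of x "\<beta> \<bullet> x"]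
    have "(\<integral>\<^sup>+y. ennreal (gaussian_tilt s \<beta> (x, y)) * h (x, y) \<partial>gauss s)
        = (\<integral>\<^sup>+y. ennreal (normal_density 0 s y) * (ennreal (gaussian_tilt s \<beta> (x, y)) * h (x, y)) \<partial>lborel)"
      by (rule nn_integral_density) measurable
    also have "\<dots> = (\<integral>\<^sup>+y. ennreal (normal_density 0 s (y - \<beta> \<bullet> x)) * h (x, y) \<partial>lborel)"
    proof (rule nn_integral_cong)
      fix y
      have "ennreal (normal_density 0 s y) * ennreal (gaussian_tilt s \<beta> (x, y)) = ennreal (normal_density 0 s (y - \<beta> \<bullet> x))"
        by (subst ennreal_mult[symmetric]) (simp_all add: normal_density_tilt less_imp_le)
      then show "ennreal (normal_density 0 s y) * (ennreal (gaussian_tilt s \<beta> (x, y)) * h (x, y)) = ennreal (normal_density 0 s (y - \<beta> \<bullet> x)) * h (x, y)"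
        by (simp flip: mult.assoc)
    qed
    also have "\<dots> = (\<integral>\<^sup>+t. ennreal (normal_density 0 s (\<beta> \<bullet> x + t - \<beta> \<bullet> x)) * h (x, \<beta> \<bullet> x + t) \<partial>lborel)"
      by (rule nn_integral_lborel_shift[symmetric]) measurable
    also have "\<dots> = (\<integral>\<^sup>+t. ennreal (normal_density 0 s t) * h (x, \<beta> \<bullet> x + t) \<partial>lborel)" by simp
    also have "\<dots> = (\<integral>\<^sup>+t. h (x, \<beta> \<bullet> x + t) \<partial>gauss s)" by (rule nn_integral_density[symmetric]) measurable
    finally show "(\<integral>\<^sup>+y. ennreal (gaussian_tilt s \<beta> (x, y)) * h (x, y) \<partial>gauss s) = (\<integral>\<^sup>+t. h (x, \<beta> \<bullet> x + t) \<partial>gauss s)" .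
  qed
  finally show ?thesis .
qed

lemma sets_gaussian_model: "sets (gaussian_model PX s \<beta>) = sets borel"
  unfolding gaussian_model_def sets_density by (rule sets_model)

lemma measurable_shear: "(\<lambda>p. (fst p, \<beta> \<bullet> fst p + snd p)) \<in> borel_measurable (PX \<Otimes>\<^sub>M gauss s)"
  by (rule measurable_model) (intro borel_measurable_continuous_onI continuous_intros)

text \<open>The density form serves the change of measure. This push-forward form makes the total
  mass, the marginal of \<open>X\<close> and the centering of the noise visible.\<close>

lemma gaussian_model_eq_distr:
  "gaussian_model PX s \<beta> = distr (PX \<Otimes>\<^sub>M gauss s) borel (\<lambda>p. (fst p, \<beta> \<bullet> fst p + snd p))"
proof (rule measure_eqI)
  interpret N: prob_space "gauss s" by (rule prob_space_gauss)
  interpret pair_prob_space PX "gauss s" ..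
  show "sets (gaussian_model PX s \<beta>) = sets (distr (PX \<Otimes>\<^sub>M gauss s) borel (\<lambda>p. (fst p, \<beta> \<bullet> fst p + snd p)))"
    by (simp add: sets_gaussian_model)
  fix A assume "A \<in> sets (gaussian_model PX s \<beta>)"
  then have A: "A \<in> sets borel" by (simp add: sets_gaussian_model)
  let ?f = "\<lambda>p :: (real ^ 'd) \<times> real. (fst p, \<beta> \<bullet> fst p + snd p)"
  have "emeasure (gaussian_model PX s \<beta>) A = (\<integral>\<^sup>+p. indicator A p \<partial>gaussian_model PX s \<beta>)"
    using A by (simp add: sets_gaussian_model)
  also have "\<dots> = (\<integral>\<^sup>+x. \<integral>\<^sup>+t. indicator A (?f (x, t)) \<partial>gauss s \<partial>PX)"
    using A by (subst nn_integral_gaussian_model) auto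
  also have "\<dots> = (\<integral>\<^sup>+p. indicator A (?f p) \<partial>(PX \<Otimes>\<^sub>M gauss s))"
    by (rule N.nn_integral_fst) (rule measurable_compose[OF measurable_shear], use A in simp)
  also have "\<dots> = (\<integral>\<^sup>+p. indicator A p \<partial>distr (PX \<Otimes>\<^sub>M gauss s) borel ?f)"
    using A by (intro nn_integral_distr[symmetric] measurable_shear) auto
  also have "\<dots> = emeasure (distr (PX \<Otimes>\<^sub>M gauss s) borel ?f) A" using A by simp
  finally show "emeasure (gaussian_model PX s \<beta>) A = emeasure (distr (PX \<Otimes>\<^sub>M gauss s) borel ?f) A" .
qed

lemma gaussian_model_joint: "gaussian_model PX s \<beta> \<in> joint_distributions PX"
proof -
  interpret N: prob_space "gauss s" by (rule prob_space_gauss)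
  interpret pair_prob_space PX "gauss s" ..
  let ?f = "\<lambda>p :: (real ^ 'd) \<times> real. (fst p, \<beta> \<bullet> fst p + snd p)"
  have fst: "(fst :: (real ^ 'd) \<times> real \<Rightarrow> _) \<in> borel_measurable borel"
    by (intro borel_measurable_continuous_onI continuous_intros)
  have "distr (gaussian_model PX s \<beta>) borel fst = distr (PX \<Otimes>\<^sub>M gauss s) borel fst"
    unfolding gaussian_model_eq_distr by (subst distr_distr[OF fst measurable_shear]) (simp add: comp_def)
  also have "\<dots> = distr (PX \<Otimes>\<^sub>M gauss s) PX fst" by (rule distr_cong) (auto simp: sets_PX)
  also have "\<dots> = PX" by (rule N.distr_pair_fst)
  finally have "distr (gaussian_model PX s \<beta>) borel fst = PX" .
  moreover have "prob_space (gaussian_model PX s \<beta>)"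
    unfolding gaussian_model_eq_distr by (rule prob_space_distr[OF measurable_shear])
  ultimately show ?thesis by (simp add: joint_distributions_def sets_gaussian_model)
qed

lemma nn_gauss_second_moment: "(\<integral>\<^sup>+t. ennreal (t\<^sup>2) \<partial>gauss s) = ennreal (s\<^sup>2)"
proof -
  have "has_bochner_integral lborel (\<lambda>t. normal_density 0 s t * t\<^sup>2) (s\<^sup>2)"
    using normal_moment_even[OF s, of 0 1] by (simp add: fact_numeral)
  then have "(\<integral>\<^sup>+t. ennreal (normal_density 0 s t * t\<^sup>2) \<partial>lborel) = ennreal (s\<^sup>2)"
    by (simp add: nn_integral_eq_integral has_bochner_integral_iff)
  then show ?thesis by (subst nn_integral_density) (auto simp: ennreal_mult)
qed

lemma gauss_mean: "(\<integral>t. t \<partial>gauss s) = 0"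
  using integral_normal_moment_nz_1[OF s, of 0] by (subst integral_density) auto

lemma integrable_gauss: "integrable (gauss s) (\<lambda>t. t)"
  using integrable_normal_moment_nz_1[OF s, of 0] by (subst integrable_density) auto

lemma gaussian_model_P_mis:
  shows "gaussian_model PX s \<beta> \<in> P_mis PX (s\<^sup>2)" and "beta_star (gaussian_model PX s \<beta>) = \<beta>"
    and "integrable (gaussian_model PX s \<beta>) (\<lambda>p. (snd p)\<^sup>2)"
proof -
  have PX1: "emeasure PX (space PX) = 1" by (rule emeasure_space_1)
  let ?P = "gaussian_model PX s \<beta>"
  let ?f = "\<lambda>p :: (real ^ 'd) \<times> real. (fst p, \<beta> \<bullet> fst p + snd p)"
  note J = gaussian_model_joint
  note [measurable] = jointD(4,5)[OF J]
  interpret Q: prob_space ?P by (rule jointD(1)[OF J])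
  interpret N: prob_space "gauss s" by (rule prob_space_gauss)
  interpret pair_prob_space PX "gauss s" ..
  have bm: "(\<lambda>p. snd p - \<beta> \<bullet> fst p) \<in> borel_measurable (borel :: ((real ^ 'd) \<times> real) measure)"
    "(\<lambda>p. (snd p - \<beta> \<bullet> fst p) *\<^sub>R fst p) \<in> borel_measurable (borel :: ((real ^ 'd) \<times> real) measure)"
    by (intro borel_measurable_continuous_onI continuous_intros)+
  have "(\<integral>\<^sup>+p. ennreal ((snd p - \<beta> \<bullet> fst p)\<^sup>2) \<partial>?P) = ennreal (s\<^sup>2)"
    using bm(1) by (subst nn_integral_gaussian_model) (auto simp: nn_gauss_second_moment PX1)
  then have e2: "integrable ?P (\<lambda>p. (snd p - \<beta> \<bullet> fst p)\<^sup>2)" by (intro integrableI_nonneg) auto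
  show y2: "integrable ?P (\<lambda>p. (snd p)\<^sup>2)" by (rule square_integrable_response[OF J e2])
  have i: "integrable ?P (\<lambda>p. (snd p - \<beta> \<bullet> fst p) *\<^sub>R fst p)" by (rule integrable_residual_fst[OF J y2])
  then have "integrable (PX \<Otimes>\<^sub>M gauss s) (\<lambda>p. (snd (?f p) - \<beta> \<bullet> fst (?f p)) *\<^sub>R fst (?f p))"
    unfolding gaussian_model_eq_distr by (subst (asm) integrable_distr_eq[OF measurable_shear bm(2)])
  then have i': "integrable (PX \<Otimes>\<^sub>M gauss s) (\<lambda>p. snd p *\<^sub>R fst p)" by simp
  have "(\<integral>p. (snd p - \<beta> \<bullet> fst p) *\<^sub>R fst p \<partial>?P) = (\<integral>p. (snd (?f p) - \<beta> \<bullet> fst (?f p)) *\<^sub>R fst (?f p) \<partial>(PX \<Otimes>\<^sub>M gauss s))"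
    unfolding gaussian_model_eq_distr by (rule integral_distr[OF measurable_shear bm(2)])
  also have "\<dots> = (\<integral>p. snd p *\<^sub>R fst p \<partial>(PX \<Otimes>\<^sub>M gauss s))" by simp
  also have "\<dots> = (\<integral>x. (\<integral>t. snd (x, t) *\<^sub>R fst (x, t) \<partial>gauss s) \<partial>PX)" by (rule integral_fst'[OF i', symmetric])
  also have "\<dots> = (\<integral>x. 0 \<partial>PX)"
  proof (intro Bochner_Integration.integral_cong refl)
    fix x :: "real ^ 'd"
    show "(\<integral>t. snd (x, t) *\<^sub>R fst (x, t) \<partial>gauss s) = 0"
    proof (cases "x = 0")
      case False
      then show ?thesis using integral_scaleR_left[OF integrable_gauss, of x] by (simp add: gauss_mean)
    qed simp
  qed
  finally have z: "(\<integral>p. (snd p - \<beta> \<bullet> fst p) *\<^sub>R fst p \<partial>?P) = 0" by simp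
  show "beta_star ?P = \<beta>" by (rule beta_star_unique[OF J y2 z])
  let ?F = "vimage_algebra (space ?P) fst (borel :: (real ^ 'd) measure)"
  have sF: "sets ?F = {fst -` A \<inter> space ?P | A. A \<in> sets borel}"
    by (rule sets_vimage_algebra2) simp
  also have "\<dots> \<subseteq> sets ?P" using measurable_sets[OF jointD(4)[OF J]] by blast
  finally have "subalgebra ?P ?F" by (simp add: subalgebra_def)
  then interpret F: finite_measure_subalgebra ?P ?F
    by (intro finite_measure_subalgebra.intro finite_measure_subalgebra_axioms.intro Q.finite_measure_axioms)
  have "AE p in ?P. ennreal (s\<^sup>2) = cond_exp_X ?P (\<lambda>p. (snd p - \<beta> \<bullet> fst p)\<^sup>2) p"
    unfolding cond_exp_X_def
  proof (rule F.nn_cond_exp_charact)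
    \<comment> \<open>Such a set depends on \<open>x\<close> alone, so its indicator leaves the
      inner Gaussian integral, which equals \<open>s\<^sup>2\<close> for every \<open>x\<close>. The
      conditional variance is therefore the constant \<open>s\<^sup>2\<close>.\<close>
    fix A assume "A \<in> sets ?F"
    then obtain B where B: "A = fst -` B" "B \<in> sets borel" unfolding sF by (auto simp: jointD(6)[OF J])
    have Bm: "(\<lambda>p. indicator B (fst p) :: ennreal) \<in> borel_measurable (borel :: ((real ^ 'd) \<times> real) measure)"
      by (rule measurable_compose[of fst _ borel])
        (use B(2) in \<open>auto intro!: borel_measurable_continuous_onI continuous_intros\<close>)
    have ind: "indicator A p = (indicator B (fst p) :: ennreal)" for p :: "(real ^ 'd) \<times> real"
      by (simp add: B(1) indicator_def)
    have "(\<integral>\<^sup>+p. ennreal ((snd p - \<beta> \<bullet> fst p)\<^sup>2) * indicator A p \<partial>?P) = (\<integral>\<^sup>+x. \<integral>\<^sup>+t. ennreal (t\<^sup>2) * indicator B x \<partial>gauss s \<partial>PX)"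
      using bm(1) Bm unfolding ind by (subst nn_integral_gaussian_model) auto
    also have "\<dots> = (\<integral>\<^sup>+x. \<integral>\<^sup>+t. ennreal (s\<^sup>2) * indicator B x \<partial>gauss s \<partial>PX)"
      using N.emeasure_space_1 by (simp add: nn_integral_multc nn_gauss_second_moment)
    also have "\<dots> = (\<integral>\<^sup>+p. ennreal (s\<^sup>2) * indicator A p \<partial>?P)"
      using Bm unfolding ind by (subst nn_integral_gaussian_model) auto
    finally show "(\<integral>\<^sup>+p\<in>A. ennreal ((snd p - \<beta> \<bullet> fst p)\<^sup>2) \<partial>?P) = (\<integral>\<^sup>+p\<in>A. ennreal (s\<^sup>2) \<partial>?P)" .
  qed measurable
  then have "AE p in ?P. cond_exp_X ?P (\<lambda>p. (snd p - \<beta> \<bullet> fst p)\<^sup>2) p \<le> ennreal (s\<^sup>2)"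
    by eventually_elim simp
  then show "?P \<in> P_mis PX (s\<^sup>2)" using J i z by (auto simp: P_mis_def)
qed

end

end

text \<open>Transfers the quadratic bound to integrals against the Gaussian prior: \<open>f\<close>
  is the likelihood as a function of one coordinate, and times the prior density it is the
  exponential of a quadratic.\<close>

lemma gauss_tilted_second_moment_ge:
  fixes f :: "real \<Rightarrow> real"
  assumes q: "0 < q" and K: "0 \<le> K" and f0: "\<And>t. 0 \<le> f t" and [measurable]: "f \<in> borel_measurable borel"
    and f: "\<And>t. f t * normal_density 0 \<tau> t = K * exp (A + B * t - q * t\<^sup>2 / 2)"
  shows "ennreal (1 / q) * (\<integral>\<^sup>+t. ennreal (f t) \<partial>gauss \<tau>) \<le> (\<integral>\<^sup>+t. ennreal (f t * (c - t)\<^sup>2) \<partial>gauss \<tau>)"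
proof -
  have "(\<integral>\<^sup>+t. ennreal (f t) \<partial>gauss \<tau>) = (\<integral>\<^sup>+t. ennreal (normal_density 0 \<tau> t) * ennreal (f t) \<partial>lborel)"
    by (rule nn_integral_density) measurable
  also have "\<dots> = (\<integral>\<^sup>+t. ennreal K * ennreal (exp (A + B * t - q * t\<^sup>2 / 2)) \<partial>lborel)"
    using f[unfolded mult.commute[of "f _"]] K f0
    by (intro nn_integral_cong, subst (1 2) ennreal_mult[symmetric]) auto
  also have "\<dots> = ennreal K * (\<integral>\<^sup>+t. ennreal (exp (A + B * t - q * t\<^sup>2 / 2)) \<partial>lborel)"
    by (rule nn_integral_cmult) measurable
  finally have "ennreal (1 / q) * (\<integral>\<^sup>+t. ennreal (f t) \<partial>gauss \<tau>)
      = ennreal K * (ennreal (1 / q) * (\<integral>\<^sup>+t. ennreal (exp (A + B * t - q * t\<^sup>2 / 2)) \<partial>lborel))"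
    by (simp add: mult.left_commute)
  also have "\<dots> \<le> ennreal K * (\<integral>\<^sup>+t. ennreal ((c - t)\<^sup>2 * exp (A + B * t - q * t\<^sup>2 / 2)) \<partial>lborel)"
    by (intro mult_left_mono gaussian_quadratic_lower_bound q) simp
  also have "\<dots> = (\<integral>\<^sup>+t. ennreal K * ennreal ((c - t)\<^sup>2 * exp (A + B * t - q * t\<^sup>2 / 2)) \<partial>lborel)"
    by (rule nn_integral_cmult[symmetric]) measurable
  also have "\<dots> = (\<integral>\<^sup>+t. ennreal (normal_density 0 \<tau> t) * ennreal (f t * (c - t)\<^sup>2) \<partial>lborel)"
  proof (rule nn_integral_cong)
    fix t
    have "K * ((c - t)\<^sup>2 * exp (A + B * t - q * t\<^sup>2 / 2)) = normal_density 0 \<tau> t * (f t * (c - t)\<^sup>2)"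
      using f[of t] by (metis mult.assoc mult.commute)
    then show "ennreal K * ennreal ((c - t)\<^sup>2 * exp (A + B * t - q * t\<^sup>2 / 2)) = ennreal (normal_density 0 \<tau> t) * ennreal (f t * (c - t)\<^sup>2)"
      using K f0[of t] by (subst (1 2) ennreal_mult[symmetric]) auto
  qed
  also have "\<dots> = (\<integral>\<^sup>+t. ennreal (f t * (c - t)\<^sup>2) \<partial>gauss \<tau>)"
    by (rule nn_integral_density[symmetric]) measurable
  finally show ?thesis .
qed

text \<open>Here \<open>y i\<close> is the response, \<open>a i\<close> the part of the linear
  predictor due to the other coordinates, and \<open>w i\<close> the coefficient of the free
  coordinate \<open>t\<close>. The factor of - t^2 / 2 is the conditional posterior precision and
  involves only the \<open>w i\<close>.\<close>

lemma gaussian_likelihood_line: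
  fixes y a w :: "nat \<Rightarrow> real"
  assumes s: "0 < s"
  shows "(\<Prod>i<n. exp ((2 * y i * (a i + t * w i) - (a i + t * w i)\<^sup>2) / (2 * s\<^sup>2))) * normal_density 0 \<tau> t
    = 1 / sqrt (2 * pi * \<tau>\<^sup>2) * exp ((\<Sum>i<n. (2 * y i * a i - (a i)\<^sup>2) / (2 * s\<^sup>2))
        + (\<Sum>i<n. (y i - a i) * w i / s\<^sup>2) * t - (1 / \<tau>\<^sup>2 + (\<Sum>i<n. (w i)\<^sup>2 / s\<^sup>2)) * t\<^sup>2 / 2)"
proof -
  have "(2 * y i * (a i + t * w i) - (a i + t * w i)\<^sup>2) / (2 * s\<^sup>2)
      = (2 * y i * a i - (a i)\<^sup>2) / (2 * s\<^sup>2) + ((y i - a i) * w i / s\<^sup>2) * t - ((w i)\<^sup>2 / s\<^sup>2) * (t\<^sup>2 / 2)" for i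
    using s by (simp add: field_simps power2_eq_square)
  then have "(\<Sum>i<n. (2 * y i * (a i + t * w i) - (a i + t * w i)\<^sup>2) / (2 * s\<^sup>2))
      = (\<Sum>i<n. (2 * y i * a i - (a i)\<^sup>2) / (2 * s\<^sup>2)) + (\<Sum>i<n. (y i - a i) * w i / s\<^sup>2) * t - (\<Sum>i<n. (w i)\<^sup>2 / s\<^sup>2) * (t\<^sup>2 / 2)"
    by (simp only: sum_subtractf sum.distrib sum_distrib_right)
  then have key: "(\<Sum>i<n. (2 * y i * (a i + t * w i) - (a i + t * w i)\<^sup>2) / (2 * s\<^sup>2)) + - (t - 0)\<^sup>2 / (2 * \<tau>\<^sup>2)
      = (\<Sum>i<n. (2 * y i * a i - (a i)\<^sup>2) / (2 * s\<^sup>2)) + (\<Sum>i<n. (y i - a i) * w i / s\<^sup>2) * t - (1 / \<tau>\<^sup>2 + (\<Sum>i<n. (w i)\<^sup>2 / s\<^sup>2)) * t\<^sup>2 / 2"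
    by (simp add: distrib_right add_divide_distrib)
  have "(\<Prod>i<n. exp ((2 * y i * (a i + t * w i) - (a i + t * w i)\<^sup>2) / (2 * s\<^sup>2))) * normal_density 0 \<tau> t
      = 1 / sqrt (2 * pi * \<tau>\<^sup>2) * (exp (\<Sum>i<n. (2 * y i * (a i + t * w i) - (a i + t * w i)\<^sup>2) / (2 * s\<^sup>2)) * exp (- (t - 0)\<^sup>2 / (2 * \<tau>\<^sup>2)))"
    unfolding exp_sum[OF finite_lessThan] normal_density_def by simp
  then show ?thesis unfolding exp_add[symmetric] key .
qed

section \<open>Prior, coordinatewise posterior and Bayes risk\<close>

lemma borel_measurable_vec_nth:
  fixes f :: "_ \<Rightarrow> real ^ 'd"
  shows "f \<in> borel_measurable M \<Longrightarrow> (\<lambda>x. f x $ k) \<in> borel_measurable M"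
  using borel_measurable_inner[of "\<lambda>_. axis k 1" M f] by (simp add: inner_axis')

context design
begin

text \<open>The prior is put on the whitened coefficients, so excess risk becomes a sum of squared
  coordinate errors. They form a function on the index type because the product measure lives on
  functions.\<close>

definition prior_parameter :: "('d \<Rightarrow> real) \<Rightarrow> real ^ 'd" where
  "prior_parameter \<xi> = R *v (\<chi> k. \<xi> k)"

definition likelihood :: "nat \<Rightarrow> real \<Rightarrow> ('d \<Rightarrow> real) \<Rightarrow> (nat \<Rightarrow> (real ^ 'd) \<times> real) \<Rightarrow> real" where
  "likelihood n s \<xi> z = (\<Prod>i<n. gaussian_tilt s (prior_parameter \<xi>) (z i))"

text \<open>Posterior precision of the k-th whitened coefficient given the data and all other
  coefficients. It involves the design but not the responses.\<close>

definition precision :: "nat \<Rightarrow> real \<Rightarrow> real \<Rightarrow> 'd \<Rightarrow> (nat \<Rightarrow> (real ^ 'd) \<times> real) \<Rightarrow> real" where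
  "precision n s \<tau> k z = 1 / \<tau>\<^sup>2 + (\<Sum>i<n. ((R *v fst (z i)) $ k)\<^sup>2 / s\<^sup>2)"

lemma likelihood_pos: "0 < likelihood n s \<xi> z"
  by (simp add: likelihood_def prod_pos)

lemma precision_pos: "0 < \<tau> \<Longrightarrow> 0 < precision n s \<tau> k z"
  unfolding precision_def by (intro add_pos_nonneg sum_nonneg) auto

lemma prior_parameter_inner: "prior_parameter \<xi> \<bullet> x = (\<Sum>j\<in>UNIV. \<xi> j * (R *v x) $ j)"
  unfolding prior_parameter_def R_inner by (simp add: inner_vec_def)

lemma prior_parameter_line:
  "prior_parameter (\<xi>(k := t)) \<bullet> x = (\<Sum>j\<in>UNIV - {k}. \<xi> j * (R *v x) $ j) + t * (R *v x) $ k"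
proof -
  have "(\<Sum>j\<in>UNIV - {k}. (\<xi>(k := t)) j * (R *v x) $ j) = (\<Sum>j\<in>UNIV - {k}. \<xi> j * (R *v x) $ j)"
    by (rule sum.cong) auto
  then show ?thesis unfolding prior_parameter_inner by (subst sum.remove[of UNIV k]) auto
qed

text \<open>Conditional variance bound for an arbitrary guess \<open>c\<close>. Both sides are
  integrated against the unnormalized posterior, so the marginal likelihood is never divided
  out.\<close>

lemma posterior_second_moment_ge:
  assumes s: "0 < s" and \<tau>: "0 < \<tau>"
  shows "ennreal (1 / precision n s \<tau> k z) * (\<integral>\<^sup>+t. ennreal (likelihood n s (\<xi>(k := t)) z) \<partial>gauss \<tau>)
      \<le> (\<integral>\<^sup>+t. ennreal (likelihood n s (\<xi>(k := t)) z * (c - t)\<^sup>2) \<partial>gauss \<tau>)"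
proof -
  let ?a = "\<lambda>i. \<Sum>j\<in>UNIV - {k}. \<xi> j * (R *v fst (z i)) $ j" and ?w = "\<lambda>i. (R *v fst (z i)) $ k"
  have L: "likelihood n s (\<xi>(k := t)) z = (\<Prod>i<n. exp ((2 * snd (z i) * (?a i + t * ?w i) - (?a i + t * ?w i)\<^sup>2) / (2 * s\<^sup>2)))" for t
    by (simp add: likelihood_def gaussian_tilt_def prior_parameter_line)
  show ?thesis
  proof (rule gauss_tilted_second_moment_ge[OF precision_pos[OF \<tau>]])
    show "(\<lambda>t. likelihood n s (\<xi>(k := t)) z) \<in> borel_measurable borel" unfolding L by measurable
    show "likelihood n s (\<xi>(k := t)) z * normal_density 0 \<tau> t
      = 1 / sqrt (2 * pi * \<tau>\<^sup>2) * exp ((\<Sum>i<n. (2 * snd (z i) * ?a i - (?a i)\<^sup>2) / (2 * s\<^sup>2))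
        + (\<Sum>i<n. (snd (z i) - ?a i) * ?w i / s\<^sup>2) * t - precision n s \<tau> k z * t\<^sup>2 / 2)" for t
      unfolding L precision_def by (rule gaussian_likelihood_line[OF s])
  qed (auto simp: likelihood_pos less_imp_le)
qed

lemma measurable_sample_borel:
  assumes "f \<in> borel_measurable (\<Pi>\<^sub>M i\<in>I. (borel :: ((real ^ 'd) \<times> real) measure))"
  shows "f \<in> borel_measurable (\<Pi>\<^sub>M i\<in>I. PX \<Otimes>\<^sub>M gauss s)"
proof -
  have "sets (\<Pi>\<^sub>M i\<in>I. PX \<Otimes>\<^sub>M gauss s) = sets (\<Pi>\<^sub>M i\<in>I. (borel :: ((real ^ 'd) \<times> real) measure))"
    by (rule sets_PiM_cong) (auto simp only: sets_model)
  then show ?thesis using assms measurable_cong_sets[OF _ refl] by blast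
qed

lemma measurable_precision:
  "precision n s \<tau> k \<in> borel_measurable (\<Pi>\<^sub>M i\<in>{..<n}. (borel :: ((real ^ 'd) \<times> real) measure))"
proof -
  have [measurable]: "(\<lambda>p :: (real ^ 'd) \<times> real. (R *v fst p) $ k) \<in> borel_measurable borel"
    by (intro borel_measurable_vec_nth borel_measurable_matrix_vector borel_measurable_continuous_onI continuous_intros)
  have "(\<lambda>z. (R *v fst (z i)) $ k) \<in> borel_measurable (\<Pi>\<^sub>M i\<in>{..<n}. (borel :: ((real ^ 'd) \<times> real) measure))" if "i < n" for i
    using that by (intro measurable_compose[of "\<lambda>z. z i" _ borel "\<lambda>p. (R *v fst p) $ k"]) auto
  then show ?thesis unfolding precision_def by (intro borel_measurable_add borel_measurable_const borel_measurable_sum borel_measurable_divide borel_measurable_power) auto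
qed

lemma measurable_likelihood:
  "(\<lambda>p. likelihood n s (fst p) (snd p)) \<in> borel_measurable ((\<Pi>\<^sub>M k\<in>UNIV. gauss \<tau>) \<Otimes>\<^sub>M (\<Pi>\<^sub>M i\<in>{..<n}. PX \<Otimes>\<^sub>M gauss s'))"
proof -
  let ?M = "(\<Pi>\<^sub>M k\<in>(UNIV :: 'd set). gauss \<tau>) \<Otimes>\<^sub>M (\<Pi>\<^sub>M i\<in>{..<n}. PX \<Otimes>\<^sub>M gauss s')"
  have \<xi>: "(\<lambda>p. fst p k) \<in> borel_measurable ?M" for k
    using measurable_compose[OF measurable_fst measurable_component_singleton[of k UNIV "\<lambda>_. gauss \<tau>"]] by simp
  have z: "(\<lambda>p. h (snd p i)) \<in> borel_measurable ?M" if "h \<in> borel_measurable borel" "i < n" for i and h :: "(real ^ 'd) \<times> real \<Rightarrow> real"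
  proof -
    have "(\<lambda>p. snd p i) \<in> ?M \<rightarrow>\<^sub>M PX \<Otimes>\<^sub>M gauss s'"
      using that(2) by (intro measurable_compose[OF measurable_snd] measurable_component_singleton) auto
    then show ?thesis by (rule measurable_compose) (rule measurable_model[OF that(1)])
  qed
  have b: "(\<lambda>p :: (real ^ 'd) \<times> real. (R *v fst p) $ j) \<in> borel_measurable borel" "(snd :: (real ^ 'd) \<times> real \<Rightarrow> _) \<in> borel_measurable borel" for j
    by (intro borel_measurable_vec_nth borel_measurable_matrix_vector borel_measurable_continuous_onI continuous_intros)+
  show ?thesis unfolding likelihood_def gaussian_tilt_def prior_parameter_inner
    by (intro borel_measurable_prod measurable_compose[OF _ borel_measurable_exp] borel_measurable_divide borel_measurable_diff
        borel_measurable_times borel_measurable_power borel_measurable_const borel_measurable_sum \<xi> z b) auto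
qed

context
  fixes s :: real assumes s: "0 < s"
begin

lemma nn_integral_gaussian_sample:
  assumes h: "h \<in> borel_measurable (\<Pi>\<^sub>M i\<in>{..<n}. (borel :: ((real ^ 'd) \<times> real) measure))"
  shows "(\<integral>\<^sup>+z. h z \<partial>(\<Pi>\<^sub>M i\<in>{..<n}. gaussian_model PX s (prior_parameter \<xi>)))
    = (\<integral>\<^sup>+z. ennreal (likelihood n s \<xi> z) * h z \<partial>(\<Pi>\<^sub>M i\<in>{..<n}. PX \<Otimes>\<^sub>M gauss s))"
proof -
  let ?g = "\<lambda>p. ennreal (gaussian_tilt s (prior_parameter \<xi>) p)"
  have g: "?g \<in> borel_measurable (PX \<Otimes>\<^sub>M gauss s)"
    using measurable_model[OF borel_measurable_gaussian_tilt] by (rule measurable_compose) simp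
  have gz: "(\<lambda>z. \<Prod>i<n. ?g (z i)) \<in> borel_measurable (\<Pi>\<^sub>M i\<in>{..<n}. PX \<Otimes>\<^sub>M gauss s)"
  proof (rule borel_measurable_prod_ennreal)
    show "(\<lambda>z. ?g (z i)) \<in> borel_measurable (\<Pi>\<^sub>M i\<in>{..<n}. PX \<Otimes>\<^sub>M gauss s)" if "i \<in> {..<n}" for i
      using measurable_component_singleton[OF that, of "\<lambda>_. PX \<Otimes>\<^sub>M gauss s"] g by (rule measurable_compose)
  qed
  have "(\<Pi>\<^sub>M i\<in>{..<n}. gaussian_model PX s (prior_parameter \<xi>)) = density (\<Pi>\<^sub>M i\<in>{..<n}. PX \<Otimes>\<^sub>M gauss s) (\<lambda>z. \<Prod>i<n. ?g (z i))"
    unfolding gaussian_model_def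
    by (rule PiM_density[OF finite_lessThan prob_space_base[OF s] g])
       (rule jointD(1)[OF gaussian_model_joint[OF s], unfolded gaussian_model_def])
  then have "(\<integral>\<^sup>+z. h z \<partial>(\<Pi>\<^sub>M i\<in>{..<n}. gaussian_model PX s (prior_parameter \<xi>)))
      = (\<integral>\<^sup>+z. (\<Prod>i<n. ?g (z i)) * h z \<partial>(\<Pi>\<^sub>M i\<in>{..<n}. PX \<Otimes>\<^sub>M gauss s))"
    using nn_integral_density[OF gz measurable_sample_borel[OF h]] by simp
  then show ?thesis by (simp add: likelihood_def prod_ennreal less_imp_le)
qed

text \<open>Jensen for the reciprocal. Each squared whitened coordinate has mean 1, so the precision
  has the mean m on the left under every parameter \<beta>.\<close>

lemma expected_inverse_precision_ge:
  assumes \<tau>: "0 < \<tau>"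
  shows "ennreal (1 / (1 / \<tau>\<^sup>2 + n / s\<^sup>2))
    \<le> (\<integral>\<^sup>+z. ennreal (1 / precision n s \<tau> k z) \<partial>(\<Pi>\<^sub>M i\<in>{..<n}. gaussian_model PX s \<beta>))"
proof -
  let ?P = "gaussian_model PX s \<beta>"
  let ?S = "\<Pi>\<^sub>M i\<in>{..<n}. ?P"
  note J = gaussian_model_joint[OF s, of \<beta>]
  note P = jointD(1)[OF J]
  note [measurable] = jointD(4,5)[OF J]
  interpret S: prob_space ?S by (rule prob_space_PiM) (rule P)
  define m where "m = 1 / \<tau>\<^sup>2 + n / s\<^sup>2"
  have m: "0 < m" unfolding m_def using \<tau> by (intro add_pos_nonneg) auto
  have "sets ?S = sets (\<Pi>\<^sub>M i\<in>{..<n}. (borel :: ((real ^ 'd) \<times> real) measure))"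
    by (rule sets_PiM_cong) (auto simp: jointD(2)[OF J])
  then have pm[measurable]: "precision n s \<tau> k \<in> borel_measurable ?S"
    using measurable_precision measurable_cong_sets[OF _ refl] by blast
  have wm[measurable]: "(\<lambda>p. (R *v fst p) $ k) \<in> borel_measurable ?P"
    by (intro borel_measurable_vec_nth) measurable
  have w: "(\<integral>\<^sup>+z. ennreal (((R *v fst (z i)) $ k)\<^sup>2) \<partial>?S) = 1" if "i < n" for i
  proof -
    have "(\<integral>\<^sup>+z. ennreal (((R *v fst (z i)) $ k)\<^sup>2) \<partial>?S) = (\<integral>\<^sup>+p. ennreal (((R *v fst p) $ k)\<^sup>2) \<partial>?P)"
      using that by (intro nn_integral_PiM_component[OF P, of i "{..<n}" "\<lambda>p. ennreal (((R *v fst p) $ k)\<^sup>2)"]) auto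
    also have "\<dots> = (\<integral>\<^sup>+p. ennreal ((axis k 1 \<bullet> (R *v fst p))\<^sup>2) \<partial>?P)" by (simp add: inner_axis')
    also have "\<dots> = (\<integral>\<^sup>+x. ennreal ((axis k 1 \<bullet> (R *v x))\<^sup>2) \<partial>PX)"
      by (rule nn_integral_fst_joint[OF J, of "\<lambda>x. ennreal ((axis k 1 \<bullet> (R *v x))\<^sup>2)"]) measurable
    also have "\<dots> = 1" by (simp add: nn_moment norm_axis_1)
    finally show ?thesis .
  qed
  have wz: "(\<lambda>z. ((R *v fst (z i)) $ k)\<^sup>2) \<in> borel_measurable ?S" if "i < n" for i
  proof (rule borel_measurable_power)
    show "(\<lambda>z. (R *v fst (z i)) $ k) \<in> borel_measurable ?S"
      using measurable_component_singleton[of i "{..<n}" "\<lambda>_. ?P"] that by (intro measurable_compose[OF _ wm]) auto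
  qed
  have "(\<integral>\<^sup>+z. ennreal (precision n s \<tau> k z) \<partial>?S)
      = (\<integral>\<^sup>+z. ennreal (1 / \<tau>\<^sup>2) + (\<Sum>i<n. ennreal (1 / s\<^sup>2) * ennreal (((R *v fst (z i)) $ k)\<^sup>2)) \<partial>?S)"
    by (intro nn_integral_cong) (simp add: precision_def sum_nonneg ennreal_plus sum_ennreal flip: ennreal_mult)
  also have "\<dots> = ennreal (1 / \<tau>\<^sup>2) + (\<Sum>i<n. ennreal (1 / s\<^sup>2) * (\<integral>\<^sup>+z. ennreal (((R *v fst (z i)) $ k)\<^sup>2) \<partial>?S))"
  proof -
    have t: "(\<lambda>z. ennreal (1 / s\<^sup>2) * ennreal (((R *v fst (z i)) $ k)\<^sup>2)) \<in> borel_measurable ?S" if "i \<in> {..<n}" for i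
      using wz[of i] that by (intro borel_measurable_times_ennreal) auto
    have "(\<integral>\<^sup>+z. ennreal (1 / \<tau>\<^sup>2) + (\<Sum>i<n. ennreal (1 / s\<^sup>2) * ennreal (((R *v fst (z i)) $ k)\<^sup>2)) \<partial>?S)
        = ennreal (1 / \<tau>\<^sup>2) + (\<integral>\<^sup>+z. (\<Sum>i<n. ennreal (1 / s\<^sup>2) * ennreal (((R *v fst (z i)) $ k)\<^sup>2)) \<partial>?S)"
      using t by (subst nn_integral_add) (auto simp: S.emeasure_space_1 intro!: borel_measurable_sum)
    also have "(\<integral>\<^sup>+z. (\<Sum>i<n. ennreal (1 / s\<^sup>2) * ennreal (((R *v fst (z i)) $ k)\<^sup>2)) \<partial>?S)
        = (\<Sum>i<n. \<integral>\<^sup>+z. ennreal (1 / s\<^sup>2) * ennreal (((R *v fst (z i)) $ k)\<^sup>2) \<partial>?S)"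
      by (rule nn_integral_sum[OF t])
    also have "\<dots> = (\<Sum>i<n. ennreal (1 / s\<^sup>2) * (\<integral>\<^sup>+z. ennreal (((R *v fst (z i)) $ k)\<^sup>2) \<partial>?S))"
      using wz by (intro sum.cong refl nn_integral_cmult) auto
    finally show ?thesis .
  qed
  also have "(\<Sum>i<n. ennreal (1 / s\<^sup>2) * (\<integral>\<^sup>+z. ennreal (((R *v fst (z i)) $ k)\<^sup>2) \<partial>?S)) = (\<Sum>i<n. ennreal (1 / s\<^sup>2))"
    by (intro sum.cong) (auto simp: w)
  also have "\<dots> = ennreal (\<Sum>i<n. 1 / s\<^sup>2)" by (rule sum_ennreal) auto
  also have "ennreal (1 / \<tau>\<^sup>2) + \<dots> = ennreal m" by (simp add: m_def)
  finally have Eq: "(\<integral>\<^sup>+z. ennreal (precision n s \<tau> k z) \<partial>?S) = ennreal m" .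
  \<comment> \<open>The tangent inequality at m is used as 2 / m \<le> 1 / q + q / m^2, which avoids
    subtraction in extended reals; the mean of q is m, so one copy of 1 / m cancels.\<close>
  have "ennreal (1 / m) + ennreal (1 / m) = (\<integral>\<^sup>+z. ennreal (2 / m) \<partial>?S)"
    using m by (simp add: S.emeasure_space_1 flip: ennreal_plus)
  also have "\<dots> \<le> (\<integral>\<^sup>+z. ennreal (1 / precision n s \<tau> k z) + ennreal (1 / m\<^sup>2) * ennreal (precision n s \<tau> k z) \<partial>?S)"
  proof (rule nn_integral_mono)
    fix z
    define q where "q = precision n s \<tau> k z"
    have q: "0 < q" unfolding q_def by (rule precision_pos[OF \<tau>])
    have "0 \<le> (q - m)\<^sup>2 / (q * m\<^sup>2)" using q by simp
    also have "\<dots> = 1 / q + 1 / m\<^sup>2 * q - 2 / m" using q m by (simp add: field_simps power2_eq_square)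
    finally have "ennreal (2 / m) \<le> ennreal (1 / q + 1 / m\<^sup>2 * q)" by (intro ennreal_leI) simp
    also have "\<dots> = ennreal (1 / q) + ennreal (1 / m\<^sup>2) * ennreal q"
      using q by (subst ennreal_plus, simp, simp, subst ennreal_mult) auto
    finally show "ennreal (2 / m) \<le> ennreal (1 / precision n s \<tau> k z) + ennreal (1 / m\<^sup>2) * ennreal (precision n s \<tau> k z)"
      by (simp only: q_def)
  qed
  also have "\<dots> = (\<integral>\<^sup>+z. ennreal (1 / precision n s \<tau> k z) \<partial>?S) + ennreal (1 / m\<^sup>2) * ennreal m"
    unfolding Eq[symmetric] by (subst nn_integral_add) (measurable, simp add: nn_integral_cmult)
  also have "ennreal (1 / m\<^sup>2) * ennreal m = ennreal (1 / m)"
    using m by (simp add: power2_eq_square flip: ennreal_mult)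
  finally have "ennreal (1 / m) + ennreal (1 / m) \<le> ennreal (1 / m) + (\<integral>\<^sup>+z. ennreal (1 / precision n s \<tau> k z) \<partial>?S)"
    by (simp only: add.commute)
  then have "ennreal (1 / m) \<le> (\<integral>\<^sup>+z. ennreal (1 / precision n s \<tau> k z) \<partial>?S)"
    by (simp only: ennreal_add_left_cancel_le) simp
  then show ?thesis by (simp only: m_def)
qed

text \<open>For each parameter the mean of 1 / precision is bounded below. After the change to the
  parameter-free base measure, Tonelli puts the prior inside; there the data and hence the guess
  \<open>c z\<close> are fixed, and the variance bound applies along coordinate
  \<open>k\<close>.\<close>

lemma bayes_coordinate_risk_ge:
  assumes \<tau>: "0 < \<tau>" and c: "c \<in> borel_measurable (\<Pi>\<^sub>M i\<in>{..<n}. (borel :: ((real ^ 'd) \<times> real) measure))"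
  shows "ennreal (1 / (1 / \<tau>\<^sup>2 + n / s\<^sup>2))
    \<le> (\<integral>\<^sup>+\<xi>. \<integral>\<^sup>+z. ennreal (likelihood n s \<xi> z * (c z - \<xi> k)\<^sup>2) \<partial>(\<Pi>\<^sub>M i\<in>{..<n}. PX \<Otimes>\<^sub>M gauss s) \<partial>(\<Pi>\<^sub>M k\<in>(UNIV :: 'd set). gauss \<tau>))"
proof -
  let ?E = "\<Pi>\<^sub>M k\<in>(UNIV :: 'd set). gauss \<tau>" and ?Z = "\<Pi>\<^sub>M i\<in>{..<n}. PX \<Otimes>\<^sub>M gauss s"
  let ?L = "\<lambda>\<xi> z. likelihood n s \<xi> z" and ?q = "precision n s \<tau> k"
  interpret E: prob_space ?E by (rule prob_space_PiM) (rule prob_space_gauss[OF \<tau>])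
  interpret Z: prob_space ?Z by (rule prob_space_PiM) (rule prob_space_base[OF s])
  interpret EZ: pair_sigma_finite ?E ?Z ..
  have L[measurable]: "(\<lambda>p. ?L (fst p) (snd p)) \<in> borel_measurable (?E \<Otimes>\<^sub>M ?Z)" by (rule measurable_likelihood)
  have qZ[measurable]: "?q \<in> borel_measurable ?Z" by (rule measurable_sample_borel[OF measurable_precision])
  have cZ[measurable]: "c \<in> borel_measurable ?Z" by (rule measurable_sample_borel[OF c])
  have kE[measurable]: "(\<lambda>\<xi>. \<xi> k) \<in> borel_measurable ?E"
    using measurable_component_singleton[of k UNIV "\<lambda>_. gauss \<tau>"] by simp
  have F[measurable]: "(\<lambda>p. ?L (fst p) (snd p) * (c (snd p) - (fst p) k)\<^sup>2) \<in> borel_measurable (?E \<Otimes>\<^sub>M ?Z)"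
    by (intro borel_measurable_times L borel_measurable_power borel_measurable_diff
        measurable_compose[OF measurable_snd cZ] measurable_compose[OF measurable_fst kE])
  have G[measurable]: "(\<lambda>p. ennreal (1 / ?q (snd p)) * ennreal (?L (fst p) (snd p))) \<in> borel_measurable (?E \<Otimes>\<^sub>M ?Z)"
  proof -
    have "(\<lambda>p. ?q (snd p)) \<in> borel_measurable (?E \<Otimes>\<^sub>M ?Z)" by (rule measurable_compose[OF measurable_snd qZ])
    then show ?thesis using L by measurable
  qed
  have "ennreal (1 / (1 / \<tau>\<^sup>2 + n / s\<^sup>2)) = (\<integral>\<^sup>+\<xi>. ennreal (1 / (1 / \<tau>\<^sup>2 + n / s\<^sup>2)) \<partial>?E)"
    by (simp add: E.emeasure_space_1)
  also have "\<dots> \<le> (\<integral>\<^sup>+\<xi>. \<integral>\<^sup>+z. ennreal (1 / ?q z) * ennreal (?L \<xi> z) \<partial>?Z \<partial>?E)"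
  proof (rule nn_integral_mono)
    fix \<xi>
    have qb: "(\<lambda>z. ennreal (1 / ?q z)) \<in> borel_measurable (\<Pi>\<^sub>M i\<in>{..<n}. (borel :: ((real ^ 'd) \<times> real) measure))"
      using measurable_precision by measurable
    show "ennreal (1 / (1 / \<tau>\<^sup>2 + n / s\<^sup>2)) \<le> (\<integral>\<^sup>+z. ennreal (1 / ?q z) * ennreal (?L \<xi> z) \<partial>?Z)"
      using expected_inverse_precision_ge[OF \<tau>, of n "prior_parameter \<xi>" k]
      unfolding nn_integral_gaussian_sample[OF qb] by (simp only: mult.commute)
  qed
  also have "\<dots> = (\<integral>\<^sup>+z. \<integral>\<^sup>+\<xi>. ennreal (1 / ?q z) * ennreal (?L \<xi> z) \<partial>?E \<partial>?Z)"
    by (rule EZ.Fubini'[symmetric]) (use G in \<open>simp add: case_prod_beta'\<close>)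
  also have "\<dots> \<le> (\<integral>\<^sup>+z. \<integral>\<^sup>+\<xi>. ennreal (?L \<xi> z * (c z - \<xi> k)\<^sup>2) \<partial>?E \<partial>?Z)"
  proof (rule nn_integral_mono)
    fix z assume z: "z \<in> space ?Z"
    have Lz: "(\<lambda>\<xi>. ?L \<xi> z) \<in> borel_measurable ?E"
      using measurable_compose[OF measurable_Pair2'[OF z] L] by simp
    have Fz: "(\<lambda>\<xi>. ?L \<xi> z * (c z - \<xi> k)\<^sup>2) \<in> borel_measurable ?E"
      using measurable_compose[OF measurable_Pair2'[OF z] F] by simp
    have fu: "(\<lambda>t. \<xi>(k := t)) \<in> gauss \<tau> \<rightarrow>\<^sub>M ?E" if "\<xi> \<in> space ?E" for \<xi>
      using that by (intro measurable_fun_upd[where J=UNIV and I=UNIV]) auto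
    \<comment> \<open>Resampling coordinate \<open>k\<close> of the product prior exposes a
      one-dimensional Gaussian integral with the other coefficients frozen; the next comparison acts
      there, and the same identity then restores the full prior.\<close>
    have "(\<integral>\<^sup>+\<xi>. ennreal (1 / ?q z) * ennreal (?L \<xi> z) \<partial>?E)
        = (\<integral>\<^sup>+\<xi>. \<integral>\<^sup>+t. ennreal (1 / ?q z) * ennreal (?L (\<xi>(k := t)) z) \<partial>gauss \<tau> \<partial>?E)"
      using Lz by (intro nn_integral_PiM_resample[OF prob_space_gauss[OF \<tau>], of k UNIV "\<lambda>\<xi>. ennreal (1 / ?q z) * ennreal (?L \<xi> z)"]) auto
    also have "\<dots> \<le> (\<integral>\<^sup>+\<xi>. \<integral>\<^sup>+t. ennreal (?L (\<xi>(k := t)) z * (c z - (\<xi>(k := t)) k)\<^sup>2) \<partial>gauss \<tau> \<partial>?E)"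
    proof (rule nn_integral_mono)
      fix \<xi> assume \<xi>: "\<xi> \<in> space ?E"
      have "(\<lambda>t. ?L (\<xi>(k := t)) z) \<in> borel_measurable (gauss \<tau>)" by (rule measurable_compose[OF fu[OF \<xi>] Lz])
      then have "(\<integral>\<^sup>+t. ennreal (1 / ?q z) * ennreal (?L (\<xi>(k := t)) z) \<partial>gauss \<tau>) = ennreal (1 / ?q z) * (\<integral>\<^sup>+t. ennreal (?L (\<xi>(k := t)) z) \<partial>gauss \<tau>)"
        by (intro nn_integral_cmult measurable_compose[OF _ measurable_ennreal])
      also have "\<dots> \<le> (\<integral>\<^sup>+t. ennreal (?L (\<xi>(k := t)) z * (c z - t)\<^sup>2) \<partial>gauss \<tau>)"
        by (rule posterior_second_moment_ge[OF s \<tau>])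
      finally show "(\<integral>\<^sup>+t. ennreal (1 / ?q z) * ennreal (?L (\<xi>(k := t)) z) \<partial>gauss \<tau>)
          \<le> (\<integral>\<^sup>+t. ennreal (?L (\<xi>(k := t)) z * (c z - (\<xi>(k := t)) k)\<^sup>2) \<partial>gauss \<tau>)" by simp
    qed
    also have "\<dots> = (\<integral>\<^sup>+\<xi>. ennreal (?L \<xi> z * (c z - \<xi> k)\<^sup>2) \<partial>?E)"
      using Fz by (intro nn_integral_PiM_resample[OF prob_space_gauss[OF \<tau>], of k UNIV "\<lambda>\<xi>. ennreal (?L \<xi> z * (c z - \<xi> k)\<^sup>2)", symmetric]) auto
    finally show "(\<integral>\<^sup>+\<xi>. ennreal (1 / ?q z) * ennreal (?L \<xi> z) \<partial>?E) \<le> (\<integral>\<^sup>+\<xi>. ennreal (?L \<xi> z * (c z - \<xi> k)\<^sup>2) \<partial>?E)" .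
  qed
  also have "\<dots> = (\<integral>\<^sup>+\<xi>. \<integral>\<^sup>+z. ennreal (?L \<xi> z * (c z - \<xi> k)\<^sup>2) \<partial>?Z \<partial>?E)"
    by (rule EZ.Fubini') (use F in \<open>simp add: case_prod_beta'\<close>)
  finally show ?thesis .
qed

text \<open>The prior is a probability measure on parameters whose models all belong to the class,
  so the supremum dominates the average risk, which is the sum of the coordinate risks.\<close>

lemma sup_risk_ge_bayes:
  assumes b: "b \<in> estimators n" and \<tau>: "0 < \<tau>"
  shows "ennreal (real CARD('d) * (1 / (1 / \<tau>\<^sup>2 + n / s\<^sup>2))) \<le> (SUP P\<in>P_mis PX (s\<^sup>2). expected_excess_risk n P b)"
proof -
  let ?E = "\<Pi>\<^sub>M k\<in>(UNIV :: 'd set). gauss \<tau>" and ?Z = "\<Pi>\<^sub>M i\<in>{..<n}. PX \<Otimes>\<^sub>M gauss s"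
  let ?B = "\<Pi>\<^sub>M i\<in>{..<n}. (borel :: ((real ^ 'd) \<times> real) measure)"
  interpret E: prob_space ?E by (rule prob_space_PiM) (rule prob_space_gauss[OF \<tau>])
  interpret Z: prob_space ?Z by (rule prob_space_PiM) (rule prob_space_base[OF s])
  define c where "c k z = (T *v b z) $ k" for k z
  define F where "F k \<xi> z = ennreal (likelihood n s \<xi> z * (c k z - \<xi> k)\<^sup>2)" for k \<xi> z
  have bB[measurable]: "b \<in> borel_measurable ?B" using b by (simp add: estimators_def)
  have cB[measurable]: "c k \<in> borel_measurable ?B" for k
    unfolding c_def by (intro borel_measurable_vec_nth) measurable
  have FEZ: "(\<lambda>p. F k (fst p) (snd p)) \<in> borel_measurable (?E \<Otimes>\<^sub>M ?Z)" for k
  proof -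
    have kE: "(\<lambda>\<xi>. \<xi> k) \<in> borel_measurable ?E"
      using measurable_component_singleton[of k UNIV "\<lambda>_. gauss \<tau>"] by simp
    have "(\<lambda>p. likelihood n s (fst p) (snd p) * (c k (snd p) - (fst p) k)\<^sup>2) \<in> borel_measurable (?E \<Otimes>\<^sub>M ?Z)"
      by (intro borel_measurable_times measurable_likelihood borel_measurable_power borel_measurable_diff
        measurable_compose[OF measurable_snd measurable_sample_borel[OF cB]] measurable_compose[OF measurable_fst kE])
    then show ?thesis unfolding F_def by measurable
  qed
  have risk: "expected_excess_risk n (gaussian_model PX s (prior_parameter \<xi>)) b = (\<Sum>k\<in>UNIV. \<integral>\<^sup>+z. F k \<xi> z \<partial>?Z)"
    if \<xi>: "\<xi> \<in> space ?E" for \<xi>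
  proof -
    let ?P = "gaussian_model PX s (prior_parameter \<xi>)"
    have ex: "excess_risk ?P (b z) = (\<Sum>k\<in>UNIV. (c k z - \<xi> k)\<^sup>2)" for z
    proof -
      have "excess_risk ?P (b z) = (norm (T *v (b z - prior_parameter \<xi>)))\<^sup>2"
        using excess_risk_eq[OF gaussian_model_joint[OF s] gaussian_model_P_mis(3)[OF s]] by (simp add: gaussian_model_P_mis(2)[OF s])
      also have "T *v (b z - prior_parameter \<xi>) = (\<chi> k. c k z - \<xi> k)"
        by (simp add: prior_parameter_def matrix_vector_mult_diff_distrib c_def vec_eq_iff)
      finally have "excess_risk ?P (b z) = (\<chi> k. c k z - \<xi> k) \<bullet> (\<chi> k. c k z - \<xi> k)" by (simp only: power2_norm_eq_inner)
      then show ?thesis by (simp add: inner_vec_def power2_eq_square)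
    qed
    have "expected_excess_risk n ?P b = (\<integral>\<^sup>+z. ennreal (likelihood n s \<xi> z) * ennreal (\<Sum>k\<in>UNIV. (c k z - \<xi> k)\<^sup>2) \<partial>?Z)"
      unfolding expected_excess_risk_def ex by (rule nn_integral_gaussian_sample) measurable
    also have "\<dots> = (\<integral>\<^sup>+z. (\<Sum>k\<in>UNIV. F k \<xi> z) \<partial>?Z)"
    proof (rule nn_integral_cong)
      fix z
      have "ennreal (likelihood n s \<xi> z) * ennreal (\<Sum>k\<in>UNIV. (c k z - \<xi> k)\<^sup>2) = ennreal (\<Sum>k\<in>UNIV. likelihood n s \<xi> z * (c k z - \<xi> k)\<^sup>2)"
        by (subst ennreal_mult[symmetric]) (auto simp: likelihood_pos less_imp_le sum_nonneg sum_distrib_left)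
      also have "\<dots> = (\<Sum>k\<in>UNIV. F k \<xi> z)"
        unfolding F_def by (rule sum_ennreal[symmetric]) (simp add: likelihood_pos less_imp_le)
      finally show "ennreal (likelihood n s \<xi> z) * ennreal (\<Sum>k\<in>UNIV. (c k z - \<xi> k)\<^sup>2) = (\<Sum>k\<in>UNIV. F k \<xi> z)" .
    qed
    also have "\<dots> = (\<Sum>k\<in>UNIV. \<integral>\<^sup>+z. F k \<xi> z \<partial>?Z)"
    proof (rule nn_integral_sum)
      show "(\<lambda>z. F k \<xi> z) \<in> borel_measurable ?Z" for k
        using measurable_compose[OF measurable_Pair1'[OF \<xi>] FEZ[of k]] by simp
    qed
    finally show ?thesis .
  qed
  have "ennreal (real CARD('d) * (1 / (1 / \<tau>\<^sup>2 + n / s\<^sup>2))) = (\<Sum>k\<in>(UNIV :: 'd set). ennreal (1 / (1 / \<tau>\<^sup>2 + n / s\<^sup>2)))"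
    by (subst sum_ennreal) auto
  also have "\<dots> \<le> (\<Sum>k\<in>UNIV. \<integral>\<^sup>+\<xi>. \<integral>\<^sup>+z. F k \<xi> z \<partial>?Z \<partial>?E)"
    unfolding F_def by (intro sum_mono bayes_coordinate_risk_ge \<tau> cB)
  also have "\<dots> = (\<integral>\<^sup>+\<xi>. (\<Sum>k\<in>UNIV. \<integral>\<^sup>+z. F k \<xi> z \<partial>?Z) \<partial>?E)"
    using Z.borel_measurable_nn_integral_fst[OF FEZ] by (intro nn_integral_sum[symmetric]) simp
  also have "\<dots> \<le> (\<integral>\<^sup>+\<xi>. (SUP P\<in>P_mis PX (s\<^sup>2). expected_excess_risk n P b) \<partial>?E)"
  proof (rule nn_integral_mono)
    show "(\<Sum>k\<in>UNIV. \<integral>\<^sup>+z. F k \<xi> z \<partial>?Z) \<le> (SUP P\<in>P_mis PX (s\<^sup>2). expected_excess_risk n P b)" if "\<xi> \<in> space ?E" for \<xi>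
      unfolding risk[OF that, symmetric] by (rule SUP_upper[OF gaussian_model_P_mis(1)[OF s]])
  qed
  also have "\<dots> = (SUP P\<in>P_mis PX (s\<^sup>2). expected_excess_risk n P b)" by (simp add: E.emeasure_space_1)
  finally show ?thesis .
qed

text \<open>The Bayes bounds with \<tau> = 1, 2, 3, ... increase to the claim as the prior flattens;
  \<open>Suc j\<close> keeps \<tau> positive.\<close>

lemma minimax_lower_bound:
  assumes b: "b \<in> estimators n" and n: "0 < n"
  shows "ennreal (s\<^sup>2 * real CARD('d) / n) \<le> (SUP P\<in>P_mis PX (s\<^sup>2). expected_excess_risk n P b)"
proof (rule LIMSEQ_le_const2)
  have "(\<lambda>j. 1 / (real (Suc j))\<^sup>2) \<longlonglongrightarrow> 0"
    using tendsto_power[OF lim_inverse_n'[THEN LIMSEQ_Suc], of 2] by (simp add: power_divide)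
  then have "(\<lambda>j. real CARD('d) * (1 / (1 / (real (Suc j))\<^sup>2 + n / s\<^sup>2))) \<longlonglongrightarrow> real CARD('d) * (1 / (0 + n / s\<^sup>2))"
    using n s by (intro tendsto_intros) auto
  then show "(\<lambda>j. ennreal (real CARD('d) * (1 / (1 / (real (Suc j))\<^sup>2 + n / s\<^sup>2)))) \<longlonglongrightarrow> ennreal (s\<^sup>2 * real CARD('d) / n)"
    by (intro tendsto_ennrealI) (simp add: mult.commute)
  show "\<exists>N. \<forall>j\<ge>N. ennreal (real CARD('d) * (1 / (1 / (real (Suc j))\<^sup>2 + n / s\<^sup>2))) \<le> (SUP P\<in>P_mis PX (s\<^sup>2). expected_excess_risk n P b)"
    by (intro exI allI impI sup_risk_ge_bayes[OF b]) simp
qed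

end

end

theorem proposition3:
  fixes PX :: "(real ^ 'd) measure" and n :: nat and \<sigma> C \<alpha> \<kappa> C' :: real
  assumes n: "1 \<le> n"
    and sigma: "0 < \<sigma>\<^sup>2"
    and PX: "prob_space PX" "sets PX = sets borel"
    and sq_int: "integrable PX (\<lambda>x. (norm x)\<^sup>2)"
    and inv: "invertible (second_moment PX)"
    and C: "1 \<le> C"
    and \<alpha>: "0 < \<alpha>" "\<alpha> \<le> 1"
    and sb: "small_ball PX C \<alpha>"
    and \<kappa>: "0 < \<kappa>"
    and L24: "L2_L4_equiv PX \<kappa>"
    and C': "C' = 3 * C ^ 4 * exp (1 + 9 / \<alpha>)"
    and n_large: "real n \<ge> max 96 (6 * real CARD('d)) / \<alpha>"
  shows "(\<forall>P \<in> joint_distributions PX. integrable P (\<lambda>p. (snd p)\<^sup>2) \<longrightarrow>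
            chi_moment P \<le> (\<integral>\<^sup>+p. ennreal (residual P p ^ 4 * whitened_norm P p ^ 4) \<partial>P)
                              / ennreal (real CARD('d) ^ 2) \<and>
            (chi_moment P < \<infinity> \<longrightarrow>
              expected_excess_risk n P (ols_estimator n)
                \<le> ennreal (1 / real n) *
                    (\<integral>\<^sup>+p. ennreal ((residual P p)\<^sup>2 * (whitened_norm P p)\<^sup>2) \<partial>P)
                  + ennreal (276 * C'\<^sup>2 * sqrt (\<kappa> * enn2real (chi_moment P))
                             * (real CARD('d) / real n) powr (3 / 2))))
       \<and> ennreal (\<sigma>\<^sup>2 * real CARD('d) / real n)
            \<le> (INF b \<in> estimators n. SUP P \<in> P_mis PX (\<sigma>\<^sup>2). expected_excess_risk n P b)
       \<and> (INF b \<in> estimators n. SUP P \<in> P_mis PX (\<sigma>\<^sup>2). expected_excess_risk n P b)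
            \<le> ennreal (\<sigma>\<^sup>2 * real CARD('d) / real n *
                         (1 + 276 * C'\<^sup>2 * \<kappa> * sqrt (real CARD('d) / real n)))"
proof -
  interpret design PX
    by (intro design.intro design_axioms.intro PX sq_int inv)
  note ols = sb C \<alpha> \<kappa> L24 n_large C'
  have "chi_moment P \<le> (\<integral>\<^sup>+p. ennreal (residual P p ^ 4 * whitened_norm P p ^ 4) \<partial>P) / ennreal (real CARD('d) ^ 2)"
    if "P \<in> joint_distributions PX" "integrable P (\<lambda>p. (snd p)\<^sup>2)" for P
    unfolding chi_moment_def whitened_norm_eq[OF that(1)]
    by (intro divide_right_mono_ennreal cond_exp_square_le[OF that L24 \<kappa>])
  moreover have "expected_excess_risk n P (ols_estimator n)
      \<le> ennreal (1 / real n) * (\<integral>\<^sup>+p. ennreal ((residual P p)\<^sup>2 * (whitened_norm P p)\<^sup>2) \<partial>P)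
        + ennreal (276 * C'\<^sup>2 * sqrt (\<kappa> * enn2real (chi_moment P)) * (real CARD('d) / real n) powr (3 / 2))"
    if "P \<in> joint_distributions PX" "integrable P (\<lambda>p. (snd p)\<^sup>2)" "chi_moment P < \<infinity>" for P
    using expected_excess_risk_ols_le[OF that(1,2) ols that(3)] .
  moreover have "ennreal (\<sigma>\<^sup>2 * real CARD('d) / real n) \<le> (INF b\<in>estimators n. SUP P\<in>P_mis PX (\<sigma>\<^sup>2). expected_excess_risk n P b)"
  proof (rule INF_greatest)
    \<comment> \<open>Only \<open>0 < \<sigma>\<^sup>2\<close> is known, so the positive standard
      deviation of the Gaussian noise is taken to be \<open>\<bar>\<sigma>\<bar>\<close>.\<close>
    show "ennreal (\<sigma>\<^sup>2 * real CARD('d) / real n) \<le> (SUP P\<in>P_mis PX (\<sigma>\<^sup>2). expected_excess_risk n P b)" if "b \<in> estimators n" for b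
      using minimax_lower_bound[of "\<bar>\<sigma>\<bar>" b n] that n sigma by simp
  qed
  moreover have "(INF b\<in>estimators n. SUP P\<in>P_mis PX (\<sigma>\<^sup>2). expected_excess_risk n P b)
      \<le> ennreal (\<sigma>\<^sup>2 * real CARD('d) / real n * (1 + 276 * C'\<^sup>2 * \<kappa> * sqrt (real CARD('d) / real n)))"
    by (rule INF_lower2[OF ols_estimator_estimators], rule SUP_least)
       (rule ols_risk_P_mis_le[OF _ sigma sb C \<alpha> \<kappa> L24 n_large C'])
  ultimately show ?thesis by blast
qed

end
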